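(* Let $D$ be a domain in $\mathbb{R}^n$, $n\ge 2$, let $Q:D\to(0,\infty)$ be a measurable function, let $x_1,x_2\in D$ with $x_1\ne x_2$ and $y_1,y_2\in\mathbb{R}^n$ with $y_1\ne y_2$. Let $\mathfrak{R}_Q$ be the class of all ring $Q$-homeomorphisms $f$ from $D$ into $\mathbb{R}^n$ satisfying $f(x_1)=y_1$ and $f(x_2)=y_2$. If $Q\in \mathrm{FMO}(D)$, then the class $\mathfrak{R}_Q$ is compact.
   Context: Let $\overline{\mathbb{R}^n}=\mathbb{R}^n\cup\{\infty\}$ with the spherical (chordal) metric $h(x,y)=\frac{|x-y|}{\sqrt{1+|x|^2}\sqrt{1+|y|^2}}$ for $x,y\ne\infty$, $h(x,\infty)=\frac{1}{\sqrt{1+|x|^2}}$. A homeomorphism of $D$ into a space means a homeomorphism of $D$ onto its image. Modulus: for a family $\Gamma$ of paths, a Borel function $\rho:\mathbb{R}^n\to[0,\infty]$ is admissible for $\Gamma$ if $\int_\gamma\rho(x)\,|dx|\ge1$ for each (locally rectifiable) $\gamma\in\Gamma$ (paths that are not locally rectifiable or that pass through $\infty$ are disregarded), and $M(\Gamma)=\inf_{\rho\text{ admissible}}\int_{\mathbb{R}^n}\rho^n\,dm$, where $m$ is Lebesgue measure. $\Gamma(E,F)$ denotes the family of all paths $\gamma:[a,b]\to\overline{\mathbb{R}^n}$ with $\gamma(a)\in E$, $\gamma(b)\in F$. Ring $Q$-homeomorphism: let $A(x_0,r_1,r_2)=\{x\in\mathbb{R}^n:r_1<|x-x_0|<r_2\}$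 and $S(x_0,r)=\{x\in\mathbb{R}^n:|x-x_0|=r\}$. A homeomorphism $f$ of $D$ into $\overline{\mathbb{R}^n}$ is a ring $Q$-homeomorphism at $x_0\in D$ if $M(\Gamma(f(S_1),f(S_2)))\le\int_A Q(x)\,\eta^n(|x-x_0|)\,dm(x)$ for every ring $A=A(x_0,r_1,r_2)$ with $0<r_1<r_2<\mathrm{dist}(x_0,\partial D)$, $S_i=S(x_0,r_i)$, $i=1,2$, and every Lebesgue measurable $\eta:(r_1,r_2)\to[0,\infty]$ with $\int_{r_1}^{r_2}\eta(r)\,dr\ge1$. $f$ is a ring $Q$-homeomorphism (in $D$) if this holds at every $x_0\in D$. Finite mean oscillation: $\varphi:D\to\mathbb{R}$ has finite mean oscillation at $x_0\in D$ if $\limsup_{\varepsilon\to0}\frac{1}{|B(x_0,\varepsilon)|}\int_{B(x_0,\varepsilon)}|\varphi(x)-\widetilde{\varphi_\varepsilon}|\,dm(x)<\infty$, where $\widetilde{\varphi_\varepsilon}$ is the average of $\varphi$ over the ball $B(x_0,\varepsilon)=\{x:|x-x_0|<\varepsilon\}$ (so $\varphi$ is integrable over small balls centred at $x_0$). $\varphi\in\mathrm{FMO}(D)$ if this holds at every $x_0\in D$. Compactness: a class of mappings is normal if every sequence in it contains a subsequence converging locally uniformly (i.e. uniformly on compact subsets of $D$, with respect to $h$); it is closed if the limit of every locally uniformly convergent sequence of its members belongs to the class; it is compact if it is normal and closed. *)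

theory Defs
  imports "HOL-Analysis.Analysis"
begin

section \<open>The extended space with the chordal metric\<close>

datatype 'a ext_space = Point (the_point: 'a) | Infpt

fun chordal_dist :: "'a::real_inner ext_space \<Rightarrow> 'a ext_space \<Rightarrow> real" where
  "chordal_dist (Point x) (Point y) =
     norm (x - y) / (sqrt (1 + (norm x)\<^sup>2) * sqrt (1 + (norm y)\<^sup>2))"
| "chordal_dist (Point x) Infpt = 1 / sqrt (1 + (norm x)\<^sup>2)"
| "chordal_dist Infpt (Point y) = 1 / sqrt (1 + (norm y)\<^sup>2)"
| "chordal_dist Infpt Infpt = 0"

text \<open>Stereographic projection onto the sphere of diameter 1, used to derive the triangle
  inequality.\<close>

fun stereo :: "'a::real_inner ext_space \<Rightarrow> 'a \<times> real" where
  "stereo (Point x) = ((1 / (1 + (norm x)\<^sup>2)) *\<^sub>R x, 1 - 1 / (1 + (norm x)\<^sup>2))"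
| "stereo Infpt = (0, 1)"

lemma chordal_dist_stereo: "chordal_dist p q = dist (stereo p) (stereo q)"
proof -
  have inf: "1 / sqrt (1 + (norm x)\<^sup>2) =
      sqrt ((norm ((1 / (1 + (norm x)\<^sup>2)) *\<^sub>R x))\<^sup>2 + (1 / (1 + (norm x)\<^sup>2))\<^sup>2)" for x :: 'a
  proof -
    define s where "s = 1 + (norm x)\<^sup>2"
    have s: "s > 0" "(norm x)\<^sup>2 = s - 1" by (auto simp: s_def add_pos_nonneg)
    have "(norm ((1 / s) *\<^sub>R x))\<^sup>2 = (s - 1) / s\<^sup>2"
      using s by (simp add: power_divide)
    then have "(norm ((1 / s) *\<^sub>R x))\<^sup>2 + (1 / s)\<^sup>2 = 1 / s"
      using s(1) by (simp add: power_divide power2_eq_square add_divide_distrib[symmetric])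
    then show ?thesis by (simp add: s_def[symmetric] real_sqrt_divide)
  qed
  show ?thesis
  proof (cases p; cases q)
    fix x y assume [simp]: "p = Point x" "q = Point y"
    define s where "s = 1 + (norm x)\<^sup>2"
    define t where "t = 1 + (norm y)\<^sup>2"
    have s: "s > 0" "x \<bullet> x = s - 1" and t: "t > 0" "y \<bullet> y = t - 1"
      by (auto simp: s_def t_def add_pos_nonneg power2_norm_eq_inner add_pos_nonneg)
    have 1: "(norm ((1 / s) *\<^sub>R x - (1 / t) *\<^sub>R y))\<^sup>2 =
        (s - 1) / s\<^sup>2 + (t - 1) / t\<^sup>2 - 2 * (x \<bullet> y) / (s * t)"
      unfolding power2_norm_eq_inner
      using s(1) t(1)
      by (simp add: inner_diff_left inner_diff_right s(2) t(2) inner_commute[of y x]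
          power2_eq_square field_simps)
    have 2: "(norm (x - y))\<^sup>2 = s + t - 2 - 2 * (x \<bullet> y)"
      unfolding power2_norm_eq_inner
      by (simp add: inner_diff_left inner_diff_right s t inner_commute[of y x])
    have "(norm ((1 / s) *\<^sub>R x - (1 / t) *\<^sub>R y))\<^sup>2 + (1 / t - 1 / s)\<^sup>2 = (norm (x - y))\<^sup>2 / (s * t)"
      unfolding 1 2 using s(1) t(1) by (simp add: field_simps power2_eq_square)
    then have "sqrt ((norm ((1 / s) *\<^sub>R x - (1 / t) *\<^sub>R y))\<^sup>2 + (1 / t - 1 / s)\<^sup>2) =
        norm (x - y) / (sqrt s * sqrt t)"
      by (simp add: real_sqrt_divide real_sqrt_mult)
    then show ?thesis
      by (simp add: dist_Pair_Pair dist_norm norm_Pair s_def[symmetric] t_def[symmetric])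
  next
    fix x assume "p = Point x" "q = Infpt"
    then show ?thesis
      using inf[of x] by (simp add: dist_Pair_Pair dist_norm norm_Pair)
  next
    fix y assume "p = Infpt" "q = Point y"
    then show ?thesis
      using inf[of y] by (simp add: dist_Pair_Pair dist_norm norm_Pair)
  qed simp
qed

lemma chordal_dist_eq_0_iff: "chordal_dist p q = 0 \<longleftrightarrow> p = q"
proof -
  have "sqrt (1 + (norm x)\<^sup>2) \<noteq> 0" for x :: 'a
    by (simp add: add_nonneg_eq_0_iff)
  then show ?thesis by (cases p; cases q) auto
qed

instantiation ext_space :: (real_inner) metric_space
begin

definition dist_ext_space :: "'a ext_space \<Rightarrow> 'a ext_space \<Rightarrow> real" where
  "dist_ext_space = chordal_dist"

definition uniformity_ext_space :: "('a ext_space \<times> 'a ext_space) filter" where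
  "uniformity_ext_space = (INF e\<in>{0 <..}. principal {(x, y). dist x y < e})"

definition open_ext_space :: "'a ext_space set \<Rightarrow> bool" where
  "open_ext_space U \<longleftrightarrow> (\<forall>x\<in>U. \<forall>\<^sub>F (x', y) in uniformity. x' = x \<longrightarrow> y \<in> U)"

instance
proof
  fix p q r :: "'a ext_space"
  show "dist p q = 0 \<longleftrightarrow> p = q"
    by (simp add: dist_ext_space_def chordal_dist_eq_0_iff)
  show "dist p q \<le> dist p r + dist q r"
    by (simp add: dist_ext_space_def chordal_dist_stereo dist_triangle2)
qed (simp_all add: uniformity_ext_space_def open_ext_space_def)

end


section \<open>Path families and their modulus\<close>

text \<open>The triple \<open>(a, b, \<gamma>)\<close> stands for the path \<open>\<gamma> : [a, b] \<rightarrow> \<close> extended space;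
  values of \<open>\<gamma>\<close> outside \<open>[a, b]\<close> play no role.\<close>

type_synonym 'a ext_path = "real \<times> real \<times> (real \<Rightarrow> 'a ext_space)"

definition path_family :: "'a::real_inner ext_space set \<Rightarrow> 'a ext_space set \<Rightarrow> 'a ext_path set" where
  "path_family E F = {(a, b, \<gamma>). a < b \<and> continuous_on {a..b} \<gamma> \<and> \<gamma> a \<in> E \<and> \<gamma> b \<in> F}"

definition curve_length :: "(real \<Rightarrow> 'a::real_normed_vector) \<Rightarrow> real \<Rightarrow> real \<Rightarrow> ennreal" where
  "curve_length c a b =
     (SUP (N, t) \<in> {(N :: nat, t :: nat \<Rightarrow> real). t 0 = a \<and> t N = b \<and> (\<forall>i<N. t i \<le> t (Suc i))}.
        \<Sum>i<N. ennreal (norm (c (t (Suc i)) - c (t i))))"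

text \<open>The arc-length parametrization: the point of the curve reached after length \<open>s\<close>. The
  parameter \<open>t\<close> need not be unique, but the point \<open>c t\<close> is, since \<open>c\<close> is constant on any
  interval of zero length.\<close>

definition arclength_param :: "(real \<Rightarrow> 'a::real_normed_vector) \<Rightarrow> real \<Rightarrow> real \<Rightarrow> real \<Rightarrow> 'a" where
  "arclength_param c a b s = c (SOME t. t \<in> {a..b} \<and> curve_length c a t = ennreal s)"

definition curve_integral ::
    "('a::real_normed_vector \<Rightarrow> ennreal) \<Rightarrow> (real \<Rightarrow> 'a) \<Rightarrow> real \<Rightarrow> real \<Rightarrow> ennreal" where
  "curve_integral \<rho> c a b =
     (\<integral>\<^sup>+ s \<in> {s. 0 \<le> s \<and> ennreal s \<le> curve_length c a b}. \<rho> (arclength_param c a b s) \<partial>lborel)"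

text \<open>A path on a compact interval is locally rectifiable iff it has finite length.\<close>

definition admissible :: "'a::euclidean_space ext_path set \<Rightarrow> ('a \<Rightarrow> ennreal) set" where
  "admissible \<Gamma> = {\<rho> \<in> borel_measurable borel.
     \<forall>(a, b, \<gamma>) \<in> \<Gamma>. Infpt \<notin> \<gamma> ` {a..b} \<and> curve_length (the_point \<circ> \<gamma>) a b < \<infinity> \<longrightarrow>
       1 \<le> curve_integral \<rho> (the_point \<circ> \<gamma>) a b}"

definition modulus :: "'a::euclidean_space ext_path set \<Rightarrow> ennreal" where
  "modulus \<Gamma> = (INF \<rho> \<in> admissible \<Gamma>. \<integral>\<^sup>+ x. \<rho> x ^ DIM('a) \<partial>lborel)"


section \<open>Ring Q-homeomorphisms\<close>

definition ring_domain :: "'a::real_normed_vector \<Rightarrow> real \<Rightarrow> real \<Rightarrow> 'a set" where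
  "ring_domain x0 r1 r2 = {x. r1 < norm (x - x0) \<and> norm (x - x0) < r2}"

text \<open>Equals \<open>\<infinity>\<close> when the boundary is empty, unlike \<^const>\<open>setdist\<close> and \<^const>\<open>infdist\<close>, which
  would give \<open>0\<close>.\<close>

definition dist_to_frontier :: "'a::metric_space \<Rightarrow> 'a set \<Rightarrow> ennreal" where
  "dist_to_frontier x0 D = (INF y \<in> frontier D. ennreal (dist x0 y))"

text \<open>Mappings of \<open>D\<close> are represented by total functions of which only the values on \<open>D\<close> matter.\<close>

definition ring_Q_homeo_at ::
    "'a::euclidean_space set \<Rightarrow> ('a \<Rightarrow> real) \<Rightarrow> ('a \<Rightarrow> 'a ext_space) \<Rightarrow> 'a \<Rightarrow> bool" where
  "ring_Q_homeo_at D Q f x0 \<longleftrightarrow>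
     (\<exists>g. homeomorphism D (f ` D) f g) \<and>
     (\<forall>r1 r2. 0 < r1 \<and> r1 < r2 \<and> ennreal r2 < dist_to_frontier x0 D \<longrightarrow>
       (\<forall>\<eta> :: real \<Rightarrow> ennreal.
          \<eta> \<in> borel_measurable (lebesgue_on {r1<..<r2}) \<and>
          1 \<le> (\<integral>\<^sup>+ r \<in> {r1<..<r2}. \<eta> r \<partial>lebesgue) \<longrightarrow>
          modulus (path_family (f ` sphere x0 r1) (f ` sphere x0 r2)) \<le>
            (\<integral>\<^sup>+ x \<in> ring_domain x0 r1 r2. ennreal (Q x) * \<eta> (norm (x - x0)) ^ DIM('a) \<partial>lebesgue)))"

definition ring_Q_homeo ::
    "'a::euclidean_space set \<Rightarrow> ('a \<Rightarrow> real) \<Rightarrow> ('a \<Rightarrow> 'a ext_space) \<Rightarrow> bool" where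
  "ring_Q_homeo D Q f \<longleftrightarrow> (\<forall>x0\<in>D. ring_Q_homeo_at D Q f x0)"

definition ring_Q_class ::
    "'a::euclidean_space set \<Rightarrow> ('a \<Rightarrow> real) \<Rightarrow> 'a \<Rightarrow> 'a \<Rightarrow> 'a \<Rightarrow> 'a \<Rightarrow> ('a \<Rightarrow> 'a ext_space) set" where
  "ring_Q_class D Q x1 x2 y1 y2 =
     {f. ring_Q_homeo D Q f \<and> Infpt \<notin> f ` D \<and> f x1 = Point y1 \<and> f x2 = Point y2}"


section \<open>Finite mean oscillation\<close>

definition ball_mean :: "('a::euclidean_space \<Rightarrow> real) \<Rightarrow> 'a \<Rightarrow> real \<Rightarrow> real" where
  "ball_mean \<phi> x0 \<epsilon> =
     integral\<^sup>L (lebesgue_on (ball x0 \<epsilon>)) \<phi> / measure lebesgue (ball x0 \<epsilon>)"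

definition fmo_at :: "('a::euclidean_space \<Rightarrow> real) \<Rightarrow> 'a \<Rightarrow> bool" where
  "fmo_at \<phi> x0 \<longleftrightarrow>
     (\<forall>\<^sub>F \<epsilon> in at_right 0. integrable (lebesgue_on (ball x0 \<epsilon>)) \<phi>) \<and>
     Limsup (at_right 0)
       (\<lambda>\<epsilon>. ereal (ball_mean (\<lambda>x. \<bar>\<phi> x - ball_mean \<phi> x0 \<epsilon>\<bar>) x0 \<epsilon>)) < \<infinity>"

text \<open>For open \<open>D\<close>, small balls about a point of \<open>D\<close> lie in \<open>D\<close>, so only \<open>\<phi>\<close> on \<open>D\<close> matters.\<close>

definition FMO :: "'a::euclidean_space set \<Rightarrow> ('a \<Rightarrow> real) set" where
  "FMO D = {\<phi>. \<forall>x0\<in>D. fmo_at \<phi> x0}"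


section \<open>Compact classes of mappings\<close>

definition locally_uniform_limit ::
    "'a::metric_space set \<Rightarrow> (nat \<Rightarrow> 'a \<Rightarrow> 'b::metric_space) \<Rightarrow> ('a \<Rightarrow> 'b) \<Rightarrow> bool" where
  "locally_uniform_limit D F f \<longleftrightarrow>
     (\<forall>K. compact K \<and> K \<subseteq> D \<longrightarrow> uniform_limit K F f sequentially)"

definition normal_class :: "'a::metric_space set \<Rightarrow> ('a \<Rightarrow> 'b::metric_space) set \<Rightarrow> bool" where
  "normal_class D C \<longleftrightarrow>
     (\<forall>F. range F \<subseteq> C \<longrightarrow> (\<exists>(r :: nat \<Rightarrow> nat) f. strict_mono r \<and> locally_uniform_limit D (F \<circ> r) f))"

definition closed_class :: "'a::metric_space set \<Rightarrow> ('a \<Rightarrow> 'b::metric_space) set \<Rightarrow> bool" where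
  "closed_class D C \<longleftrightarrow>
     (\<forall>F f. range F \<subseteq> C \<and> locally_uniform_limit D F f \<longrightarrow> f \<in> C)"

definition compact_class :: "'a::metric_space set \<Rightarrow> ('a \<Rightarrow> 'b::metric_space) set \<Rightarrow> bool" where
  "compact_class D C \<longleftrightarrow> normal_class D C \<and> closed_class D C"

end

theory Submission
  imports Defs "HOL-Complex_Analysis.Great_Picard"
begin

text \<open>The heart of the proof is a scale-invariant Loewner estimate: two paths of diameter comparable
  to \<open>R\<close> in a ball of radius \<open>R\<close> cannot be separated by a density \<open>\<rho>\<close> with small \<open>\<integral>\<rho>\<^sup>n\<close>. It is
  obtained by averaging the \<open>\<rho>\<close>-length over broken lines through a random point of the ball that
  start at points of the paths with uniformly distributed coordinate in some direction.
  On the other hand finite mean oscillation of \<open>Q\<close> makes the moduli of the images of the rings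
  \<open>r1 < |x - x0| < r2\<close> tend to \<open>0\<close> as \<open>r1 \<rightarrow> 0\<close>, uniformly in the class. Together, for
  every \<open>\<theta>\<close> there is a radius \<open>r1\<close> such that \<open>|f x - f a| \<le> \<theta> |f a - y|\<close> for all \<open>a\<close>, \<open>x\<close> with distance
  at most \<open>r1\<close> from \<open>x0\<close> and all values \<open>y\<close> omitted on \<open>cball x0 r2\<close>; close to any \<open>x0\<close> one of \<open>y1\<close>, \<open>y2\<close> is omitted.
  Hence local boundedness spreads from \<open>x1\<close> over the connected set \<open>D\<close>, the class is
  equicontinuous, and the theorem of Arzela and Ascoli gives normality.
  A limit that identifies two points is constant near each of them by the same inequality, hence
  constant on \<open>D\<close>, which \<open>y1 \<noteq> y2\<close> excludes. The ring inequality for an injective limit follows from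
  the one for the sequence on slightly smaller rings, without any semicontinuity of the modulus.\<close>

section \<open>Length of curves\<close>

text \<open>Broken lines suffice because only a contradiction with admissibility is wanted: one line
  of small \<open>\<rho>\<close>-length from a continuum inside the image ring to one outside
  refutes a density. Its integral splits into integrals over segments, which Fubini can average, so
  no symmetrization or capacity theory enters. The outer continuum exists because the maps omit
  infinity: the complement of the image of a closed ball is unbounded and, for
  \<open>n \<ge> 2\<close>, path connected, so an omitted value can be joined to a far point within
  it. Cutting both continua to diameters comparable to the distance from \<open>f a\<close> to the
  omitted value turns a small modulus into a distortion bound that is uniform over the maps. Finite
  mean oscillation enters through dyadic balls: each halving of the radius raises the mean of
  \<open>Q\<close> by at most a constant, so the mean grows at most like the logarithm of the
  inverse radius, and for \<open>n \<ge> 2\<close> the divergence of the harmonic series still wins.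
  The bounds on the class also reconcile the two metrics, since on bounded sets chordal and
  Euclidean distance are comparable.\<close>

definition is_partition :: "real \<Rightarrow> real \<Rightarrow> nat \<Rightarrow> (nat \<Rightarrow> real) \<Rightarrow> bool" where
  "is_partition a b N t \<longleftrightarrow> t 0 = a \<and> t N = b \<and> (\<forall>i<N. t i \<le> t (Suc i))"

definition variation_sum :: "(real \<Rightarrow> 'a::real_normed_vector) \<Rightarrow> nat \<Rightarrow> (nat \<Rightarrow> real) \<Rightarrow> real" where
  "variation_sum c N t = (\<Sum>i<N. norm (c (t (Suc i)) - c (t i)))"

lemma variation_sum_nonneg [simp]: "0 \<le> variation_sum c N t"
  by (simp add: variation_sum_def sum_nonneg)

lemma curve_length_alt:
  "curve_length c a b = (SUP (N, t) \<in> {(N, t). is_partition a b N t}. ennreal (variation_sum c N t))"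
  by (simp add: curve_length_def is_partition_def variation_sum_def sum_ennreal)

lemma variation_sum_le_length:
  "is_partition a b N t \<Longrightarrow> ennreal (variation_sum c N t) \<le> curve_length c a b"
  unfolding curve_length_alt by (rule SUP_upper2[of "(N, t)"]) auto

lemma curve_length_le:
  "(\<And>N t. is_partition a b N t \<Longrightarrow> ennreal (variation_sum c N t) \<le> M) \<Longrightarrow> curve_length c a b \<le> M"
  unfolding curve_length_alt by (rule SUP_least) auto

lemma is_partition_mono:
  assumes "is_partition a b N t" "i \<le> j" "j \<le> N"
  shows "t i \<le> t j"
  using assms(2,3)
proof (induction j)
  case (Suc j)
  show ?case
  proof (cases "i = Suc j")
    case False
    then have "t i \<le> t j" using Suc by simp
    also have "t j \<le> t (Suc j)" using assms(1) Suc.prems by (simp add: is_partition_def)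
    finally show ?thesis .
  qed simp
qed simp

lemma is_partition_range:
  assumes "is_partition a b N t" "i \<le> N"
  shows "t i \<in> {a..b}"
  using is_partition_mono[OF assms(1), of 0 i] is_partition_mono[OF assms(1), of i N] assms
  by (auto simp: is_partition_def)

text \<open>Clamping keeps the number of points. It may repeat points, which weakly increasing
  partitions allow and which add nothing to the variation.\<close>

lemma is_partition_min:
  assumes "is_partition a b N t" "u \<in> {a..b}"
  shows "is_partition a u N (\<lambda>i. min (t i) u)"
  using assms unfolding is_partition_def by (auto simp: min_def)

lemma is_partition_max:
  assumes "is_partition a b N t" "u \<in> {a..b}"
  shows "is_partition u b N (\<lambda>i. max (t i) u)"
  using assms unfolding is_partition_def by (auto simp: max_def)

lemma norm_diff_le_curve_length:
  assumes "a \<le> b"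
  shows "ennreal (norm (c b - c a)) \<le> curve_length c a b"
proof -
  have "is_partition a b 1 (\<lambda>i. if i = 0 then a else b)"
    using assms by (auto simp: is_partition_def)
  from variation_sum_le_length[OF this, of c] show ?thesis by (simp add: variation_sum_def)
qed

lemma curve_length_refl [simp]: "curve_length c a a = 0"
proof -
  have "curve_length c a a \<le> 0"
  proof (rule curve_length_le)
    fix N t assume p: "is_partition a a N t"
    have "t i = a" if "i \<le> N" for i
      using is_partition_range[OF p that] by simp
    then show "ennreal (variation_sum c N t) \<le> 0" by (simp add: variation_sum_def)
  qed
  then show ?thesis by simp
qed

text \<open>Clamping a partition at \<open>b\<close> from above and from below splits only the
  interval that straddles \<open>b\<close>, where the triangle inequality through \<open>c b\<close>
  applies. The converse concatenates partitions and takes the two suprema one after the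
  other.\<close>

lemma curve_length_add:
  assumes "a \<le> b" "b \<le> d"
  shows "curve_length c a d = curve_length c a b + curve_length c b d"
proof (rule antisym)
  show "curve_length c a d \<le> curve_length c a b + curve_length c b d"
  proof (rule curve_length_le)
    fix N t assume p: "is_partition a d N t"
    have b: "b \<in> {a..d}" using assms by simp
    have "variation_sum c N t \<le> variation_sum c N (\<lambda>i. min (t i) b) + variation_sum c N (\<lambda>i. max (t i) b)"
      unfolding variation_sum_def sum.distrib[symmetric]
    proof (rule sum_mono)
      fix i assume "i \<in> {..<N}"
      then have "t i \<le> t (Suc i)" using p by (simp add: is_partition_def)
      then consider "t (Suc i) \<le> b" | "b \<le> t i" | "t i \<le> b" "b \<le> t (Suc i)" by linarith
      then show "norm (c (t (Suc i)) - c (t i))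
          \<le> norm (c (min (t (Suc i)) b) - c (min (t i) b)) + norm (c (max (t (Suc i)) b) - c (max (t i) b))"
      proof cases
        case 3
        then show ?thesis
          using norm_triangle_ineq[of "c b - c (t i)" "c (t (Suc i)) - c b"]
          by (simp add: min_absorb1 min_absorb2 max_absorb1 max_absorb2)
      qed (use \<open>t i \<le> t (Suc i)\<close> in \<open>auto simp: min_def max_def\<close>)
    qed
    then have "ennreal (variation_sum c N t) \<le>
        ennreal (variation_sum c N (\<lambda>i. min (t i) b)) + ennreal (variation_sum c N (\<lambda>i. max (t i) b))"
      by (metis ennreal_leI ennreal_plus variation_sum_nonneg)
    also have "\<dots> \<le> curve_length c a b + curve_length c b d"
      by (intro add_mono variation_sum_le_length is_partition_min[OF p b] is_partition_max[OF p b])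
    finally show "ennreal (variation_sum c N t) \<le> curve_length c a b + curve_length c b d" .
  qed
next
  have *: "ennreal (variation_sum c N t) + ennreal (variation_sum c M s) \<le> curve_length c a d"
    if t: "is_partition a b N t" and s: "is_partition b d M s" for N M t s
  proof -
    \<comment> \<open>Index \<open>N\<close> falls into the first branch, and
      \<open>t N = b = s 0\<close> makes the shifted formula valid for \<open>i = 0\<close> as
      well.\<close>
    define u where "u i = (if i \<le> N then t i else s (i - N))" for i
    have u: "u (N + i) = s i" for i
      using t s by (cases "i = 0") (auto simp: u_def is_partition_def)
    have "is_partition a d (N + M) u"
      unfolding is_partition_def
    proof (intro conjI allI impI)
      show "u 0 = a" "u (N + M) = d" using t s u[of M] by (auto simp: u_def is_partition_def)
      fix i assume "i < N + M"
      show "u i \<le> u (Suc i)"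
      proof (cases "i < N")
        case True
        then show ?thesis using t by (auto simp: u_def is_partition_def)
      next
        case False
        then obtain j where j: "i = N + j" using le_Suc_ex[of N i] by auto
        then show ?thesis using s \<open>i < N + M\<close> u[of j] u[of "Suc j"] by (auto simp: is_partition_def)
      qed
    qed
    moreover have "variation_sum c (N + M) u = variation_sum c N t + variation_sum c M s"
    proof -
      have "variation_sum c (N + M) u =
          (\<Sum>i<N. norm (c (u (Suc i)) - c (u i))) + (\<Sum>i<M. norm (c (u (N + Suc i)) - c (u (N + i))))"
        unfolding variation_sum_def lessThan_atLeast0
        by (subst sum.atLeastLessThan_concat[of 0 N "N + M", symmetric])
          (use sum.shift_bounds_nat_ivl[of "\<lambda>i. norm (c (u (Suc i)) - c (u i))" 0 N M] in
            \<open>auto simp: add.commute\<close>)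
      also have "(\<Sum>i<N. norm (c (u (Suc i)) - c (u i))) = variation_sum c N t"
        unfolding variation_sum_def by (rule sum.cong) (auto simp: u_def)
      finally show ?thesis by (simp only: u variation_sum_def)
    qed
    ultimately show ?thesis
      by (metis variation_sum_le_length ennreal_plus variation_sum_nonneg)
  qed
  have ex: "is_partition p q 1 (\<lambda>i. if i = 0 then p else q)" if "p \<le> q" for p q
    using that by (auto simp: is_partition_def)
  \<comment> \<open>Pulling a constant out of a supremum requires a nonempty index set, as the empty
    supremum is \<open>0\<close>.\<close>
  have ne1: "{(N, t). is_partition a b N t} \<noteq> {}" and ne2: "{(N, t). is_partition b d N t} \<noteq> {}"
    using ex[OF assms(1)] ex[OF assms(2)] by auto
  have 1: "ennreal (variation_sum c N t) + curve_length c b d \<le> curve_length c a d"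
    if "is_partition a b N t" for N t
    unfolding curve_length_alt[of c b d]
    by (subst ennreal_SUP_add_right[OF ne2], rule SUP_least) (use *[OF that] in auto)
  have "curve_length c b d + curve_length c a b \<le> curve_length c a d"
    unfolding curve_length_alt[of c a b]
    by (subst ennreal_SUP_add_right[OF ne1], rule SUP_least) (use 1 in \<open>auto simp: add.commute\<close>)
  then show "curve_length c a b + curve_length c b d \<le> curve_length c a d" by (simp add: add.commute)
qed

lemma curve_length_mono:
  assumes "a \<le> a'" "a' \<le> b'" "b' \<le> b"
  shows "curve_length c a' b' \<le> curve_length c a b"
  using curve_length_add[of a a' b c] curve_length_add[of a' b' b c] assms
  by (simp add: add_increasing add_increasing2)

section \<open>Continuous dependence of the length on the end point\<close>

lemma curve_length_approx:
  assumes "p \<le> q" "curve_length c p q < \<infinity>" "0 < e"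
  obtains N t where "is_partition p q N t" "enn2real (curve_length c p q) - e < variation_sum c N t"
proof -
  define l where "l = enn2real (curve_length c p q)"
  have l: "curve_length c p q = ennreal l" "0 \<le> l" using assms by (auto simp: l_def less_top)
  have "\<exists>N t. is_partition p q N t \<and> l - e < variation_sum c N t"
  proof (rule ccontr)
    assume "\<not> ?thesis"
    then have *: "variation_sum c N t \<le> l - e" if "is_partition p q N t" for N t using that by (meson not_less)
    \<comment> \<open>The trivial partition shows \<open>0 \<le> l - e\<close>; otherwise
      \<open>ennreal (l - e)\<close> would be truncated to \<open>0\<close> and the comparison below
      could hold for \<open>l = 0\<close>.\<close>
    have "is_partition p q 1 (\<lambda>i. if i = 0 then p else q)" using assms by (auto simp: is_partition_def)
    from order_trans[OF variation_sum_nonneg *[OF this]] have "0 \<le> l - e" .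
    moreover have "ennreal l \<le> ennreal (l - e)"
      unfolding l(1)[symmetric] by (rule curve_length_le) (use * in \<open>auto intro: ennreal_leI\<close>)
    ultimately show False using assms by simp
  qed
  then show ?thesis using that by (auto simp: l_def)
qed

text \<open>A fixed nearly optimal partition, truncated at \<open>u\<close>, has a variation depending continuously
  on \<open>u\<close>; this makes the length of the short remaining piece small.\<close>

lemma curve_length_small_left:
  assumes "p < q" "continuous_on {p..q} c" "curve_length c p q < \<infinity>" "0 < e"
  shows "\<exists>d>0. \<forall>u\<in>{p..q}. q - u < d \<longrightarrow> enn2real (curve_length c u q) < e"
proof -
  obtain N t where t: "is_partition p q N t" "enn2real (curve_length c p q) - e < variation_sum c N t"
    using curve_length_approx assms by (metis less_imp_le)
  have tr: "t i \<in> {p..q}" if "i \<le> N" for i using is_partition_range[OF t(1) that] .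
  define g where "g u = variation_sum c N (\<lambda>i. min (t i) u)" for u
  have "continuous_on {p..q} g"
    unfolding g_def variation_sum_def
  proof (intro continuous_on_sum continuous_on_norm continuous_on_diff)
    fix i assume "i \<in> {..<N}"
    then have "(\<lambda>u. min (t k) u) ` {p..q} \<subseteq> {p..q}" if "k = i \<or> k = Suc i" for k
      using tr[of k] that by (auto simp: min_def max_def)
    then show "continuous_on {p..q} (\<lambda>u. c (min (t (Suc i)) u))" "continuous_on {p..q} (\<lambda>u. c (min (t i) u))"
      by (auto intro!: continuous_on_compose2[OF assms(2)] continuous_intros)
  qed
  moreover have gq: "g q = variation_sum c N t"
    unfolding g_def variation_sum_def by (intro sum.cong refl) (use tr in \<open>auto simp: min_absorb1\<close>)
  ultimately obtain d where d: "d > 0" "\<And>u. u \<in> {p..q} \<Longrightarrow> dist u q < d \<Longrightarrow>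
      dist (g u) (g q) < variation_sum c N t - (enn2real (curve_length c p q) - e)"
    using t(2) assms(1) unfolding continuous_on_iff by (metis atLeastAtMost_iff diff_gt_0_iff_gt less_imp_le order_refl)
  show ?thesis
  proof (intro exI conjI ballI impI)
    fix u assume u: "u \<in> {p..q}" "q - u < d"
    have "dist (g u) (g q) < variation_sum c N t - (enn2real (curve_length c p q) - e)"
      using u by (intro d(2)) (auto simp: dist_real_def)
    then have gu: "g u > enn2real (curve_length c p q) - e"
      using gq by (auto simp: dist_real_def)
    have add: "curve_length c p q = curve_length c p u + curve_length c u q"
      using u by (intro curve_length_add) auto
    then have fin: "curve_length c p u < top" "curve_length c u q < top"
      using assms(3) by (auto simp: less_top)
    have "ennreal (g u) \<le> curve_length c p u"
      unfolding g_def by (intro variation_sum_le_length is_partition_min[OF t(1) u(1)])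
    then have "g u \<le> enn2real (curve_length c p u)"
      using fin by (metis enn2real_mono enn2real_ennreal g_def variation_sum_nonneg)
    moreover have "enn2real (curve_length c p q) = enn2real (curve_length c p u) + enn2real (curve_length c u q)"
      unfolding add using fin by (rule enn2real_plus)
    ultimately show "enn2real (curve_length c u q) < e" using gu by linarith
  qed (rule d)
qed

lemma curve_length_small_right:
  assumes "p < q" "continuous_on {p..q} c" "curve_length c p q < \<infinity>" "0 < e"
  shows "\<exists>d>0. \<forall>u\<in>{p..q}. u - p < d \<longrightarrow> enn2real (curve_length c p u) < e"
proof -
  obtain N t where t: "is_partition p q N t" "enn2real (curve_length c p q) - e < variation_sum c N t"
    using curve_length_approx assms by (metis less_imp_le)
  have tr: "t i \<in> {p..q}" if "i \<le> N" for i using is_partition_range[OF t(1) that] .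
  define g where "g u = variation_sum c N (\<lambda>i. max (t i) u)" for u
  have "continuous_on {p..q} g"
    unfolding g_def variation_sum_def
  proof (intro continuous_on_sum continuous_on_norm continuous_on_diff)
    fix i assume "i \<in> {..<N}"
    then have "(\<lambda>u. max (t k) u) ` {p..q} \<subseteq> {p..q}" if "k = i \<or> k = Suc i" for k
      using tr[of k] that by (auto simp: min_def max_def)
    then show "continuous_on {p..q} (\<lambda>u. c (max (t (Suc i)) u))" "continuous_on {p..q} (\<lambda>u. c (max (t i) u))"
      by (auto intro!: continuous_on_compose2[OF assms(2)] continuous_intros)
  qed
  moreover have gp: "g p = variation_sum c N t"
    unfolding g_def variation_sum_def by (intro sum.cong refl) (use tr in \<open>auto simp: max_absorb1\<close>)
  ultimately obtain d where d: "d > 0" "\<And>u. u \<in> {p..q} \<Longrightarrow> dist u p < d \<Longrightarrow>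
      dist (g u) (g p) < variation_sum c N t - (enn2real (curve_length c p q) - e)"
    using t(2) assms(1) unfolding continuous_on_iff by (metis atLeastAtMost_iff diff_gt_0_iff_gt less_imp_le order_refl)
  show ?thesis
  proof (intro exI conjI ballI impI)
    fix u assume u: "u \<in> {p..q}" "u - p < d"
    have "dist (g u) (g p) < variation_sum c N t - (enn2real (curve_length c p q) - e)"
      using u by (intro d(2)) (auto simp: dist_real_def)
    then have gu: "g u > enn2real (curve_length c p q) - e"
      using gp by (auto simp: dist_real_def)
    have add: "curve_length c p q = curve_length c p u + curve_length c u q"
      using u by (intro curve_length_add) auto
    then have fin: "curve_length c p u < top" "curve_length c u q < top"
      using assms(3) by (auto simp: less_top)
    have "ennreal (g u) \<le> curve_length c u q"
      unfolding g_def by (intro variation_sum_le_length is_partition_max[OF t(1) u(1)])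
    then have "g u \<le> enn2real (curve_length c u q)"
      using fin by (metis enn2real_mono enn2real_ennreal g_def variation_sum_nonneg)
    moreover have "enn2real (curve_length c p q) = enn2real (curve_length c p u) + enn2real (curve_length c u q)"
      unfolding add using fin by (rule enn2real_plus)
    ultimately show "enn2real (curve_length c p u) < e" using gu by linarith
  qed (rule d)
qed

text \<open>By additivity an increment of the length function is the length of a short piece, which
  the two one-sided estimates control; at an end point of \<open>{a..b}\<close> the missing side is
  trivial.\<close>

lemma continuous_on_curve_length:
  assumes "continuous_on {a..b} c" "curve_length c a b < \<infinity>"
  shows "continuous_on {a..b} (\<lambda>t. enn2real (curve_length c a t))"
  unfolding continuous_on_iff
proof (intro ballI allI impI)
  fix x e :: real assume x: "x \<in> {a..b}" and e: "0 < e"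
  have fin: "curve_length c p q < \<infinity>" if "a \<le> p" "p \<le> q" "q \<le> b" for p q
    using curve_length_mono[OF that] assms(2) by (rule le_less_trans)
  have *: "enn2real (curve_length c a q) - enn2real (curve_length c a p) = enn2real (curve_length c p q)"
    if "a \<le> p" "p \<le> q" "q \<le> b" for p q
    using curve_length_add[of a p q c] fin[of a p] fin[of p q] that by (simp add: enn2real_plus)
  have "\<exists>d>0. \<forall>u\<in>{a..x}. x - u < d \<longrightarrow> enn2real (curve_length c u x) < e"
  proof (cases "a < x")
    case True
    then show ?thesis
      using x e fin[of a x] by (intro curve_length_small_left continuous_on_subset[OF assms(1)]) auto
  qed (use e x in \<open>auto intro!: exI[of _ 1]\<close>)
  then obtain d1 where d1: "d1 > 0" "\<And>u. u \<in> {a..x} \<Longrightarrow> x - u < d1 \<Longrightarrow> enn2real (curve_length c u x) < e"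
    by blast
  have "\<exists>d>0. \<forall>u\<in>{x..b}. u - x < d \<longrightarrow> enn2real (curve_length c x u) < e"
  proof (cases "x < b")
    case True
    then show ?thesis
      using x e fin[of x b] by (intro curve_length_small_right continuous_on_subset[OF assms(1)]) auto
  qed (use e x in \<open>auto intro!: exI[of _ 1]\<close>)
  then obtain d2 where d2: "d2 > 0" "\<And>u. u \<in> {x..b} \<Longrightarrow> u - x < d2 \<Longrightarrow> enn2real (curve_length c x u) < e"
    by blast
  show "\<exists>d>0. \<forall>x'\<in>{a..b}. dist x' x < d \<longrightarrow>
      dist (enn2real (curve_length c a x')) (enn2real (curve_length c a x)) < e"
  proof (intro exI[of _ "min d1 d2"] conjI ballI impI)
    fix y assume y: "y \<in> {a..b}" "dist y x < min d1 d2"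
    show "dist (enn2real (curve_length c a y)) (enn2real (curve_length c a x)) < e"
    proof (cases "y \<le> x")
      case True
      have "enn2real (curve_length c a x) - enn2real (curve_length c a y) = enn2real (curve_length c y x)"
        "enn2real (curve_length c y x) < e"
        using True x y *[of y x] d1(2)[of y] by (auto simp: dist_real_def)
      then show ?thesis using enn2real_nonneg[of "curve_length c y x"] unfolding dist_real_def by linarith
    next
      case False
      have "enn2real (curve_length c a y) - enn2real (curve_length c a x) = enn2real (curve_length c x y)"
        "enn2real (curve_length c x y) < e"
        using False x y *[of x y] d2(2)[of y] by (auto simp: dist_real_def)
      then show ?thesis using enn2real_nonneg[of "curve_length c x y"] unfolding dist_real_def by linarith
    qed
  qed (use d1 d2 in auto)
qed

text \<open>The intermediate value theorem for the length function. It provides the witness for the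
  choice in \<open>arclength_param\<close>.\<close>

lemma curve_length_attains:
  assumes "a \<le> b" "continuous_on {a..b} c" "ennreal s \<le> curve_length c a b" "curve_length c a b < \<infinity>" "0 \<le> s"
  shows "\<exists>t\<in>{a..b}. curve_length c a t = ennreal s"
proof -
  have "s \<le> enn2real (curve_length c a b)"
    using assms by (metis enn2real_ennreal enn2real_mono infinity_ennreal_def)
  then have "\<exists>t\<ge>a. t \<le> b \<and> enn2real (curve_length c a t) = s"
    using assms by (intro IVT' continuous_on_curve_length) auto
  then obtain t where t: "t \<in> {a..b}" "enn2real (curve_length c a t) = s" by auto
  moreover have "curve_length c a t < \<infinity>"
    using curve_length_mono[of a a t b c] t assms by (auto simp: le_less_trans)
  ultimately show ?thesis by (metis ennreal_enn2real infinity_ennreal_def)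
qed

section \<open>Curve integrals\<close>

text \<open>Two parameters with the same finite length from \<open>a\<close> enclose a piece of
  length zero, on which the chord estimate makes \<open>c\<close> constant; finiteness of
  \<open>ennreal s\<close> is what permits cancelling it.\<close>

lemma arclength_param_eq:
  assumes "t \<in> {a..b}" "curve_length c a t = ennreal s"
  shows "arclength_param c a b s = c t"
proof -
  define t' where "t' = (SOME t. t \<in> {a..b} \<and> curve_length c a t = ennreal s)"
  have t': "t' \<in> {a..b} \<and> curve_length c a t' = ennreal s"
    unfolding t'_def by (rule someI[of _ t]) (use assms in auto)
  have *: "c u = c v" if "a \<le> u" "u \<le> v" "curve_length c a u = ennreal s" "curve_length c a v = ennreal s" for u v
  proof -
    have "curve_length c a v = curve_length c a u + curve_length c u v"
      using that by (intro curve_length_add)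
    then have "ennreal s + curve_length c u v = ennreal s + 0"
      unfolding that(3,4) by (simp only: add_0_right)
    then have "curve_length c u v = 0" unfolding ennreal_add_left_cancel by simp
    then show ?thesis using norm_diff_le_curve_length[of u v c] that by simp
  qed
  have "c t' = c t"
  proof (cases "t \<le> t'")
    case True
    then show ?thesis using *[of t t'] t' assms by simp
  next
    case False
    then show ?thesis using *[of t' t] t' assms by simp
  qed
  then show ?thesis by (simp add: arclength_param_def t'_def)
qed

lemma norm_arclength_param_diff:
  assumes "a \<le> b" "continuous_on {a..b} c" "curve_length c a b = ennreal l" "0 \<le> s" "s \<le> s'" "s' \<le> l"
  shows "norm (arclength_param c a b s' - arclength_param c a b s) \<le> s' - s"
proof -
  obtain t where t: "t \<in> {a..b}" "curve_length c a t = ennreal s"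
    using curve_length_attains[of a b c s] assms by (auto intro: ennreal_leI)
  obtain t' where t': "t' \<in> {a..b}" "curve_length c a t' = ennreal s'"
    using curve_length_attains[of a b c s'] assms by (auto intro: ennreal_leI)
  show ?thesis
  proof (cases "t \<le> t'")
    case True
    have "ennreal s' = ennreal s + curve_length c t t'"
      unfolding t(2)[symmetric] t'(2)[symmetric] using t t' True by (intro curve_length_add) auto
    moreover have "ennreal s' = ennreal s + ennreal (s' - s)"
      using assms by (simp flip: ennreal_plus)
    ultimately have "ennreal s + curve_length c t t' = ennreal s + ennreal (s' - s)" by (simp only:)
    then have "curve_length c t t' = ennreal (s' - s)" unfolding ennreal_add_left_cancel by simp
    then have "norm (c t' - c t) \<le> s' - s"
      using norm_diff_le_curve_length[OF True, of c] assms by simp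
    then show ?thesis by (simp only: arclength_param_eq[OF t] arclength_param_eq[OF t'])
  next
    case False
    then have "ennreal s' \<le> ennreal s"
      unfolding t(2)[symmetric] t'(2)[symmetric] using t t' by (intro curve_length_mono) auto
    then have "s = s'" using assms by (simp add: ennreal_le_iff)
    then show ?thesis by (simp only: diff_self norm_zero order_refl)
  qed
qed

lemma continuous_on_arclength_param:
  assumes "a \<le> b" "continuous_on {a..b} c" "curve_length c a b = ennreal l"
  shows "continuous_on {0..l} (arclength_param c a b)"
  unfolding continuous_on_iff
proof (intro ballI allI impI)
  fix x e :: real assume x: "x \<in> {0..l}" "0 < e"
  have "norm (arclength_param c a b y - arclength_param c a b x) \<le> \<bar>y - x\<bar>" if "y \<in> {0..l}" for y
    using norm_arclength_param_diff[OF assms, of x y] norm_arclength_param_diff[OF assms, of y x] x that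
    by (cases "x \<le> y") (auto simp: norm_minus_commute)
  then show "\<exists>d>0. \<forall>x'\<in>{0..l}. dist x' x < d \<longrightarrow> dist (arclength_param c a b x') (arclength_param c a b x) < e"
    using x(2) by (intro exI[of _ e] conjI ballI impI) (simp_all add: dist_norm, meson le_less_trans)
qed

text \<open>Beyond the length of the curve the choice in \<open>arclength_param\<close> has no
  witness, so the parametrization is cut off before \<open>\<rho>\<close> is applied; on
  \<open>{0..l}\<close> it is 1-Lipschitz, hence continuous.\<close>

lemma arclength_param_measurable:
  fixes \<rho> :: "'a::euclidean_space \<Rightarrow> ennreal"
  assumes "a \<le> b" "continuous_on {a..b} c" "curve_length c a b = ennreal l" "\<rho> \<in> borel_measurable borel"
  shows "(\<lambda>s. \<rho> (arclength_param c a b s) * indicator {0..l} s) \<in> borel_measurable borel"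
proof -
  define h where "h s = indicator {0..l} s *\<^sub>R arclength_param c a b s" for s
  have [measurable]: "h \<in> borel_measurable borel"
    unfolding h_def
    by (rule borel_measurable_continuous_on_indicator[OF _ continuous_on_arclength_param[OF assms(1-3)]]) simp
  note assms(4)[measurable]
  have "(\<lambda>s. \<rho> (h s) * indicator {0..l} s) \<in> borel_measurable borel"
    by measurable
  also have "(\<lambda>s. \<rho> (h s) * indicator {0..l} s) = (\<lambda>s. \<rho> (arclength_param c a b s) * indicator {0..l} s)"
    by (auto simp: indicator_def h_def)
  finally show ?thesis .
qed

lemma curve_integral_finite:
  assumes "curve_length c a b = ennreal l" "0 \<le> l"
  shows "curve_integral \<rho> c a b = (\<integral>\<^sup>+s. \<rho> (arclength_param c a b s) * indicator {0..l} s \<partial>lborel)"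
proof -
  have "{s. 0 \<le> s \<and> ennreal s \<le> curve_length c a b} = {0..l}"
    using assms by (auto simp: ennreal_le_iff)
  then show ?thesis by (simp add: curve_integral_def)
qed

text \<open>The arc-length parametrization of the subpath is that of the whole path shifted by the
  length \<open>l a a'\<close> of the initial piece, so its integral is a part of the larger
  one.\<close>

lemma curve_integral_mono:
  fixes \<rho> :: "'a::euclidean_space \<Rightarrow> ennreal"
  assumes "a \<le> a'" "a' \<le> b'" "b' \<le> b" "continuous_on {a..b} c" "curve_length c a b < \<infinity>"
    and [measurable]: "\<rho> \<in> borel_measurable borel"
  shows "curve_integral \<rho> c a' b' \<le> curve_integral \<rho> c a b"
proof -
  have fin: "curve_length c p q < \<infinity>" if "a \<le> p" "p \<le> q" "q \<le> b" for p q
    using curve_length_mono[OF that] assms(5) by (rule le_less_trans)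
  define l where "l p q = enn2real (curve_length c p q)" for p q
  have l: "curve_length c p q = ennreal (l p q)" "0 \<le> l p q" if "a \<le> p" "p \<le> q" "q \<le> b" for p q
    using fin[OF that] by (auto simp: l_def less_top)
  have le: "l a a' + l a' b' \<le> l a b"
  proof -
    have "ennreal (l a a') + ennreal (l a' b') \<le> ennreal (l a b)"
      using curve_length_add[of a a' b' c] curve_length_mono[of a a b' b c] l assms by simp
    then show ?thesis using l assms by (simp flip: ennreal_plus)
  qed
  have shift: "arclength_param c a b (l a a' + s) = arclength_param c a' b' s" if s: "s \<in> {0..l a' b'}" for s
  proof -
    have "continuous_on {a'..b'} c" using assms by (auto intro: continuous_on_subset)
    then obtain t where t: "t \<in> {a'..b'}" "curve_length c a' t = ennreal s"
      using curve_length_attains[of a' b' c s] s l assms fin by (auto simp: ennreal_leI)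
    then have "curve_length c a t = ennreal (l a a' + s)"
      using curve_length_add[of a a' t c] l[of a a'] assms s by simp
    then show ?thesis
      using arclength_param_eq[of t a b c] arclength_param_eq[OF t] t assms by simp
  qed
  have m: "(\<lambda>s. \<rho> (arclength_param c a b s) * indicator {0..l a b} s) \<in> borel_measurable borel"
    using l assms by (intro arclength_param_measurable) auto
  have "curve_integral \<rho> c a' b' = (\<integral>\<^sup>+s. \<rho> (arclength_param c a' b' s) * indicator {0..l a' b'} s \<partial>lborel)"
    using l assms by (intro curve_integral_finite) auto
  \<comment> \<open>The factor \<open>1\<close> is written out to match the affine substitution of
    slope \<open>1\<close>.\<close>
  also have "\<dots> \<le> (\<integral>\<^sup>+s. \<rho> (arclength_param c a b (l a a' + 1 * s)) * indicator {0..l a b} (l a a' + 1 * s) \<partial>lborel)"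
  proof (rule nn_integral_mono)
    fix s show "\<rho> (arclength_param c a' b' s) * indicator {0..l a' b'} s
        \<le> \<rho> (arclength_param c a b (l a a' + 1 * s)) * indicator {0..l a b} (l a a' + 1 * s)"
      using shift[of s] le l(2)[of a a'] assms by (auto simp: indicator_def)
  qed
  also have "\<dots> = (\<integral>\<^sup>+s. \<rho> (arclength_param c a b s) * indicator {0..l a b} s \<partial>lborel)"
    using nn_integral_real_affine[OF m, of 1 "l a a'"] by simp
  also have "\<dots> = curve_integral \<rho> c a b"
    using l assms by (intro curve_integral_finite[symmetric]) auto
  finally show ?thesis .
qed

lemma curve_integral_unit_speed:
  assumes "a \<le> b" "\<And>t. t \<in> {a..b} \<Longrightarrow> curve_length c a t = ennreal (t - a)"
    and [measurable]: "\<rho> \<in> borel_measurable borel" "c \<in> borel_measurable borel"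
  shows "curve_integral \<rho> c a b = (\<integral>\<^sup>+t. \<rho> (c t) * indicator {a..b} t \<partial>lborel)"
proof -
  have "curve_integral \<rho> c a b = (\<integral>\<^sup>+s. \<rho> (arclength_param c a b s) * indicator {0..b-a} s \<partial>lborel)"
    using assms by (intro curve_integral_finite) auto
  also have "\<dots> = (\<integral>\<^sup>+s. \<rho> (c (a + 1 * s)) * indicator {a..b} (a + 1 * s) \<partial>lborel)"
  proof (rule nn_integral_cong)
    fix s show "\<rho> (arclength_param c a b s) * indicator {0..b-a} s = \<rho> (c (a + 1 * s)) * indicator {a..b} (a + 1 * s)"
      using arclength_param_eq[of "a + s" a b c s] assms(2)[of "a + s"] by (auto simp: indicator_def)
  qed
  also have "\<dots> = (\<integral>\<^sup>+t. \<rho> (c t) * indicator {a..b} t \<partial>lborel)"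
    by (subst nn_integral_real_affine[where c = 1 and t = a]) auto
  finally show ?thesis .
qed

lemma curve_length_isometric:
  assumes "a \<le> b" "\<And>u v. u \<in> {a..b} \<Longrightarrow> v \<in> {a..b} \<Longrightarrow> norm (c u - c v) = \<bar>u - v\<bar>"
  shows "curve_length c a b = ennreal (b - a)"
proof (rule antisym)
  show "curve_length c a b \<le> ennreal (b - a)"
  proof (rule curve_length_le)
    fix N t assume p: "is_partition a b N t"
    have "variation_sum c N t = (\<Sum>i<N. t (Suc i) - t i)"
      unfolding variation_sum_def
    proof (rule sum.cong)
      fix i assume "i \<in> {..<N}"
      then show "norm (c (t (Suc i)) - c (t i)) = t (Suc i) - t i"
        using assms(2)[of "t (Suc i)" "t i"] is_partition_range[OF p] p by (auto simp: is_partition_def)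
    qed simp
    also have "\<dots> = b - a" using p by (simp add: sum_lessThan_telescope is_partition_def)
    finally show "ennreal (variation_sum c N t) \<le> ennreal (b - a)" by simp
  qed
  show "ennreal (b - a) \<le> curve_length c a b"
    using norm_diff_le_curve_length[of a b c] assms(2)[of b a] assms(1) by simp
qed

section \<open>Finite points of the extended space\<close>

lemma dist_Point_le: "dist (Point x) (Point y) \<le> dist x y"
proof -
  have "1 * 1 \<le> sqrt (1 + (norm x)\<^sup>2) * sqrt (1 + (norm y)\<^sup>2)"
    by (intro mult_mono) auto
  then show ?thesis
    unfolding dist_ext_space_def chordal_dist.simps dist_norm
    using mult_left_mono[of 1 "sqrt (1 + (norm x)\<^sup>2) * sqrt (1 + (norm y)\<^sup>2)" "norm (x - y)"]
    by (subst divide_le_eq) auto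
qed

text \<open>The chordal denominator contains \<open>norm y\<close>, which is bounded by
  \<open>norm x + norm (x - y)\<close>; the resulting term in \<open>norm (x - y)\<close> has
  coefficient at most \<open>1 / 2\<close> and is absorbed on the left, leaving a bound in terms of
  \<open>x\<close> alone.\<close>

lemma norm_diff_le_dist_Point:
  assumes "dist (Point x) (Point y) * (1 + norm x) \<le> 1 / 2"
  shows "norm (x - y) \<le> 2 * dist (Point x) (Point y) * (1 + norm x)\<^sup>2"
proof -
  define h where "h = dist (Point x) (Point y)"
  have s: "sqrt (1 + (norm v)\<^sup>2) \<le> 1 + norm v" for v :: 'a
    by (rule real_le_lsqrt) (auto simp: power2_eq_square algebra_simps)
  have pos: "sqrt (1 + (norm v)\<^sup>2) > 0" for v :: 'a
    by (simp add: add_pos_nonneg)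
  have "h \<ge> 0" by (simp add: h_def)
  have "norm (x - y) = h * (sqrt (1 + (norm x)\<^sup>2) * sqrt (1 + (norm y)\<^sup>2))"
    using pos[of x] pos[of y] by (simp add: h_def dist_ext_space_def)
  also have "\<dots> \<le> h * ((1 + norm x) * (1 + norm y))"
    using \<open>h \<ge> 0\<close> s[of x] s[of y] by (intro mult_left_mono mult_mono) auto
  also have "\<dots> \<le> h * ((1 + norm x) * (1 + norm x + norm (x - y)))"
    using \<open>h \<ge> 0\<close> norm_triangle_sub[of y x]
    by (intro mult_left_mono) (auto simp: norm_minus_commute)
  also have "\<dots> = h * (1 + norm x)\<^sup>2 + h * (1 + norm x) * norm (x - y)"
    by (simp add: power2_eq_square algebra_simps)
  also have "\<dots> \<le> h * (1 + norm x)\<^sup>2 + 1 / 2 * norm (x - y)"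
    using assms by (intro add_left_mono mult_right_mono) (auto simp: h_def)
  finally show ?thesis by (simp add: h_def)
qed

lemma continuous_on_Point: "continuous_on S Point"
  unfolding continuous_on_iff by (metis dist_Point_le le_less_trans)

lemma continuous_on_the_point:
  assumes "Infpt \<notin> S"
  shows "continuous_on S the_point"
  unfolding continuous_on_iff
proof (intro ballI allI impI)
  fix p and e :: real assume p: "p \<in> S" and e: "0 < e"
  then obtain x where x: "p = Point x" using assms by (cases p) auto
  define k where "k = 1 + norm x"
  have k: "k > 0" by (simp add: k_def add_pos_nonneg)
  show "\<exists>d>0. \<forall>q\<in>S. dist q p < d \<longrightarrow> dist (the_point q) (the_point p) < e"
  \<comment> \<open>The first bound ensures the absorption hypothesis, the second makes the
    resulting estimate smaller than \<open>e\<close>.\<close>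
  proof (intro exI[of _ "min (1 / (2 * k)) (e / (2 * k\<^sup>2))"] conjI ballI impI)
    fix q assume q: "q \<in> S" "dist q p < min (1 / (2 * k)) (e / (2 * k\<^sup>2))"
    then obtain y where y: "q = Point y" using assms by (cases q) auto
    have d: "dist (Point x) (Point y) < 1 / (2 * k)" "dist (Point x) (Point y) < e / (2 * k\<^sup>2)"
      using q by (auto simp: x y dist_commute)
    have "dist (Point x) (Point y) * (1 + norm x) \<le> 1 / 2"
      using d(1) k by (simp add: k_def[symmetric] field_simps)
    then have "norm (x - y) \<le> 2 * dist (Point x) (Point y) * k\<^sup>2"
      unfolding k_def by (rule norm_diff_le_dist_Point)
    also have "\<dots> < e" using d(2) k by (simp add: field_simps)
    finally show "dist (the_point q) (the_point p) < e" by (simp add: x y dist_norm norm_minus_commute)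
  qed (use k e in auto)
qed

section \<open>Line integrals over broken lines\<close>

text \<open>The parameter runs over \<open>{0..1}\<close> with the speed as a factor, rather than
  over arc length, so that the integral is jointly measurable in both end points and can be averaged
  over them. A degenerate segment gives \<open>0\<close>.\<close>

definition seg_int :: "('a::euclidean_space \<Rightarrow> ennreal) \<Rightarrow> 'a \<Rightarrow> 'a \<Rightarrow> ennreal" where
  "seg_int \<rho> x z = ennreal (norm (z - x)) * (\<integral>\<^sup>+s. \<rho> (x + s *\<^sub>R (z - x)) * indicator {0..1} s \<partial>lborel)"

lemma seg_int_unit_speed:
  assumes [measurable]: "\<rho> \<in> borel_measurable borel"
  shows "(\<integral>\<^sup>+t. \<rho> (x + t *\<^sub>R sgn (z - x)) * indicator {0..norm (z - x)} t \<partial>lborel) = seg_int \<rho> x z"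
proof (cases "z = x")
  case True
  have "(\<integral>\<^sup>+t. \<rho> (x + t *\<^sub>R sgn (z - x)) * indicator {0..norm (z - x)} t \<partial>lborel) =
      (\<integral>\<^sup>+t. \<rho> x * indicator {0::real} t \<partial>lborel)"
    by (rule nn_integral_cong) (auto simp: True indicator_def)
  also have "\<dots> = 0" by (simp add: nn_integral_cmult)
  finally show ?thesis by (simp add: seg_int_def True)
next
  case False
  define A where "A = norm (z - x)"
  have A: "A > 0" using False by (simp add: A_def)
  have "(\<integral>\<^sup>+t. \<rho> (x + t *\<^sub>R sgn (z - x)) * indicator {0..A} t \<partial>lborel) =
     ennreal \<bar>A\<bar> * (\<integral>\<^sup>+s. \<rho> (x + (0 + A * s) *\<^sub>R sgn (z - x)) * indicator {0..A} (0 + A * s) \<partial>lborel)"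
    using A by (subst nn_integral_real_affine[where c = A and t = 0]) auto
  also have "(\<integral>\<^sup>+s. \<rho> (x + (0 + A * s) *\<^sub>R sgn (z - x)) * indicator {0..A} (0 + A * s) \<partial>lborel) =
      (\<integral>\<^sup>+s. \<rho> (x + s *\<^sub>R (z - x)) * indicator {0..1} s \<partial>lborel)"
  proof (rule nn_integral_cong)
    fix s
    have "(A * s) *\<^sub>R sgn (z - x) = s *\<^sub>R (z - x)"
      using A by (simp add: sgn_div_norm A_def)
    moreover have "indicator {0..A} (A * s) = (indicator {0..1} s :: ennreal)"
      using A by (auto simp: indicator_def zero_le_mult_iff mult_le_cancel_left_pos)
    ultimately show "\<rho> (x + (0 + A * s) *\<^sub>R sgn (z - x)) * indicator {0..A} (0 + A * s) =
        \<rho> (x + s *\<^sub>R (z - x)) * indicator {0..1} s" by simp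
  qed
  finally show ?thesis using A by (simp add: seg_int_def A_def)
qed

text \<open>Both pieces are run through with unit speed, so the parameter is arc length and the
  integral splits at the corner. If \<open>z = x\<close> or \<open>y = z\<close>, the direction
  \<open>sgn\<close> is \<open>0\<close> and the corresponding time interval is a point.\<close>

lemma broken_line:
  fixes \<rho> :: "'a::euclidean_space \<Rightarrow> ennreal"
  assumes \<rho>[measurable]: "\<rho> \<in> borel_measurable borel"
  obtains c L where "0 \<le> L" "continuous_on {0..L} c" "c 0 = x" "c L = y"
    "curve_length c 0 L < \<infinity>" "curve_integral \<rho> c 0 L = seg_int \<rho> x z + seg_int \<rho> z y"
proof -
  define A where "A = norm (z - x)"
  define B where "B = norm (y - z)"
  define c where "c t = (if t \<le> A then x + t *\<^sub>R sgn (z - x) else z + (t - A) *\<^sub>R sgn (y - z))" for t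
  have AB: "0 \<le> A" "0 \<le> B" by (auto simp: A_def B_def)
  have cA: "x + A *\<^sub>R sgn (z - x) = z" by (cases "z = x") (auto simp: A_def sgn_div_norm)
  have cont: "continuous_on UNIV c"
  proof -
    have "continuous_on ({..A} \<union> {A..}) c"
      unfolding c_def
      by (rule continuous_on_If) (auto intro!: continuous_intros simp: cA)
    moreover have "{..A} \<union> {A..} = UNIV" by auto
    ultimately show ?thesis by simp
  qed
  have [measurable]: "c \<in> borel_measurable borel"
    using cont by (rule borel_measurable_continuous_onI)
  have iso: "norm (x' + u *\<^sub>R sgn v - (x' + w *\<^sub>R sgn v)) = \<bar>u - w\<bar>"
    if "v \<noteq> 0 \<or> u = w" for x' v :: 'a and u w :: real
  proof -
    have "x' + u *\<^sub>R sgn v - (x' + w *\<^sub>R sgn v) = (u - w) *\<^sub>R sgn v" by (simp add: algebra_simps)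
    then show ?thesis using that by (auto simp: norm_sgn)
  qed
  have l1: "curve_length c 0 t = ennreal (t - 0)" if "t \<in> {0..A}" for t
  proof (rule curve_length_isometric)
    fix u v assume "u \<in> {0..t}" "v \<in> {0..t}"
    then show "norm (c u - c v) = \<bar>u - v\<bar>"
      using iso[of "z - x" u v x] that by (cases "z = x") (auto simp: c_def A_def)
  qed (use that in auto)
  have l2: "curve_length c A t = ennreal (t - A)" if t: "t \<in> {A..A+B}" for t
  proof (rule curve_length_isometric)
    fix u v assume uv: "u \<in> {A..t}" "v \<in> {A..t}"
    have "c w = z + (w - A) *\<^sub>R sgn (y - z)" if "w \<ge> A" for w
      using that cA by (cases "w = A") (auto simp: c_def)
    moreover have "y - z \<noteq> 0 \<or> u - A = v - A"
      using uv t by (cases "y = z") (auto simp: B_def)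
    ultimately show "norm (c u - c v) = \<bar>u - v\<bar>"
      using iso[of "y - z" "u - A" "v - A" z] uv by simp
  qed (use t in auto)
  have l3: "curve_length c 0 t = ennreal (t - 0)" if t: "t \<in> {0..A+B}" for t
  proof (cases "t \<le> A")
    case False
    then have "curve_length c 0 t = curve_length c 0 A + curve_length c A t"
      using AB by (intro curve_length_add) auto
    also have "\<dots> = ennreal (A - 0) + ennreal (t - A)"
      using l1[of A] l2[of t] t False AB by simp
    also have "\<dots> = ennreal (t - 0)" using False AB by (simp flip: ennreal_plus)
    finally show ?thesis .
  qed (use l1 t in auto)
  have "curve_integral \<rho> c 0 (A + B) = (\<integral>\<^sup>+t. \<rho> (c t) * indicator {0..A+B} t \<partial>lborel)"
    using l3 AB by (intro curve_integral_unit_speed) auto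
  also have "\<dots> = (\<integral>\<^sup>+t. \<rho> (c t) * indicator {0..A} t + \<rho> (c t) * indicator {A<..A+B} t \<partial>lborel)"
    using AB by (intro nn_integral_cong) (auto simp: indicator_def)
  also have "\<dots> = (\<integral>\<^sup>+t. \<rho> (c t) * indicator {0..A} t \<partial>lborel) + (\<integral>\<^sup>+t. \<rho> (c t) * indicator {A<..A+B} t \<partial>lborel)"
    by (subst nn_integral_add) auto
  also have "(\<integral>\<^sup>+t. \<rho> (c t) * indicator {0..A} t \<partial>lborel) = seg_int \<rho> x z"
    unfolding seg_int_unit_speed[OF \<rho>, symmetric] A_def[symmetric]
    by (intro nn_integral_cong) (auto simp: indicator_def c_def)
  also have "(\<integral>\<^sup>+t. \<rho> (c t) * indicator {A<..A+B} t \<partial>lborel) =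
      (\<integral>\<^sup>+t. \<rho> (c (A + 1 * t)) * indicator {A<..A+B} (A + 1 * t) \<partial>lborel)"
    by (subst nn_integral_real_affine[where c = 1 and t = A]) auto
  \<comment> \<open>The half-open interval left over from the splitting misses only
    \<open>t = 0\<close>.\<close>
  also have "\<dots> = (\<integral>\<^sup>+t. \<rho> (z + t *\<^sub>R sgn (y - z)) * indicator {0..B} t \<partial>lborel)"
  proof (rule nn_integral_cong_AE)
    have "AE t in lborel. t \<noteq> (0::real)" by (rule AE_lborel_singleton)
    then show "AE t in lborel. \<rho> (c (A + 1 * t)) * indicator {A<..A+B} (A + 1 * t) =
        \<rho> (z + t *\<^sub>R sgn (y - z)) * indicator {0..B} t"
      by eventually_elim (auto simp: indicator_def c_def)
  qed
  also have "\<dots> = seg_int \<rho> z y"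
    unfolding B_def by (rule seg_int_unit_speed[OF \<rho>])
  finally have "curve_integral \<rho> c 0 (A + B) = seg_int \<rho> x z + seg_int \<rho> z y" .
  moreover have "c (A + B) = y"
    using cA AB by (cases "B = 0") (auto simp: c_def B_def sgn_div_norm)
  moreover have "curve_length c 0 (A + B) < \<infinity>" using l3[of "A + B"] AB by simp
  moreover have "c 0 = x" using AB by (simp add: c_def)
  ultimately show ?thesis
    using that[of "A + B" c] AB continuous_on_subset[OF cont] by auto
qed

section \<open>Paths crossing the image of a ring\<close>

text \<open>By invariance of domain the open ball has an open image, so only points of the sphere
  can be mapped to the frontier.\<close>

lemma frontier_image_cball:
  fixes h :: "'a::euclidean_space \<Rightarrow> 'a"
  assumes "continuous_on (cball x0 s) h" "inj_on h (cball x0 s)"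
  shows "frontier (h ` cball x0 s) \<subseteq> h ` sphere x0 s"
proof -
  have "open (h ` ball x0 s)"
    using assms by (intro invariance_of_domain) (auto intro: continuous_on_subset inj_on_subset)
  then have "h ` ball x0 s \<subseteq> interior (h ` cball x0 s)"
    by (intro interior_maximal) auto
  moreover have "closed (h ` cball x0 s)"
    using assms by (intro compact_imp_closed compact_continuous_image) auto
  moreover have "cball x0 s = ball x0 s \<union> sphere x0 s" by auto
  ultimately show ?thesis by (auto simp: frontier_def)
qed

text \<open>The outer crossing is found first and the inner one on the part before it, which yields
  \<open>a' < b'\<close> and hence a subpath belonging to the family of the two image
  spheres.\<close>

lemma path_crosses_ring:
  fixes h :: "'a::euclidean_space \<Rightarrow> 'a" and a b :: real
  assumes h: "continuous_on (cball x0 s2) h" "inj_on h (cball x0 s2)" and s: "0 < s1" "s1 < s2"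
    and c: "continuous_on {a..b} c" "a \<le> b" "c a \<in> h ` cball x0 s1" "c b \<notin> h ` cball x0 s2"
  obtains a' b' where "a \<le> a'" "a' < b'" "b' \<le> b" "c a' \<in> h ` sphere x0 s1" "c b' \<in> h ` sphere x0 s2"
proof -
  have sub: "cball x0 s1 \<subseteq> cball x0 s2" "sphere x0 s1 \<subseteq> cball x0 s2" "sphere x0 s2 \<subseteq> cball x0 s2" using s by auto
  have conn: "connected (c ` {a..t})" if "t \<le> b" for t
    using that by (intro connected_continuous_image continuous_on_subset[OF c(1)] connected_Icc) auto
  have "c ` {a..b} \<inter> frontier (h ` cball x0 s2) \<noteq> {}"
    using c sub by (intro connected_Int_frontier conn) force+
  then obtain b' where b': "b' \<in> {a..b}" "c b' \<in> h ` sphere x0 s2"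
    using frontier_image_cball[OF h] by blast
  have disj: "h ` sphere x0 s2 \<inter> h ` cball x0 s1 = {}"
    using inj_on_image_Int[OF h(2) sub(3) sub(1)] s by auto
  have "c ` {a..b'} \<inter> frontier (h ` cball x0 s1) \<noteq> {}"
  proof (rule connected_Int_frontier)
    show "connected (c ` {a..b'})" using b' by (intro conn) auto
    show "c ` {a..b'} \<inter> h ` cball x0 s1 \<noteq> {}" using c(3) b' by force
    show "c ` {a..b'} - h ` cball x0 s1 \<noteq> {}" using b' disj by force
  qed
  moreover have "frontier (h ` cball x0 s1) \<subseteq> h ` sphere x0 s1"
    using h sub by (intro frontier_image_cball) (auto intro: continuous_on_subset inj_on_subset)
  ultimately obtain a' where a': "a' \<in> {a..b'}" "c a' \<in> h ` sphere x0 s1" by blast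
  have "a' \<noteq> b'" using a' b' disj by auto
  then show ?thesis using that[of a' b'] a' b' by auto
qed

lemma admissibleD:
  assumes "\<rho> \<in> admissible \<Gamma>" "(a, b, \<gamma>) \<in> \<Gamma>" "Infpt \<notin> \<gamma> ` {a..b}" "curve_length (the_point \<circ> \<gamma>) a b < \<infinity>"
  shows "1 \<le> curve_integral \<rho> (the_point \<circ> \<gamma>) a b"
  using assms unfolding admissible_def by fast

text \<open>Turns admissibility into an inequality about segments: the piece between the two
  crossings belongs to the family, and the rest of the broken line can only add to the
  integral.\<close>

lemma admissible_broken_line:
  fixes h :: "'a::euclidean_space \<Rightarrow> 'a"
  assumes h: "continuous_on (cball x0 s2) h" "inj_on h (cball x0 s2)" and s: "0 < s1" "s1 < s2"
    and \<rho>: "\<rho> \<in> admissible (path_family (Point ` h ` sphere x0 s1) (Point ` h ` sphere x0 s2))"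
    and xy: "x \<in> h ` cball x0 s1" "y \<notin> h ` cball x0 s2"
  shows "1 \<le> seg_int \<rho> x z + seg_int \<rho> z y"
proof -
  have m: "\<rho> \<in> borel_measurable borel" using \<rho> by (simp add: admissible_def)
  obtain c L where c: "0 \<le> L" "continuous_on {0..L} c" "c 0 = x" "c L = y"
    "curve_length c 0 L < \<infinity>" "curve_integral \<rho> c 0 L = seg_int \<rho> x z + seg_int \<rho> z y"
    using broken_line[OF m] .
  obtain a' b' where ab: "0 \<le> a'" "a' < b'" "b' \<le> L" "c a' \<in> h ` sphere x0 s1" "c b' \<in> h ` sphere x0 s2"
    using path_crosses_ring[OF h s c(2,1)] c xy by metis
  have comp: "the_point \<circ> (Point \<circ> c) = c" by auto
  have cont: "continuous_on {a'..b'} c" using ab by (intro continuous_on_subset[OF c(2)]) auto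
  have "(a', b', Point \<circ> c) \<in> path_family (Point ` h ` sphere x0 s1) (Point ` h ` sphere x0 s2)"
    unfolding path_family_def
    using ab continuous_on_compose[OF cont continuous_on_Point] by auto
  moreover have "Infpt \<notin> (Point \<circ> c) ` {a'..b'}" by auto
  moreover have "curve_length (the_point \<circ> (Point \<circ> c)) a' b' < \<infinity>"
    using curve_length_mono[of 0 a' b' L c] ab c(5) unfolding comp by (auto simp: le_less_trans)
  ultimately have "1 \<le> curve_integral \<rho> (the_point \<circ> (Point \<circ> c)) a' b'"
    by (rule admissibleD[OF \<rho>])
  also have "\<dots> \<le> curve_integral \<rho> c 0 L"
    unfolding comp using ab c m by (intro curve_integral_mono) auto
  finally show ?thesis by (simp add: c)
qed

text \<open>Minorization: a density giving the subpaths \<open>\<rho>\<close>-length at least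
  \<open>1\<close> does so for the longer paths too, hence the infimum for \<open>\<Gamma>\<close>
  runs over a larger set.\<close>

lemma modulus_le_of_subpaths:
  fixes \<Gamma> \<Gamma>' :: "'a::euclidean_space ext_path set"
  assumes "\<And>a b \<gamma>. (a, b, \<gamma>) \<in> \<Gamma> \<Longrightarrow> Infpt \<notin> \<gamma> ` {a..b} \<Longrightarrow> continuous_on {a..b} \<gamma> \<and>
      (\<exists>a' b'. a \<le> a' \<and> a' \<le> b' \<and> b' \<le> b \<and> (a', b', \<gamma>) \<in> \<Gamma>')"
  shows "modulus \<Gamma> \<le> modulus \<Gamma>'"
  unfolding modulus_def
proof (rule INF_superset_mono[OF _ order_refl], rule subsetI)
  fix \<rho> assume \<rho>: "\<rho> \<in> admissible \<Gamma>'"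
  then have m: "\<rho> \<in> borel_measurable borel" by (simp add: admissible_def)
  have "1 \<le> curve_integral \<rho> (the_point \<circ> \<gamma>) a b"
    if \<gamma>: "(a, b, \<gamma>) \<in> \<Gamma>" "Infpt \<notin> \<gamma> ` {a..b}" "curve_length (the_point \<circ> \<gamma>) a b < \<infinity>" for a b \<gamma>
  proof -
    obtain a' b' where ab: "a \<le> a'" "a' \<le> b'" "b' \<le> b" "(a', b', \<gamma>) \<in> \<Gamma>'" and "continuous_on {a..b} \<gamma>"
      using assms[OF \<gamma>(1,2)] by blast
    then have cont: "continuous_on {a..b} (the_point \<circ> \<gamma>)"
      using \<gamma>(2) by (intro continuous_on_compose continuous_on_the_point) auto
    have "curve_length (the_point \<circ> \<gamma>) a' b' < \<infinity>"
      using curve_length_mono[of a a' b' b "the_point \<circ> \<gamma>"] ab \<gamma>(3) by (auto simp: le_less_trans)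
    moreover have "Infpt \<notin> \<gamma> ` {a'..b'}" using \<gamma>(2) ab by auto
    ultimately have "1 \<le> curve_integral \<rho> (the_point \<circ> \<gamma>) a' b'"
      using admissibleD[OF \<rho> ab(4)] by blast
    also have "\<dots> \<le> curve_integral \<rho> (the_point \<circ> \<gamma>) a b"
      using ab cont \<gamma>(3) m by (intro curve_integral_mono) auto
    finally show ?thesis .
  qed
  then show "\<rho> \<in> admissible \<Gamma>" using m unfolding admissible_def by blast
qed

text \<open>Used with \<open>h\<close> a member of a convergent sequence and \<open>A\<close>,
  \<open>B\<close> the images of two spheres under the limit; a path from \<open>A\<close> to
  \<open>B\<close> must cross the image of the intermediate ring.\<close>

lemma modulus_le_of_ring_crossing:
  fixes h :: "'a::euclidean_space \<Rightarrow> 'a"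
  assumes h: "continuous_on (cball x0 s2) h" "inj_on h (cball x0 s2)" and s: "0 < s1" "s1 < s2"
    and AB: "A \<subseteq> h ` cball x0 s1" "B \<inter> h ` cball x0 s2 = {}"
  shows "modulus (path_family (Point ` A) (Point ` B)) \<le>
      modulus (path_family (Point ` h ` sphere x0 s1) (Point ` h ` sphere x0 s2))"
proof (rule modulus_le_of_subpaths)
  fix a b \<gamma> assume \<gamma>: "(a, b, \<gamma>) \<in> path_family (Point ` A) (Point ` B)" "Infpt \<notin> \<gamma> ` {a..b}"
  then have g: "a < b" "continuous_on {a..b} \<gamma>" "\<gamma> a \<in> Point ` A" "\<gamma> b \<in> Point ` B"
    by (auto simp: path_family_def)
  have cont: "continuous_on {a..b} (the_point \<circ> \<gamma>)"
    using \<gamma>(2) g by (intro continuous_on_compose continuous_on_the_point) auto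
  have "(the_point \<circ> \<gamma>) a \<in> h ` cball x0 s1" "(the_point \<circ> \<gamma>) b \<notin> h ` cball x0 s2"
    using g AB by auto
  then obtain a' b' where ab: "a \<le> a'" "a' < b'" "b' \<le> b" "(the_point \<circ> \<gamma>) a' \<in> h ` sphere x0 s1"
      "(the_point \<circ> \<gamma>) b' \<in> h ` sphere x0 s2"
    using path_crosses_ring[OF h s cont] g(1) by (metis less_imp_le)
  have P: "\<gamma> t \<in> Point ` V" if "(the_point \<circ> \<gamma>) t \<in> V" "t \<in> {a..b}" for t V
    using that \<gamma>(2) by (cases "\<gamma> t") force+
  have "(a', b', \<gamma>) \<in> path_family (Point ` h ` sphere x0 s1) (Point ` h ` sphere x0 s2)"
    unfolding path_family_def using ab P g(2) by (auto intro: continuous_on_subset)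
  then show "continuous_on {a..b} \<gamma> \<and> (\<exists>a' b'. a \<le> a' \<and> a' \<le> b' \<and> b' \<le> b \<and>
      (a', b', \<gamma>) \<in> path_family (Point ` h ` sphere x0 s1) (Point ` h ` sphere x0 s2))"
    using ab g by (auto intro: less_imp_le)
qed

section \<open>A Loewner type estimate\<close>

text \<open>A substitute for Hoelder's inequality: where \<open>X\<close> exceeds
  \<open>\<kappa>\<close>, the factor \<open>(X / \<kappa>) ^ (n - 1)\<close> is at least
  \<open>1\<close>. After integration only \<open>\<kappa>\<close> remains to be chosen.\<close>

lemma ennreal_le_add_power:
  fixes X :: ennreal
  assumes "0 < \<kappa>" "1 \<le> n"
  shows "X \<le> ennreal \<kappa> + ennreal ((1 / \<kappa>) ^ (n - 1)) * X ^ n"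
proof (cases "X \<le> ennreal \<kappa>")
  case True
  then show ?thesis by (rule add_increasing2[rotated]) simp
next
  case False
  have "1 = ennreal (1 / \<kappa>) * ennreal \<kappa>"
    using assms by (simp flip: ennreal_mult)
  also have "\<dots> \<le> ennreal (1 / \<kappa>) * X" using False by (intro mult_left_mono) auto
  finally have "1 \<le> (ennreal (1 / \<kappa>) * X) ^ (n - 1)" by (rule one_le_power)
  then have "1 * X \<le> (ennreal (1 / \<kappa>) * X) ^ (n - 1) * X" by (rule mult_right_mono) simp
  also have "\<dots> = ennreal ((1 / \<kappa>) ^ (n - 1)) * (X ^ (n - 1) * X)"
    using assms by (simp add: power_mult_distrib ennreal_power mult.assoc)
  also have "X ^ (n - 1) * X = X ^ n" using assms(2) by (metis power_minus_mult zero_less_one order_less_le_trans)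
  finally show ?thesis by (simp add: add_increasing)
qed

section \<open>Averages of segment integrals over a ball\<close>

lemma nn_integral_affine:
  fixes t :: "'a::euclidean_space"
  assumes [measurable]: "g \<in> borel_measurable borel" and "c \<noteq> 0"
  shows "(\<integral>\<^sup>+x. g x \<partial>lborel) = ennreal (\<bar>c\<bar> ^ DIM('a)) * (\<integral>\<^sup>+x. g (t + c *\<^sub>R x) \<partial>lborel)"
  by (subst lborel_affine[OF assms(2), of t])
     (simp add: nn_integral_density nn_integral_distr nn_integral_cmult)

lemma seg_int_measurable [measurable]:
  fixes \<rho> :: "'a::euclidean_space \<Rightarrow> ennreal"
  assumes [measurable]: "\<rho> \<in> borel_measurable borel" "g \<in> borel_measurable M" "h \<in> borel_measurable M"
  shows "(\<lambda>x. seg_int \<rho> (g x) (h x)) \<in> borel_measurable M"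
  unfolding seg_int_def by measurable

lemma seg_int_commute:
  assumes [measurable]: "\<rho> \<in> borel_measurable borel"
  shows "seg_int \<rho> x z = seg_int \<rho> z x"
proof -
  have "(\<integral>\<^sup>+s. \<rho> (x + s *\<^sub>R (z - x)) * indicator {0..1} s \<partial>lborel) =
      ennreal \<bar>-1\<bar> * (\<integral>\<^sup>+s. \<rho> (x + (1 + (-1) * s) *\<^sub>R (z - x)) * indicator {0..1} (1 + (-1) * s) \<partial>lborel)"
    by (rule nn_integral_real_affine) auto
  also have "\<dots> = (\<integral>\<^sup>+s. \<rho> (z + s *\<^sub>R (x - z)) * indicator {0..1} s \<partial>lborel)"
    by (simp, rule nn_integral_cong) (auto simp: indicator_def algebra_simps)
  finally show ?thesis by (simp add: seg_int_def norm_minus_commute)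
qed

text \<open>At contraction factor \<open>s\<close> a given point is reached only from parameters \<open>t\<close> in an interval of
  length \<open>4 R s\<close>, since \<open>e\<close> moves with unit speed in direction \<open>b\<close>.\<close>

lemma contraction_average:
  fixes e :: "real \<Rightarrow> 'a::euclidean_space"
  assumes [measurable]: "e \<in> borel_measurable borel" "f \<in> borel_measurable borel"
    and e: "\<And>t. t \<in> {0..w} \<Longrightarrow> e t \<in> cball p R \<and> e t \<bullet> b = l + t" and b: "norm b = 1"
    and s: "0 < s" and R: "0 < R"
  shows "ennreal (s ^ (DIM('a) - 1)) *
      (\<integral>\<^sup>+t\<in>{0..w}. (\<integral>\<^sup>+z\<in>cball p R. f (e t + s *\<^sub>R (z - e t)) \<partial>lborel) \<partial>lborel)
      \<le> ennreal (4 * R) * (\<integral>\<^sup>+x. f x \<partial>lborel)"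
proof -
  have [measurable]: "cball p R \<in> sets borel" by simp
  let ?n = "DIM('a)"
  let ?J = "\<integral>\<^sup>+t\<in>{0..w}. (\<integral>\<^sup>+z\<in>cball p R. f (e t + s *\<^sub>R (z - e t)) \<partial>lborel) \<partial>lborel"
  have n: "s ^ ?n = s * s ^ (?n - 1)"
    using DIM_positive[where 'a='a] by (metis power_eq_if less_not_refl)
  \<comment> \<open>Since \<open>z\<close> and \<open>e t\<close> both lie in the ball, the
    contracted point stays in a slab of half-width \<open>2 * R * s\<close> about the level
    \<open>l + t\<close>. Recording this by an indicator is what later gains a factor
    \<open>s\<close> in the integration over \<open>t\<close>.\<close>
  have 1: "ennreal (s ^ ?n) * (\<integral>\<^sup>+z\<in>cball p R. f (e t + s *\<^sub>R (z - e t)) \<partial>lborel)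
      \<le> (\<integral>\<^sup>+x. f x * indicator {l + t - 2 * R * s .. l + t + 2 * R * s} (x \<bullet> b) \<partial>lborel)" if t: "t \<in> {0..w}" for t
  proof -
    have "(\<integral>\<^sup>+z\<in>cball p R. f (e t + s *\<^sub>R (z - e t)) \<partial>lborel) \<le>
        (\<integral>\<^sup>+z. f ((e t - s *\<^sub>R e t) + s *\<^sub>R z) *
          indicator {l + t - 2 * R * s .. l + t + 2 * R * s} (((e t - s *\<^sub>R e t) + s *\<^sub>R z) \<bullet> b) \<partial>lborel)"
    proof (rule nn_integral_mono)
      fix z
      have eq: "(e t - s *\<^sub>R e t) + s *\<^sub>R z = e t + s *\<^sub>R (z - e t)" by (simp add: algebra_simps)
      have "(e t + s *\<^sub>R (z - e t)) \<bullet> b \<in> {l + t - 2 * R * s .. l + t + 2 * R * s}" if "z \<in> cball p R"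
      proof -
        have "norm (z - e t) \<le> 2 * R"
          using that e[OF t] norm_triangle_ineq4[of "z - p" "e t - p"] by (auto simp: dist_norm norm_minus_commute)
        then have "\<bar>(z - e t) \<bullet> b\<bar> \<le> 2 * R"
          using Cauchy_Schwarz_ineq2[of "z - e t" b] b by auto
        then have "\<bar>s * ((z - e t) \<bullet> b)\<bar> \<le> s * (2 * R)"
          using s by (simp add: abs_mult)
        moreover have "(e t + s *\<^sub>R (z - e t)) \<bullet> b = l + t + s * ((z - e t) \<bullet> b)"
          using e[OF t] by (simp add: inner_add_left)
        ultimately show ?thesis by (auto simp: abs_le_iff algebra_simps)
      qed
      then show "f (e t + s *\<^sub>R (z - e t)) * indicator (cball p R) z \<le>
          f ((e t - s *\<^sub>R e t) + s *\<^sub>R z) *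
          indicator {l + t - 2 * R * s .. l + t + 2 * R * s} (((e t - s *\<^sub>R e t) + s *\<^sub>R z) \<bullet> b)"
        unfolding eq by (auto simp: indicator_def)
    qed
    then have "ennreal (s ^ ?n) * (\<integral>\<^sup>+z\<in>cball p R. f (e t + s *\<^sub>R (z - e t)) \<partial>lborel) \<le> ennreal (\<bar>s\<bar> ^ ?n) * \<dots>"
      using s by (intro mult_mono) auto
    also have "\<dots> = (\<integral>\<^sup>+x. f x * indicator {l + t - 2 * R * s .. l + t + 2 * R * s} (x \<bullet> b) \<partial>lborel)"
      using s by (intro nn_integral_affine[symmetric]) auto
    finally show ?thesis .
  qed
  \<comment> \<open>One additional factor \<open>s\<close> completes the Jacobian
    \<open>s ^ n\<close>; the slab integration produces an \<open>s\<close> on the right as well,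
    and both are cancelled at the end.\<close>
  have "ennreal s * (ennreal (s ^ (?n - 1)) * ?J) = ennreal (s ^ ?n) * ?J"
    using s by (simp add: n ennreal_mult mult.assoc)
  also have "\<dots> = (\<integral>\<^sup>+t. ennreal (s ^ ?n) * ((\<integral>\<^sup>+z\<in>cball p R. f (e t + s *\<^sub>R (z - e t)) \<partial>lborel) * indicator {0..w} t) \<partial>lborel)"
    by (rule nn_integral_cmult[symmetric]) measurable
  also have "\<dots> \<le> (\<integral>\<^sup>+t. (\<integral>\<^sup>+x. f x * indicator {l + t - 2 * R * s .. l + t + 2 * R * s} (x \<bullet> b) \<partial>lborel) \<partial>lborel)"
  proof (rule nn_integral_mono)
    fix t show "ennreal (s ^ ?n) * ((\<integral>\<^sup>+z\<in>cball p R. f (e t + s *\<^sub>R (z - e t)) \<partial>lborel) * indicator {0..w} t)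
        \<le> (\<integral>\<^sup>+x. f x * indicator {l + t - 2 * R * s .. l + t + 2 * R * s} (x \<bullet> b) \<partial>lborel)"
      using 1[of t] by (cases "t \<in> {0..w}") auto
  qed
  \<comment> \<open>For fixed \<open>x\<close> the slab condition is read as a condition on
    \<open>t\<close>.\<close>
  also have "\<dots> = (\<integral>\<^sup>+t. (\<integral>\<^sup>+x. f x * indicator {x \<bullet> b - l - 2 * R * s .. x \<bullet> b - l + 2 * R * s} t \<partial>lborel) \<partial>lborel)"
    by (intro nn_integral_cong) (auto simp: indicator_def)
  also have "\<dots> = (\<integral>\<^sup>+x. (\<integral>\<^sup>+t. f x * indicator {x \<bullet> b - l - 2 * R * s .. x \<bullet> b - l + 2 * R * s} t \<partial>lborel) \<partial>lborel)"
  proof (rule lborel_pair.Fubini')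
    have "Measurable.pred (lborel \<Otimes>\<^sub>M lborel) (\<lambda>(x, t). x \<bullet> b - l - 2 * R * s \<le> t \<and> t \<le> x \<bullet> b - l + 2 * R * s)"
      by measurable
    then show "(\<lambda>(x, t). f x * indicator {x \<bullet> b - l - 2 * R * s .. x \<bullet> b - l + 2 * R * s} t) \<in> borel_measurable (lborel \<Otimes>\<^sub>M lborel)"
      unfolding indicator_def of_bool_def atLeastAtMost_iff by measurable
  qed
  also have "\<dots> = (\<integral>\<^sup>+x. f x * ennreal (4 * R * s) \<partial>lborel)"
    using R s by (intro nn_integral_cong) (simp add: nn_integral_cmult mult.assoc)
  also have "\<dots> = ennreal (4 * R * s) * (\<integral>\<^sup>+x. f x \<partial>lborel)"
    by (subst nn_integral_multc) (auto simp: mult.commute)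
  also have "\<dots> = ennreal s * (ennreal (4 * R) * (\<integral>\<^sup>+x. f x \<partial>lborel))"
    using R s by (simp add: ennreal_mult mult_ac)
  finally have *: "ennreal s * (ennreal (s ^ (?n - 1)) * ?J) \<le> ennreal s * (ennreal (4 * R) * (\<integral>\<^sup>+x. f x \<partial>lborel))" .
  have "ennreal (1 / s) * (ennreal s * Y) = Y" for Y
    using s by (simp flip: ennreal_mult mult.assoc)
  then show ?thesis
    using mult_left_mono[OF *, of "ennreal (1 / s)"] by simp
qed

text \<open>The weight \<open>s powr ((n - 1) / n)\<close> is chosen such that its inverse is integrable near \<open>0\<close>
  while its \<open>n\<close>-th power compensates the contraction.\<close>

lemma seg_int_average:
  fixes e :: "real \<Rightarrow> 'a::euclidean_space"
  assumes [measurable]: "e \<in> borel_measurable borel" "\<rho> \<in> borel_measurable borel"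
    and e: "\<And>t. t \<in> {0..w} \<Longrightarrow> e t \<in> cball p R \<and> e t \<bullet> b = l + t" and b: "norm b = 1"
    and R: "0 < R" and \<kappa>: "0 < \<kappa>" and w: "0 \<le> w"
  shows "(\<integral>\<^sup>+t\<in>{0..w}. (\<integral>\<^sup>+z\<in>cball p R. seg_int \<rho> (e t) z \<partial>lborel) \<partial>lborel)
    \<le> ennreal (2 * R * DIM('a)) *
      (ennreal \<kappa> * (emeasure lborel (cball p R) * ennreal w) +
       ennreal ((1 / \<kappa>) ^ (DIM('a) - 1)) * (ennreal (4 * R) * (\<integral>\<^sup>+x. \<rho> x ^ DIM('a) \<partial>lborel)))"
proof -
  have [measurable]: "cball p R \<in> sets borel" by simp
  define n where "n = DIM('a)"
  have n: "n \<ge> 1" by (simp add: n_def Suc_leI)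
  define N where "N = (\<integral>\<^sup>+x. \<rho> x ^ n \<partial>lborel)"
  define M where "M = ennreal \<kappa> * (emeasure lborel (cball p R) * ennreal w) + ennreal ((1 / \<kappa>) ^ (n - 1)) * (ennreal (4 * R) * N)"
  define v where "v s = s powr ((real n - 1) / n)" for s
  define W where "W s = s powr (- ((real n - 1) / n))" for s
  define G where "G s t z = \<rho> (e t + s *\<^sub>R (z - e t)) * indicator (cball p R) z * indicator {0..w} t * indicator {0..1} s" for s t z
  have vW: "v s > 0" "W s > 0" "W s * v s = 1" "v s ^ n = s ^ (n - 1)" if "s > 0" for s
  proof -
    show "v s > 0" "W s > 0" "W s * v s = 1" using that by (auto simp: v_def W_def simp flip: powr_add)
    have "v s ^ n = s powr (((real n - 1) / n) * n)"
      using that by (simp add: v_def powr_powr flip: powr_realpow)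
    also have "((real n - 1) / n) * n = real (n - 1)" using n by (simp add: of_nat_diff)
    finally show "v s ^ n = s ^ (n - 1)" using that by (simp add: powr_realpow)
  qed
  have mG[measurable]: "(\<lambda>x. G (fst x) (fst (snd x)) (snd (snd x))) \<in> borel_measurable (lborel \<Otimes>\<^sub>M (lborel \<Otimes>\<^sub>M lborel))"
    unfolding G_def by measurable
  \<comment> \<open>The value \<open>s = 0\<close> is excluded because \<open>0 powr x = 0\<close>
    makes \<open>W 0\<close> vanish; it is a null set in the outer integral.\<close>
  have slice: "(\<integral>\<^sup>+t. (\<integral>\<^sup>+z. G s t z \<partial>lborel) \<partial>lborel) \<le> (ennreal (W s) * indicator {0..1} s) * M" if s: "s \<noteq> 0" for s
  proof (cases "s \<in> {0..1}")
    case True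
    then have s0: "s > 0" using s by auto
    \<comment> \<open>\<open>ennreal_le_add_power\<close> is applied to
      \<open>v s * \<rho> y\<close>. Multiplying back by \<open>W s\<close> leaves the integrable
      weight in front of both terms, and \<open>v s ^ n = s ^ (n - 1)\<close> is the weight that
      \<open>contraction_average\<close> tolerates.\<close>
    have pt: "\<rho> y \<le> ennreal (W s) * ennreal \<kappa> + ennreal (W s) * (ennreal ((1 / \<kappa>) ^ (n - 1)) * ennreal (s ^ (n - 1))) * \<rho> y ^ n" for y
    proof -
      have "\<rho> y = ennreal (W s) * (ennreal (v s) * \<rho> y)"
        using vW[OF s0] by (simp flip: ennreal_mult mult.assoc)
      also have "\<dots> \<le> ennreal (W s) * (ennreal \<kappa> + ennreal ((1 / \<kappa>) ^ (n - 1)) * (ennreal (v s) * \<rho> y) ^ n)"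
        by (intro mult_left_mono ennreal_le_add_power \<kappa> n) auto
      also have "(ennreal (v s) * \<rho> y) ^ n = ennreal (s ^ (n - 1)) * \<rho> y ^ n"
        using vW[OF s0] by (simp add: power_mult_distrib ennreal_power)
      finally show ?thesis by (simp add: distrib_left mult.assoc)
    qed
    let ?C = "ennreal (W s) * (ennreal ((1 / \<kappa>) ^ (n - 1)) * ennreal (s ^ (n - 1)))"
    have "(\<integral>\<^sup>+t. (\<integral>\<^sup>+z. G s t z \<partial>lborel) \<partial>lborel) \<le>
        (\<integral>\<^sup>+t. (\<integral>\<^sup>+z. (ennreal (W s) * ennreal \<kappa>) * indicator (cball p R) z * indicator {0..w} t +
           ?C * (\<rho> (e t + s *\<^sub>R (z - e t)) ^ n * indicator (cball p R) z * indicator {0..w} t) \<partial>lborel) \<partial>lborel)"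
      unfolding G_def by (intro nn_integral_mono) (use pt in \<open>auto simp: indicator_def\<close>)
    also have "\<dots> = (\<integral>\<^sup>+t. (ennreal (W s) * ennreal \<kappa>) * emeasure lborel (cball p R) * indicator {0..w} t +
           ?C * ((\<integral>\<^sup>+z\<in>cball p R. \<rho> (e t + s *\<^sub>R (z - e t)) ^ n \<partial>lborel) * indicator {0..w} t) \<partial>lborel)"
      by (intro nn_integral_cong)
        (simp add: nn_integral_add nn_integral_cmult nn_integral_multc)
    also have "\<dots> = (ennreal (W s) * ennreal \<kappa>) * emeasure lborel (cball p R) * ennreal w +
           ?C * (\<integral>\<^sup>+t\<in>{0..w}. (\<integral>\<^sup>+z\<in>cball p R. \<rho> (e t + s *\<^sub>R (z - e t)) ^ n \<partial>lborel) \<partial>lborel)"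
      using w by (simp add: nn_integral_add nn_integral_cmult nn_integral_multc)
    also have "\<dots> = ennreal (W s) * (ennreal \<kappa> * (emeasure lborel (cball p R) * ennreal w) + ennreal ((1 / \<kappa>) ^ (n - 1)) *
        (ennreal (s ^ (n - 1)) * (\<integral>\<^sup>+t\<in>{0..w}. (\<integral>\<^sup>+z\<in>cball p R. \<rho> (e t + s *\<^sub>R (z - e t)) ^ n \<partial>lborel) \<partial>lborel)))"
      by (simp add: distrib_left mult.assoc)
    also have "\<dots> \<le> ennreal (W s) * M"
      unfolding M_def N_def n_def
      by (intro mult_left_mono add_left_mono contraction_average[OF _ _ e b s0 R]) auto
    finally show ?thesis using True by simp
  next
    case False
    then show ?thesis by (simp add: G_def)
  qed
  have seg: "seg_int \<rho> (e t) z * indicator (cball p R) z * indicator {0..w} t \<le> ennreal (2 * R) * (\<integral>\<^sup>+s. G s t z \<partial>lborel)" for t z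
  proof (cases "t \<in> {0..w} \<and> z \<in> cball p R")
    case True
    then have "norm (z - e t) \<le> 2 * R"
      using e[of t] norm_triangle_ineq4[of "z - p" "e t - p"] by (auto simp: dist_norm norm_minus_commute)
    then show ?thesis
      using True unfolding seg_int_def G_def by (auto intro!: mult_mono ennreal_leI)
  qed auto
  have "(\<integral>\<^sup>+t\<in>{0..w}. (\<integral>\<^sup>+z\<in>cball p R. seg_int \<rho> (e t) z \<partial>lborel) \<partial>lborel) =
      (\<integral>\<^sup>+t. (\<integral>\<^sup>+z. seg_int \<rho> (e t) z * indicator (cball p R) z * indicator {0..w} t \<partial>lborel) \<partial>lborel)"
    unfolding seg_int_def by (intro nn_integral_cong nn_integral_multc[symmetric]) measurable
  also have "\<dots> \<le> (\<integral>\<^sup>+t. (\<integral>\<^sup>+z. ennreal (2 * R) * (\<integral>\<^sup>+s. G s t z \<partial>lborel) \<partial>lborel) \<partial>lborel)"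
    by (intro nn_integral_mono seg)
  also have "\<dots> = ennreal (2 * R) * (\<integral>\<^sup>+t. (\<integral>\<^sup>+z. (\<integral>\<^sup>+s. G s t z \<partial>lborel) \<partial>lborel) \<partial>lborel)"
    unfolding G_def by (simp add: nn_integral_cmult)
  also have "(\<integral>\<^sup>+t. (\<integral>\<^sup>+z. (\<integral>\<^sup>+s. G s t z \<partial>lborel) \<partial>lborel) \<partial>lborel) =
      (\<integral>\<^sup>+t. (\<integral>\<^sup>+s. (\<integral>\<^sup>+z. G s t z \<partial>lborel) \<partial>lborel) \<partial>lborel)"
    unfolding G_def by (intro nn_integral_cong lborel_pair.Fubini') measurable
  also have "\<dots> = (\<integral>\<^sup>+s. (\<integral>\<^sup>+t. (\<integral>\<^sup>+z. G s t z \<partial>lborel) \<partial>lborel) \<partial>lborel)"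
    unfolding G_def by (intro lborel_pair.Fubini') measurable
  also have "\<dots> \<le> (\<integral>\<^sup>+s. (ennreal (W s) * indicator {0..1} s) * M \<partial>lborel)"
  proof (rule nn_integral_mono_AE)
    have "AE s in lborel. s \<noteq> (0::real)" by (rule AE_lborel_singleton)
    then show "AE s in lborel. (\<integral>\<^sup>+t. (\<integral>\<^sup>+z. G s t z \<partial>lborel) \<partial>lborel) \<le> (ennreal (W s) * indicator {0..1} s) * M"
      by eventually_elim (rule slice)
  qed
  also have "\<dots> = (\<integral>\<^sup>+s. ennreal (W s) * indicator {0..1} s \<partial>lborel) * M"
    unfolding W_def by (rule nn_integral_multc) measurable
  \<comment> \<open>The exponent of \<open>W\<close> plus one is \<open>1 / n\<close>, so this
    integral is \<open>n\<close>; it is the source of \<open>DIM('a)\<close> in the bound.\<close>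
  also have "(\<integral>\<^sup>+s. ennreal (W s) * indicator {0..1} s \<partial>lborel) = ennreal (real n)"
  proof -
    have *: "- ((real n - 1) / n) + 1 = 1 / n" using n by (simp add: field_simps)
    then have "- ((real n - 1) / n) > -1" using n by (smt (verit) divide_pos_pos of_nat_0_less_iff less_le_trans zero_less_one)
    then have "(W has_integral (1 powr (1 / n) / (1 / n))) {0..1}"
      unfolding W_def using has_integral_powr_from_0[of "- ((real n - 1) / n)" 1] unfolding * by simp
    then have int: "(W has_integral (real n)) {0..1}" by simp
    show ?thesis by (rule nn_integral_has_integral_lebesgue'[OF _ int]) (simp add: W_def)
  qed
  finally have "(\<integral>\<^sup>+t\<in>{0..w}. (\<integral>\<^sup>+z\<in>cball p R. seg_int \<rho> (e t) z \<partial>lborel) \<partial>lborel) \<le> ennreal (2 * R) * (ennreal (real n) * M)"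
    by (simp add: mult_left_mono)
  also have "\<dots> = ennreal (2 * R * n) * M" using R by (simp add: ennreal_mult mult.assoc)
  finally show ?thesis unfolding M_def N_def n_def .
qed

text \<open>The first hitting times of the levels \<open>l + t\<close> are monotone in \<open>t\<close>, hence Borel.\<close>

lemma path_level_selection:
  fixes \<alpha> :: "real \<Rightarrow> 'a::euclidean_space"
  assumes "path \<alpha>" "(pathfinish \<alpha> - pathstart \<alpha>) \<bullet> b \<ge> w"
  obtains e where "e \<in> borel_measurable borel"
    "\<And>t. t \<in> {0..w} \<Longrightarrow> e t \<in> path_image \<alpha> \<and> e t \<bullet> b = pathstart \<alpha> \<bullet> b + t"
proof -
  define l where "l = pathstart \<alpha> \<bullet> b"
  \<comment> \<open>Using \<open>\<le>\<close> instead of equality makes \<open>S\<close> decreasing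
    in \<open>t\<close>, whence \<open>\<tau>\<close> is monotone; inserting \<open>1\<close> keeps
    \<open>S t\<close> nonempty for all real \<open>t\<close>.\<close>
  define S where "S t = insert 1 {s \<in> {0..1}. l + t \<le> \<alpha> s \<bullet> b}" for t
  define \<tau> where "\<tau> t = Inf (S t)" for t
  \<comment> \<open>Clamping the argument extends \<open>\<alpha>\<close> continuously to the whole
    line, so that the composition with \<open>\<tau>\<close> is Borel everywhere.\<close>
  define a where "a s = \<alpha> (max 0 (min 1 s))" for s
  have cont: "continuous_on {0..1} \<alpha>" using assms(1) by (simp add: path_def)
  have "continuous_on UNIV a"
    unfolding a_def by (rule continuous_on_compose2[OF cont]) (auto intro!: continuous_intros)
  then have [measurable]: "a \<in> borel_measurable borel" by (rule borel_measurable_continuous_onI)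
  have bdd: "bdd_below (S t)" for t by (rule bdd_belowI[of _ 0]) (auto simp: S_def)
  have "mono \<tau>"
    unfolding \<tau>_def by (intro monoI cInf_superset_mono bdd) (auto simp: S_def)
  then have [measurable]: "\<tau> \<in> borel_measurable borel" by (rule borel_measurable_mono)
  have "\<alpha> (\<tau> t) \<bullet> b = l + t \<and> \<tau> t \<in> {0..1}" if t: "t \<in> {0..w}" for t
  proof -
    have cb: "continuous_on {0..1} (\<lambda>s. \<alpha> s \<bullet> b)" by (intro continuous_intros cont)
    have end1: "l + t \<le> \<alpha> 1 \<bullet> b"
      using t assms(2) by (auto simp: l_def pathstart_def pathfinish_def inner_diff_left)
    then have S: "S t = {0..1} \<inter> {s \<in> {0..1}. l + t \<le> \<alpha> s \<bullet> b}" by (auto simp: S_def)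
    have "closed (S t)"
      unfolding S by (intro closed_Int closed_atLeastAtMost continuous_on_closed_Collect_le[OF _ cb] continuous_intros)
    then have "\<tau> t \<in> S t"
      unfolding \<tau>_def by (intro closed_contains_Inf bdd) (auto simp: S_def)
    then have ge: "\<tau> t \<in> {0..1}" "l + t \<le> \<alpha> (\<tau> t) \<bullet> b" by (auto simp: S)
    moreover have "\<alpha> (\<tau> t) \<bullet> b \<le> l + t"
    proof -
      have "\<exists>s\<ge>0. s \<le> \<tau> t \<and> \<alpha> s \<bullet> b = l + t"
        using ge t by (intro IVT' continuous_on_subset[OF cb]) (auto simp: l_def pathstart_def)
      then obtain s where s: "0 \<le> s" "s \<le> \<tau> t" "\<alpha> s \<bullet> b = l + t" by blast
      then have "s \<in> S t" using ge by (auto simp: S)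
      then have "\<tau> t \<le> s" unfolding \<tau>_def by (intro cInf_lower bdd)
      then have "s = \<tau> t" using s by simp
      then show ?thesis using s by simp
    qed
    ultimately show ?thesis by simp
  qed
  note * = this
  have "a (\<tau> t) = \<alpha> (\<tau> t)" if "t \<in> {0..w}" for t using *[OF that] by (simp add: a_def)
  then have "a (\<tau> t) \<in> path_image \<alpha> \<and> a (\<tau> t) \<bullet> b = pathstart \<alpha> \<bullet> b + t" if "t \<in> {0..w}" for t
    using *[OF that] that by (auto simp: path_image_def l_def)
  moreover have "(\<lambda>t. a (\<tau> t)) \<in> borel_measurable borel" by measurable
  ultimately show ?thesis using that by blast
qed

text \<open>The norm is at most the sum of the absolute coordinates, so one of them carries its
  share; the sign is absorbed into \<open>b\<close>.\<close>

lemma exists_unit_vector_component: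
  fixes v :: "'a::euclidean_space"
  obtains b where "norm b = 1" "norm v / DIM('a) \<le> v \<bullet> b"
proof -
  have "\<exists>i\<in>Basis. norm v / DIM('a) \<le> \<bar>v \<bullet> i\<bar>"
  proof (rule ccontr)
    assume "\<not> ?thesis"
    then have "(\<Sum>i\<in>Basis. \<bar>v \<bullet> i\<bar>) < (\<Sum>i\<in>(Basis :: 'a set). norm v / DIM('a))"
      by (intro sum_strict_mono) (auto simp: not_le)
    then show False using norm_le_l1[of v] by simp
  qed
  then obtain i where i: "i \<in> Basis" "norm v / DIM('a) \<le> \<bar>v \<bullet> i\<bar>" by blast
  show ?thesis
    using that[of i] that[of "- i"] i by (cases "v \<bullet> i \<ge> 0") auto
qed

text \<open>If every broken line had \<open>\<rho>\<close>-length at least \<open>1\<close>,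
  averaging over \<open>z\<close> in the ball and \<open>t\<close> in \<open>{0..w}\<close> would
  give \<open>V * R ^ n * w \<le> 2 * M\<close>, whereas \<open>\<kappa>\<close> and
  \<open>c\<close> make each of the two terms of \<open>2 * M\<close> at most a quarter of the left
  side. Both sides scale like \<open>R ^ (n + 1)\<close>, so \<open>c\<close> depends only on
  \<open>K\<close> and the dimension.\<close>

lemma loewner_estimate:
  assumes "0 < K"
  shows "\<exists>c>0. \<forall>(\<alpha> :: real \<Rightarrow> 'a::euclidean_space) \<beta> p R \<rho>.
    0 < R \<longrightarrow> path \<alpha> \<longrightarrow> path \<beta> \<longrightarrow> path_image \<alpha> \<subseteq> cball p R \<longrightarrow> path_image \<beta> \<subseteq> cball p R \<longrightarrow>
    R / K \<le> norm (pathfinish \<alpha> - pathstart \<alpha>) \<longrightarrow> R / K \<le> norm (pathfinish \<beta> - pathstart \<beta>) \<longrightarrow>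
    \<rho> \<in> borel_measurable borel \<longrightarrow> (\<integral>\<^sup>+x. \<rho> x ^ DIM('a) \<partial>lborel) < ennreal c \<longrightarrow>
    (\<exists>x\<in>path_image \<alpha>. \<exists>y\<in>path_image \<beta>. \<exists>z. seg_int \<rho> x z + seg_int \<rho> z y < 1)"
proof -
  define n where "n = DIM('a)"
  have n: "n \<ge> 1" by (simp add: n_def Suc_leI)
  define V where "V = unit_ball_vol (real n)"
  have V: "V > 0" by (simp add: V_def)
  \<comment> \<open>Solves \<open>c * (R ^ (n + 1) * (16 * n) ^ n) = V * R ^ n * w / 4\<close> with
    \<open>w = R / (K * n)\<close>; the radius cancels.\<close>
  define c where "c = V / (4 * K * n * (16 * n) ^ n)"
  have "c > 0" using V assms n by (simp add: c_def)
  moreover have "\<exists>x\<in>path_image \<alpha>. \<exists>y\<in>path_image \<beta>. \<exists>z. seg_int \<rho> x z + seg_int \<rho> z y < 1"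
    if R: "0 < R" and path: "path \<alpha>" "path \<beta>" and im: "path_image \<alpha> \<subseteq> cball p R" "path_image \<beta> \<subseteq> cball p R"
      and far: "R / K \<le> norm (pathfinish \<alpha> - pathstart \<alpha>)" "R / K \<le> norm (pathfinish \<beta> - pathstart \<beta>)"
      and [measurable]: "\<rho> \<in> borel_measurable borel" and small: "(\<integral>\<^sup>+x. \<rho> x ^ DIM('a) \<partial>lborel) < ennreal c"
    for \<alpha> \<beta> :: "real \<Rightarrow> 'a" and p R \<rho>
  proof (rule ccontr)
    assume none: "\<not> ?thesis"
    \<comment> \<open>The second segment is reversed so that both start on a path and the same
      average estimate serves for each.\<close>
    have big: "1 \<le> seg_int \<rho> x z + seg_int \<rho> y z" if "x \<in> path_image \<alpha>" "y \<in> path_image \<beta>" for x y z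
    proof -
      have "1 \<le> seg_int \<rho> x z + seg_int \<rho> z y"
        using none that by (meson not_less)
      then show ?thesis by (subst seg_int_commute) auto
    qed
    \<comment> \<open>A displacement of at least \<open>R / K\<close> has a component of at least
      \<open>R / K / n\<close> in some unit direction, so each path passes all levels
      \<open>l + t\<close> with \<open>t\<close> up to \<open>w\<close>.\<close>
    define w where "w = R / (K * n)"
    have w: "w > 0" using R assms n by (simp add: w_def)
    have wK: "w = R / K / n" by (simp add: w_def)
    have sel: "\<exists>e b l. e \<in> borel_measurable borel \<and> norm b = 1 \<and> (\<forall>t\<in>{0..w}. e t \<in> path_image g \<and> e t \<bullet> b = l + t)"
      if "path g" "R / K \<le> norm (pathfinish g - pathstart g)" for g :: "real \<Rightarrow> 'a"
    proof -
      obtain b where b: "norm b = 1" "norm (pathfinish g - pathstart g) / n \<le> (pathfinish g - pathstart g) \<bullet> b"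
        unfolding n_def by (rule exists_unit_vector_component)
      have "w \<le> norm (pathfinish g - pathstart g) / n"
        unfolding wK using that by (intro divide_right_mono) auto
      then show ?thesis
        using path_level_selection[OF that(1), of w b] b by (metis order_trans)
    qed
    obtain e b l where e[measurable]: "e \<in> borel_measurable borel" and "norm b = 1"
      and e': "\<And>t. t \<in> {0..w} \<Longrightarrow> e t \<in> path_image \<alpha> \<and> e t \<bullet> b = l + t"
      using sel[OF path(1) far(1)] by blast
    obtain f b' l' where f[measurable]: "f \<in> borel_measurable borel" and "norm b' = 1"
      and f': "\<And>t. t \<in> {0..w} \<Longrightarrow> f t \<in> path_image \<beta> \<and> f t \<bullet> b' = l' + t"
      using sel[OF path(2) far(2)] by blast
    \<comment> \<open>Makes the first term of \<open>2 * M\<close> equal to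
      \<open>V * R ^ n * w / 4\<close>.\<close>
    define \<kappa> where "\<kappa> = 1 / (16 * R * n)"
    have \<kappa>: "\<kappa> > 0" using R n by (simp add: \<kappa>_def)
    define N where "N = enn2real (\<integral>\<^sup>+x. \<rho> x ^ n \<partial>lborel)"
    have N: "(\<integral>\<^sup>+x. \<rho> x ^ n \<partial>lborel) = ennreal N" "0 \<le> N" "N < c"
    proof -
      have "(\<integral>\<^sup>+x. \<rho> x ^ n \<partial>lborel) < top"
        using small unfolding n_def by (rule less_trans) simp
      then show eq: "(\<integral>\<^sup>+x. \<rho> x ^ n \<partial>lborel) = ennreal N" by (simp add: N_def)
      show "0 \<le> N" by (simp add: N_def)
      then show "N < c" using small unfolding n_def[symmetric] eq by (simp add: ennreal_less_iff)
    qed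
    define M where "M = 2 * R * n * (\<kappa> * (V * R ^ n * w) + (1 / \<kappa>) ^ (n - 1) * (4 * R * N))"
    have vol: "emeasure lborel (cball p R) = ennreal (V * R ^ n)"
      using R by (simp add: emeasure_cball V_def n_def)
    have M0: "M \<ge> 0" using R N(2) V w \<kappa> by (simp add: M_def)
    have bound: "ennreal (2 * R * DIM('a)) *
      (ennreal \<kappa> * (emeasure lborel (cball p R) * ennreal w) +
       ennreal ((1 / \<kappa>) ^ (DIM('a) - 1)) * (ennreal (4 * R) * (\<integral>\<^sup>+x. \<rho> x ^ DIM('a) \<partial>lborel))) = ennreal M"
      unfolding n_def[symmetric] N(1) vol M_def using R N(2) V w \<kappa>
      by (simp add: ennreal_mult ennreal_plus)
    have ie: "(\<integral>\<^sup>+t\<in>{0..w}. (\<integral>\<^sup>+z\<in>cball p R. seg_int \<rho> (e t) z \<partial>lborel) \<partial>lborel) \<le> ennreal M"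
      unfolding bound[symmetric]
    proof (rule seg_int_average)
      show "e t \<in> cball p R \<and> e t \<bullet> b = l + t" if "t \<in> {0..w}" for t using e'[OF that] im by blast
    qed (use R \<kappa> w \<open>norm b = 1\<close> in auto)
    have "(\<integral>\<^sup>+t\<in>{0..w}. (\<integral>\<^sup>+z\<in>cball p R. seg_int \<rho> (f t) z \<partial>lborel) \<partial>lborel) \<le> ennreal M"
      unfolding bound[symmetric]
    proof (rule seg_int_average)
      show "f t \<in> cball p R \<and> f t \<bullet> b' = l' + t" if "t \<in> {0..w}" for t using f'[OF that] im by blast
    qed (use R \<kappa> w \<open>norm b' = 1\<close> in auto)
    with ie have "(\<integral>\<^sup>+t\<in>{0..w}. (\<integral>\<^sup>+z\<in>cball p R. seg_int \<rho> (e t) z \<partial>lborel) \<partial>lborel) +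
        (\<integral>\<^sup>+t\<in>{0..w}. (\<integral>\<^sup>+z\<in>cball p R. seg_int \<rho> (f t) z \<partial>lborel) \<partial>lborel) \<le> ennreal M + ennreal M"
      by (rule add_mono)
    also have "\<dots> = ennreal (2 * M)" using M0 by (simp flip: ennreal_plus)
    also have "(\<integral>\<^sup>+t\<in>{0..w}. (\<integral>\<^sup>+z\<in>cball p R. seg_int \<rho> (e t) z \<partial>lborel) \<partial>lborel) +
        (\<integral>\<^sup>+t\<in>{0..w}. (\<integral>\<^sup>+z\<in>cball p R. seg_int \<rho> (f t) z \<partial>lborel) \<partial>lborel) =
        (\<integral>\<^sup>+t\<in>{0..w}. (\<integral>\<^sup>+z\<in>cball p R. (seg_int \<rho> (e t) z + seg_int \<rho> (f t) z) \<partial>lborel) \<partial>lborel)"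
    proof -
      have [measurable]: "cball p R \<in> sets borel" by simp
      define A where "A t = (\<integral>\<^sup>+z\<in>cball p R. seg_int \<rho> (e t) z \<partial>lborel)" for t
      define B where "B t = (\<integral>\<^sup>+z\<in>cball p R. seg_int \<rho> (f t) z \<partial>lborel)" for t
      have [measurable]: "A \<in> borel_measurable borel" "B \<in> borel_measurable borel"
        unfolding A_def B_def by measurable
      have "(\<integral>\<^sup>+z\<in>cball p R. (seg_int \<rho> (e t) z + seg_int \<rho> (f t) z) \<partial>lborel) = A t + B t" for t
        unfolding distrib_right A_def B_def by (rule nn_integral_add) measurable
      moreover have "(\<integral>\<^sup>+t\<in>{0..w}. A t \<partial>lborel) + (\<integral>\<^sup>+t\<in>{0..w}. B t \<partial>lborel) =
          (\<integral>\<^sup>+t\<in>{0..w}. (A t + B t) \<partial>lborel)"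
        unfolding distrib_right by (rule nn_integral_add[symmetric]) measurable
      ultimately show ?thesis unfolding A_def B_def by (simp only:)
    qed
    finally have "(\<integral>\<^sup>+t\<in>{0..w}. (\<integral>\<^sup>+z\<in>cball p R. (seg_int \<rho> (e t) z + seg_int \<rho> (f t) z) \<partial>lborel) \<partial>lborel) \<le> ennreal (2 * M)" .
    moreover have "(\<integral>\<^sup>+t\<in>{0..w}. (\<integral>\<^sup>+z\<in>cball p R. 1 \<partial>lborel) \<partial>lborel) \<le>
        (\<integral>\<^sup>+t\<in>{0..w}. (\<integral>\<^sup>+z\<in>cball p R. (seg_int \<rho> (e t) z + seg_int \<rho> (f t) z) \<partial>lborel) \<partial>lborel)"
    proof (rule nn_integral_mono)
      fix t show "(\<integral>\<^sup>+z\<in>cball p R. 1 \<partial>lborel) * indicator {0..w} t \<le>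
        (\<integral>\<^sup>+z\<in>cball p R. (seg_int \<rho> (e t) z + seg_int \<rho> (f t) z) \<partial>lborel) * indicator {0..w} t"
      proof (cases "t \<in> {0..w}")
        case True
        then have "1 \<le> seg_int \<rho> (e t) z + seg_int \<rho> (f t) z" for z using big e' f' by blast
        then show ?thesis by (intro mult_right_mono nn_integral_mono) auto
      qed simp
    qed
    moreover have "(\<integral>\<^sup>+t\<in>{0..w}. (\<integral>\<^sup>+z\<in>cball p R. 1 \<partial>lborel) \<partial>lborel) = ennreal (V * R ^ n * w)"
      using w V R by (simp add: vol nn_integral_cmult flip: ennreal_mult)
    ultimately have "ennreal (V * R ^ n * w) \<le> ennreal (2 * M)" by (simp only: order_trans)
    then have "V * R ^ n * w \<le> 2 * M" using M0 by simp
    moreover have "2 * M = V * R ^ n * w / 4 + N * (R ^ (n + 1) * (16 * n) ^ n)"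
    proof -
      have e1: "2 * (2 * R * n * (\<kappa> * (V * R ^ n * w))) = V * R ^ n * w / 4"
        using R n by (simp add: \<kappa>_def)
      have "(1 / \<kappa>) ^ (n - 1) * (16 * R * n) = (16 * R * n) ^ n"
        using power_minus_mult[of n "16 * R * n"] n by (simp add: \<kappa>_def)
      then have e2: "2 * (2 * R * n * ((1 / \<kappa>) ^ (n - 1) * (4 * R * N))) = N * R * (16 * R * n) ^ n"
        by (simp add: algebra_simps)
      have e3: "(16 * R * n) ^ n = R ^ n * (16 * n) ^ n" by (simp add: power_mult_distrib)
      have "2 * M = 2 * (2 * R * n * (\<kappa> * (V * R ^ n * w))) + 2 * (2 * R * n * ((1 / \<kappa>) ^ (n - 1) * (4 * R * N)))"
        unfolding M_def by (simp only: distrib_left)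
      also have "\<dots> = V * R ^ n * w / 4 + N * (R ^ (n + 1) * (16 * n) ^ n)"
        unfolding e1 e2 e3 by simp
      finally show ?thesis .
    qed
    moreover have "N * (R ^ (n + 1) * (16 * n) ^ n) < c * (R ^ (n + 1) * (16 * n) ^ n)"
      using N R n by (intro mult_strict_right_mono) auto
    moreover have "c * (R ^ (n + 1) * (16 * n) ^ n) = V * R ^ n * w / 4"
      using R n assms by (simp add: c_def w_def mult_ac)
    moreover have "V * R ^ n * w > 0" using V R w by simp
    ultimately show False by linarith
  qed
  ultimately show ?thesis by blast
qed

section \<open>Finite mean oscillation\<close>

lemma measure_lebesgue_ball:
  fixes x0 :: "'a::euclidean_space"
  assumes "0 \<le> r"
  shows "measure lebesgue (ball x0 r) = unit_ball_vol (DIM('a)) * r ^ DIM('a)"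
  using content_ball[OF assms, of x0] by simp

text \<open>The deviation of \<open>\<phi>\<close> from its mean over the large ball, integrated
  over the half ball, is at most the oscillation integral over the large ball; the ratio of the
  volumes contributes the factor \<open>2 ^ n\<close> in \<open>C\<close>.\<close>

lemma fmo_at_ball_mean_halve:
  fixes \<phi> :: "'a::euclidean_space \<Rightarrow> real"
  assumes "fmo_at \<phi> x0"
  obtains \<delta> C where "0 < \<delta>" "0 \<le> C" "\<And>r. 0 < r \<Longrightarrow> r < \<delta> \<Longrightarrow> integrable (lebesgue_on (ball x0 r)) \<phi>"
    "\<And>r. 0 < r \<Longrightarrow> r < \<delta> \<Longrightarrow> ball_mean \<phi> x0 (r / 2) \<le> ball_mean \<phi> x0 r + C"
proof -
  let ?n = "DIM('a)"
  define osc where "osc r = ball_mean (\<lambda>x. \<bar>\<phi> x - ball_mean \<phi> x0 r\<bar>) x0 r" for r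
  have "Limsup (at_right 0) (\<lambda>r. ereal (osc r)) < \<infinity>"
    using assms by (simp add: fmo_at_def osc_def)
  then obtain c where "Limsup (at_right 0) (\<lambda>r. ereal (osc r)) < ereal c"
    using ereal_dense2 by blast
  then have "\<forall>\<^sub>F r in at_right 0. ereal (osc r) < ereal c" by (rule Limsup_lessD)
  moreover have "\<forall>\<^sub>F r in at_right 0. integrable (lebesgue_on (ball x0 r)) \<phi>"
    using assms by (simp add: fmo_at_def)
  ultimately have "\<forall>\<^sub>F r in at_right 0. osc r < c \<and> integrable (lebesgue_on (ball x0 r)) \<phi>"
    by eventually_elim simp
  then obtain \<delta> where \<delta>: "\<delta> > 0" "\<And>r. 0 < r \<Longrightarrow> r < \<delta> \<Longrightarrow> osc r < c \<and> integrable (lebesgue_on (ball x0 r)) \<phi>"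
    unfolding eventually_at_right[OF zero_less_one] by auto
  define C where "C = 2 ^ ?n * max c 0"
  show ?thesis
  proof (rule that[of \<delta> C])
    show "0 < \<delta>" "0 \<le> C" using \<delta> by (auto simp: C_def)
    fix r assume r: "0 < r" "r < \<delta>"
    show int: "integrable (lebesgue_on (ball x0 r)) \<phi>" using \<delta>(2)[OF r] by simp
    define m where "m = ball_mean \<phi> x0 r"
    define V where "V s = measure lebesgue (ball x0 s)" for s
    have V: "V s = unit_ball_vol ?n * s ^ ?n" if "s > 0" for s
      unfolding V_def using that by (intro measure_lebesgue_ball) simp
    have Vpos: "V s > 0" if "s > 0" for s using that by (simp add: V)
    have r2: "r / 2 > 0" "r / 2 < \<delta>" using r by auto
    have int2: "integrable (lebesgue_on (ball x0 (r / 2))) \<phi>" using \<delta>(2)[OF r2] by simp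
    have const: "integrable (lebesgue_on (ball x0 s)) (\<lambda>x. m)" for s
    proof -
      have "integrable lebesgue (indicat_real (ball x0 s))"
        using lmeasurable_ball lmeasurable_iff_integrable by blast
      then show ?thesis by (subst integrable_restrict_space) auto
    qed
    have cint: "integral\<^sup>L (lebesgue_on (ball x0 s)) (\<lambda>x. m) = m * V s" for s
      by (subst integral_restrict_space) (auto simp: V_def)
    have ab: "integrable (lebesgue_on (ball x0 s)) (\<lambda>x. \<bar>\<phi> x - m\<bar>)" if "integrable (lebesgue_on (ball x0 s)) \<phi>" for s
      using that const by auto
    have "integral\<^sup>L (lebesgue_on (ball x0 (r / 2))) \<phi> - m * V (r / 2) = integral\<^sup>L (lebesgue_on (ball x0 (r / 2))) (\<lambda>x. \<phi> x - m)"
      unfolding cint[symmetric] by (rule Bochner_Integration.integral_diff[OF int2 const, symmetric])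
    also have "\<dots> \<le> integral\<^sup>L (lebesgue_on (ball x0 (r / 2))) (\<lambda>x. \<bar>\<phi> x - m\<bar>)"
      by (intro integral_mono ab int2 Bochner_Integration.integrable_diff const) auto
    also have "\<dots> \<le> integral\<^sup>L (lebesgue_on (ball x0 r)) (\<lambda>x. \<bar>\<phi> x - m\<bar>)"
    proof -
      have "integrable lebesgue (\<lambda>x. indicator (ball x0 s) x *\<^sub>R \<bar>\<phi> x - m\<bar>)" if "integrable (lebesgue_on (ball x0 s)) \<phi>" for s
        using ab[OF that] by (subst (asm) integrable_restrict_space) auto
      from integral_mono[OF this[OF int2] this[OF int]] show ?thesis
        using r by (subst (1 2) integral_restrict_space)
          (auto simp: indicator_def split: if_splits)
    qed
    also have "\<dots> = osc r * V r"
      using Vpos[OF r(1)] by (simp add: osc_def ball_mean_def m_def V_def)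
    also have "\<dots> \<le> max c 0 * V r"
      using \<delta>(2)[OF r] Vpos[OF r(1)] by (intro mult_right_mono) auto
    also have "\<dots> = C * V (r / 2)" using r by (simp add: V C_def power_divide)
    finally have "integral\<^sup>L (lebesgue_on (ball x0 (r / 2))) \<phi> \<le> (m + C) * V (r / 2)"
      by (simp add: algebra_simps)
    then show "ball_mean \<phi> x0 (r / 2) \<le> ball_mean \<phi> x0 r + C"
      using Vpos[OF r2(1)] by (simp add: ball_mean_def[of \<phi> x0 "r / 2"] V_def m_def divide_le_eq)
  qed
qed

text \<open>The weight \<open>\<eta>\<close> equals a multiple of \<open>1 / (k + 1)\<close> times the inverse radius on the \<open>k\<close>-th dyadic ring.
  As the mean of \<open>Q\<close> over the \<open>k\<close>-th dyadic ball grows at most linearly in \<open>k\<close>, the integral is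
  bounded by a multiple of \<open>1 / H\<close>, where \<open>H\<close> is a partial sum of the harmonic series.\<close>

lemma fmo_at_small_ring_integral:
  fixes Q :: "'a::euclidean_space \<Rightarrow> real"
  assumes fmo: "fmo_at Q x0" and n2: "2 \<le> DIM('a)" and r2: "0 < r2" and \<epsilon>: "0 < \<epsilon>"
    and pos: "\<And>x. x \<in> ball x0 r2 \<Longrightarrow> 0 \<le> Q x"
  obtains r1 \<eta> where "0 < r1" "r1 < r2" "\<eta> \<in> borel_measurable borel"
    "1 \<le> (\<integral>\<^sup>+ r \<in> {r1<..<r2}. \<eta> r \<partial>lebesgue)"
    "(\<integral>\<^sup>+ x \<in> ring_domain x0 r1 r2. ennreal (Q x) * \<eta> (norm (x - x0)) ^ DIM('a) \<partial>lebesgue) \<le> ennreal \<epsilon>"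
proof -
  define n where "n = DIM('a)"
  obtain \<delta> C where \<delta>: "0 < \<delta>" "0 \<le> C" "\<And>r. 0 < r \<Longrightarrow> r < \<delta> \<Longrightarrow> integrable (lebesgue_on (ball x0 r)) Q"
    "\<And>r. 0 < r \<Longrightarrow> r < \<delta> \<Longrightarrow> ball_mean Q x0 (r / 2) \<le> ball_mean Q x0 r + C"
    using fmo_at_ball_mean_halve[OF fmo] by blast
  define r0 where "r0 = min r2 (\<delta> / 2)"
  have r0: "0 < r0" "r0 \<le> r2" "r0 < \<delta>" using \<delta>(1) r2 by (auto simp: r0_def)
  define r where "r k = r0 / 2 ^ k" for k
  have r: "0 < r k" "r k \<le> r0" "r (Suc k) = r k / 2" "r (Suc k) < r k" for k
  proof -
    show 1: "0 < r k" using r0 by (simp add: r_def)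
    show "r k \<le> r0" using r0 by (simp add: r_def divide_le_eq)
    show 2: "r (Suc k) = r k / 2" by (simp add: r_def)
    show "r (Suc k) < r k" unfolding 2 using 1 by simp
  qed
  have r_anti: "r j \<le> r k" if "k \<le> j" for j k
    using r0 that by (auto simp: r_def intro!: divide_left_mono power_increasing)
  \<comment> \<open>Dominates both the mean at the starting radius and the increment per halving,
    hence the linear bound below.\<close>
  define A where "A = \<bar>ball_mean Q x0 r0\<bar> + C"
  have A: "0 \<le> A" using \<delta> by (simp add: A_def)
  have mean: "ball_mean Q x0 (r k) \<le> A * (real k + 1)" for k
  proof -
    have "ball_mean Q x0 (r k) \<le> \<bar>ball_mean Q x0 r0\<bar> + C * real k"
    proof (induction k)
      case (Suc k)
      have "ball_mean Q x0 (r (Suc k)) \<le> ball_mean Q x0 (r k) + C"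
        unfolding r(3) using r(1,2)[of k] r0 by (intro \<delta>(4)) auto
      then show ?case using Suc by (simp add: algebra_simps)
    qed (simp add: r_def)
    also have "\<dots> \<le> A * (real k + 1)" using \<delta>(2) by (simp add: A_def algebra_simps)
    finally show ?thesis .
  qed
  define v where "v = unit_ball_vol (real n)"
  have v: "v > 0" by (simp add: v_def)
  define g where "g x = ennreal (indicator (ball x0 r0) x * Q x)" for x
  have int: "integrable lebesgue (\<lambda>x. indicator (ball x0 (r k)) x * Q x)" for k
  proof -
    have "integrable (lebesgue_on (ball x0 (r k))) Q" using r(1,2)[of k] r0 by (intro \<delta>(3)) auto
    then show ?thesis by (subst (asm) integrable_restrict_space) auto
  qed
  have g_meas[measurable]: "g \<in> borel_measurable lebesgue"
    using int[of 0] unfolding g_def by (simp add: r_def)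
  have gm: "(\<lambda>x. g x * indicator (ball x0 s) x) \<in> borel_measurable lebesgue" for s
    by (intro borel_measurable_times_ennreal g_meas borel_measurable_indicator) simp
  have gk: "(\<integral>\<^sup>+x. g x * indicator (ball x0 (r k)) x \<partial>lebesgue) \<le> ennreal (A * (real k + 1) * (v * r k ^ n))" for k
  proof -
    have "(\<integral>\<^sup>+x. g x * indicator (ball x0 (r k)) x \<partial>lebesgue) = (\<integral>\<^sup>+x. ennreal (indicator (ball x0 (r k)) x * Q x) \<partial>lebesgue)"
      using r(2)[of k] by (intro nn_integral_cong) (auto simp: g_def indicator_def)
    also have "\<dots> = ennreal (LINT x|lebesgue. indicator (ball x0 (r k)) x * Q x)"
      using pos r(2)[of k] r0 by (intro nn_integral_eq_integral int) (auto simp: indicator_def)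
    also have "(LINT x|lebesgue. indicator (ball x0 (r k)) x * Q x) = integral\<^sup>L (lebesgue_on (ball x0 (r k))) Q"
      by (subst integral_restrict_space) auto
    also have "\<dots> = ball_mean Q x0 (r k) * (v * r k ^ n)"
    proof -
      have "measure lebesgue (ball x0 (r k)) = v * r k ^ n"
        unfolding v_def n_def using r(1)[of k] by (intro measure_lebesgue_ball) simp
      then show ?thesis using v r(1)[of k] unfolding ball_mean_def by simp
    qed
    also have "ennreal \<dots> \<le> ennreal (A * (real k + 1) * (v * r k ^ n))"
      using v r(1)[of k] by (intro ennreal_leI mult_right_mono mean) auto
    finally show ?thesis .
  qed
  \<comment> \<open>The bound \<open>1\<close> allows \<open>H ^ n\<close> to be replaced by the
    square of \<open>H\<close>; the other makes the final value \<open>2 ^ n * A * v / H\<close> at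
    most \<open>\<epsilon>\<close>.\<close>
  obtain N where N: "harm N \<ge> max 1 (2 ^ n * A * v / \<epsilon>)"
    using harm_at_top unfolding filterlim_at_top eventually_sequentially by blast
  define H :: real where "H = harm N"
  have H: "H \<ge> 1" "2 ^ n * A * v / \<epsilon> \<le> H" using N by (auto simp: H_def)
  have H_sum: "H = (\<Sum>k<N. 1 / (real k + 1))"
    unfolding H_def harm_def by (rule sum.reindex_bij_witness[of _ Suc "\<lambda>k. k - 1"]) (auto simp: inverse_eq_divide)
  \<comment> \<open>The \<open>k\<close>-th ring has width \<open>r (Suc k)\<close>, so it
    contributes \<open>1 / ((k + 1) * H)\<close> to the integral of \<open>\<eta>\<close>, and these
    numbers sum to \<open>1\<close>.\<close>
  define a where "a k = 1 / (r (Suc k) * (real k + 1) * H)" for k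
  have a: "a k > 0" for k using H(1) r(1)[of "Suc k"] by (auto simp: a_def intro!: mult_pos_pos)
  \<comment> \<open>Open intervals are pairwise disjoint; at the dyadic radii themselves
    \<open>\<eta>\<close> is \<open>0\<close>, which does not affect its integral.\<close>
  define T where "T k = {r (Suc k)<..<r k}" for k
  define \<eta> where "\<eta> t = (\<Sum>k<N. ennreal (a k) * indicator (T k) t)" for t
  have \<eta>_T: "\<eta> t = ennreal (a j)" if "t \<in> T j" "j < N" for t j
  proof -
    have "t \<notin> T k" if "k \<noteq> j" for k
      using \<open>t \<in> T j\<close> that r_anti[of "Suc k" j] r_anti[of "Suc j" k]
      by (cases "k < j") (auto simp: T_def)
    then have "(\<Sum>k\<in>{..<N} - {j}. ennreal (a k) * indicator (T k) t) = 0" by (intro sum.neutral) auto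
    moreover have "\<eta> t = ennreal (a j) * indicator (T j) t + (\<Sum>k\<in>{..<N} - {j}. ennreal (a k) * indicator (T k) t)"
      unfolding \<eta>_def using that by (intro sum.remove) auto
    ultimately show ?thesis using that by simp
  qed
  show ?thesis
  proof (rule that[of "r N" \<eta>])
    show "0 < r N" by (rule r)
    have "N > 0" using H(1) H_sum by (cases N) auto
    then have "r N < r 0" using r(4)[of 0] r_anti[of 1 N] by auto
    then show "r N < r2" using r0 by (simp add: r_def)
    show "\<eta> \<in> borel_measurable borel"
      unfolding \<eta>_def T_def by measurable
    have "1 = (\<Sum>k<N. ennreal (a k * (r k - r (Suc k))))"
    proof -
      have "(\<Sum>k<N. a k * (r k - r (Suc k))) = (\<Sum>k<N. 1 / (real k + 1) / H)"
      proof (rule sum.cong)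
        fix k
        have "r k - r (Suc k) = r (Suc k)" by (simp add: r(3))
        then show "a k * (r k - r (Suc k)) = 1 / (real k + 1) / H"
          using r(1)[of "Suc k"] by (simp add: a_def)
      qed simp
      also have "\<dots> = 1" unfolding sum_divide_distrib[symmetric] H_sum[symmetric] using H by simp
      finally have sum1: "(\<Sum>k<N. a k * (r k - r (Suc k))) = 1" .
      have "0 \<le> a k * (r k - r (Suc k))" for k using a[of k] r(4)[of k] by simp
      then have "(\<Sum>k<N. ennreal (a k * (r k - r (Suc k)))) = ennreal (\<Sum>k<N. a k * (r k - r (Suc k)))"
        by (intro sum_ennreal)
      then show ?thesis unfolding sum1 by simp
    qed
    also have "\<dots> = (\<Sum>k<N. \<integral>\<^sup>+t. ennreal (a k) * indicator (T k) t \<partial>lebesgue)"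
    proof (rule sum.cong)
      fix k
      have "(\<integral>\<^sup>+t. ennreal (a k) * indicator (T k) t \<partial>lebesgue) = ennreal (a k) * ennreal (r k - r (Suc k))"
        using r(4)[of k] by (subst nn_integral_cmult_indicator) (auto simp: T_def)
      then show "ennreal (a k * (r k - r (Suc k))) = (\<integral>\<^sup>+t. ennreal (a k) * indicator (T k) t \<partial>lebesgue)"
        using a[of k] r(4)[of k] by (simp add: ennreal_mult)
    qed simp
    also have "\<dots> = (\<integral>\<^sup>+t. \<eta> t \<partial>lebesgue)"
      unfolding \<eta>_def T_def
      by (intro nn_integral_sum[symmetric] borel_measurable_times_ennreal borel_measurable_const
          borel_measurable_indicator) simp
    also have "\<dots> \<le> (\<integral>\<^sup>+ t \<in> {r N<..<r2}. \<eta> t \<partial>lebesgue)"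
    proof (rule nn_integral_mono)
      fix t
      have "\<eta> t = 0" if "t \<notin> {r N<..<r2}"
        unfolding \<eta>_def
      proof (rule sum.neutral, rule ballI)
        fix k assume "k \<in> {..<N}"
        then have "t \<notin> T k" using that r_anti[of "Suc k" N] r(2)[of k] r0 by (auto simp: T_def)
        then show "ennreal (a k) * indicator (T k) t = 0" by simp
      qed
      then show "\<eta> t \<le> \<eta> t * indicator {r N<..<r2} t" by (cases "t \<in> {r N<..<r2}") auto
    qed
    finally show "1 \<le> (\<integral>\<^sup>+ t \<in> {r N<..<r2}. \<eta> t \<partial>lebesgue)" .
    \<comment> \<open>Each ring is enlarged to the ball containing it, because the integral of
      \<open>Q\<close> over a ball is its mean times the volume.\<close>
    have pt: "ennreal (Q x) * \<eta> (norm (x - x0)) ^ n * indicator (ring_domain x0 (r N) r2) x \<le>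
        (\<Sum>k<N. ennreal (a k ^ n) * (g x * indicator (ball x0 (r k)) x))" for x
    proof (cases "\<exists>j<N. norm (x - x0) \<in> T j")
      case True
      then obtain j where j: "j < N" "norm (x - x0) \<in> T j" by blast
      then have xj: "x \<in> ball x0 (r j)" by (simp add: T_def dist_norm norm_minus_commute)
      have "ennreal (Q x) * \<eta> (norm (x - x0)) ^ n * indicator (ring_domain x0 (r N) r2) x \<le> ennreal (Q x) * ennreal (a j) ^ n"
        unfolding \<eta>_T[OF j(2,1)] by (auto simp: indicator_def)
      also have "\<dots> = ennreal (a j ^ n) * (g x * indicator (ball x0 (r j)) x)"
        using xj r(2)[of j] a[of j] by (auto simp: g_def ennreal_power less_imp_le mult.commute)
      also have "\<dots> \<le> (\<Sum>k<N. ennreal (a k ^ n) * (g x * indicator (ball x0 (r k)) x))"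
        using j by (intro member_le_sum) auto
      finally show ?thesis .
    next
      case False
      then have "\<eta> (norm (x - x0)) = 0" unfolding \<eta>_def by (intro sum.neutral) (auto simp: indicator_def)
      then show ?thesis by (simp add: n_def power_0_left)
    qed
    have "(\<integral>\<^sup>+ x \<in> ring_domain x0 (r N) r2. ennreal (Q x) * \<eta> (norm (x - x0)) ^ n \<partial>lebesgue)
        \<le> (\<integral>\<^sup>+x. (\<Sum>k<N. ennreal (a k ^ n) * (g x * indicator (ball x0 (r k)) x)) \<partial>lebesgue)"
      by (intro nn_integral_mono pt)
    also have "\<dots> = (\<Sum>k<N. ennreal (a k ^ n) * (\<integral>\<^sup>+x. g x * indicator (ball x0 (r k)) x \<partial>lebesgue))"
      by (subst nn_integral_sum) (auto intro!: sum.cong nn_integral_cmult gm borel_measurable_times_ennreal borel_measurable_const)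
    also have "\<dots> \<le> (\<Sum>k<N. ennreal (a k ^ n) * ennreal (A * (real k + 1) * (v * r k ^ n)))"
      by (intro sum_mono mult_left_mono gk) auto
    also have "\<dots> \<le> (\<Sum>k<N. ennreal (2 ^ n * A * v / H\<^sup>2 * (1 / (real k + 1))))"
    proof (rule sum_mono)
      fix k
      \<comment> \<open>As \<open>r k\<close> is twice \<open>r (Suc k)\<close>, the radii cancel.
        One factor \<open>k + 1\<close> from the mean meets \<open>(k + 1) ^ n\<close> in the
        denominator; \<open>n \<ge> 2\<close> leaves at most the harmonic term, whose sum
        \<open>H\<close> cancels one of the two factors \<open>H\<close>.\<close>
      have "(r (Suc k) * (real k + 1) * H) ^ n = r k ^ n * (real k + 1) ^ n * H ^ n / 2 ^ n"
        by (simp add: r(3) power_mult_distrib power_divide)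
      then have "a k ^ n * (A * (real k + 1) * (v * r k ^ n)) = 2 ^ n * A * v * (real k + 1) / ((real k + 1) ^ n * H ^ n)"
        using r(1)[of k] by (simp add: a_def power_divide)
      also have "\<dots> \<le> 2 ^ n * A * v * (real k + 1) / ((real k + 1)\<^sup>2 * H\<^sup>2)"
        using H(1) A v n2 unfolding n_def[symmetric]
        by (intro divide_left_mono mult_mono power_increasing) auto
      also have "\<dots> = 2 ^ n * A * v / H\<^sup>2 * (1 / (real k + 1))"
        by (simp add: power2_eq_square mult_ac)
      finally show "ennreal (a k ^ n) * ennreal (A * (real k + 1) * (v * r k ^ n)) \<le> ennreal (2 ^ n * A * v / H\<^sup>2 * (1 / (real k + 1)))"
        using a[of k] A v r(1)[of k] by (simp flip: ennreal_mult add: less_imp_le)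
    qed
    also have "\<dots> = ennreal (\<Sum>k<N. 2 ^ n * A * v / H\<^sup>2 * (1 / (real k + 1)))"
      using A v by (intro sum_ennreal) auto
    also have "(\<Sum>k<N. 2 ^ n * A * v / H\<^sup>2 * (1 / (real k + 1))) = 2 ^ n * A * v / H\<^sup>2 * H"
      unfolding H_sum by (rule sum_distrib_left[symmetric])
    also have "\<dots> = 2 ^ n * A * v / H" using H(1) by (simp add: power2_eq_square)
    also have "\<dots> \<le> \<epsilon>" using H \<epsilon> by (simp add: field_simps)
    finally show "(\<integral>\<^sup>+ x \<in> ring_domain x0 (r N) r2. ennreal (Q x) * \<eta> (norm (x - x0)) ^ DIM('a) \<partial>lebesgue) \<le> ennreal \<epsilon>"
      by (simp add: n_def ennreal_leI)
  qed
qed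

section \<open>Distortion of ring homeomorphisms\<close>

lemma dist_to_frontier_less_cball:
  fixes D :: "'a::euclidean_space set"
  assumes "x0 \<in> D" "0 \<le> r" "ennreal r < dist_to_frontier x0 D"
  shows "cball x0 r \<subseteq> D"
proof (rule ccontr)
  assume "\<not> ?thesis"
  then have "cball x0 r \<inter> frontier D \<noteq> {}"
  proof (intro connected_Int_frontier)
    have "x0 \<in> cball x0 r \<inter> D" using assms by simp
    then show "cball x0 r \<inter> D \<noteq> {}" by blast
  qed auto
  then obtain y where y: "y \<in> frontier D" "dist x0 y \<le> r" by auto
  have "dist_to_frontier x0 D \<le> ennreal (dist x0 y)"
    unfolding dist_to_frontier_def using y by (intro INF_lower)
  also have "\<dots> \<le> ennreal r" using y by (intro ennreal_leI)
  finally show False using assms by simp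
qed

lemma less_dist_to_frontier:
  assumes "open D" "ball x0 e \<subseteq> D" "r < e" "0 < e"
  shows "ennreal r < dist_to_frontier x0 D"
proof -
  have "ennreal e \<le> dist_to_frontier x0 D"
    unfolding dist_to_frontier_def
  proof (rule INF_greatest)
    fix y assume "y \<in> frontier D"
    then have "y \<notin> D" using assms(1) by (simp add: frontier_def interior_open)
    then have "e \<le> dist x0 y" using assms(2) by force
    then show "ennreal e \<le> ennreal (dist x0 y)" by (rule ennreal_leI)
  qed
  moreover have "ennreal r < ennreal e" using assms by (simp add: ennreal_less_iff ennreal_lessI)
  ultimately show ?thesis by (rule less_le_trans[rotated])
qed

lemma finite_homeomorphism_embedding:
  assumes "\<exists>g. homeomorphism D (f ` D) f g" "Infpt \<notin> f ` D"
  shows "continuous_on D (the_point \<circ> f)" "inj_on (the_point \<circ> f) D" "\<And>x. x \<in> D \<Longrightarrow> f x = Point ((the_point \<circ> f) x)"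
proof -
  obtain g where g: "homeomorphism D (f ` D) f g" using assms by blast
  show "continuous_on D (the_point \<circ> f)"
    using homeomorphism_cont1[OF g] assms(2) by (intro continuous_on_compose continuous_on_the_point)
  show eq: "f x = Point ((the_point \<circ> f) x)" if "x \<in> D" for x
    using assms(2) that by (cases "f x") force+
  show "inj_on (the_point \<circ> f) D"
  proof (rule inj_onI)
    fix x y assume xy: "x \<in> D" "y \<in> D" "(the_point \<circ> f) x = (the_point \<circ> f) y"
    then have "f x = f y" using eq[OF xy(1)] eq[OF xy(2)] by metis
    then show "x = y" using homeomorphism_apply1[OF g] xy by metis
  qed
qed

lemma image_eq_Point_image:
  "(\<And>x. x \<in> S \<Longrightarrow> f x = Point (g x)) \<Longrightarrow> f ` S = Point ` g ` S"
  by force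

text \<open>By the Loewner estimate, if \<open>f (cball x0 r1)\<close> were too large compared with its distance to an
  omitted value, the modulus of the image ring would exceed the bound provided by \<open>Q\<close>.\<close>

lemma ring_Q_homeo_distortion:
  fixes D :: "'a::euclidean_space set"
  assumes n: "2 \<le> DIM('a)" and D: "\<And>x. x \<in> D \<Longrightarrow> 0 < Q x" "Q \<in> FMO D"
    and x0: "x0 \<in> D" and r2: "0 < r2" "ennreal r2 < dist_to_frontier x0 D" and \<theta>: "0 < \<theta>" "\<theta> \<le> 1"
  obtains r1 where "0 < r1" "r1 < r2"
    "\<And>f g a x y. \<lbrakk>ring_Q_homeo_at D Q f x0; Infpt \<notin> f ` D; g = the_point \<circ> f;
      a \<in> cball x0 r1; x \<in> cball x0 r1; y \<notin> g ` cball x0 r2\<rbrakk> \<Longrightarrow> norm (g x - g a) \<le> \<theta> * norm (g a - y)"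
proof -
  have sub: "cball x0 r2 \<subseteq> D" using x0 r2 by (intro dist_to_frontier_less_cball) auto
  \<comment> \<open>Both paths will lie in a ball of radius \<open>2 * R0\<close>, and the smaller
    displacement will be \<open>\<theta> * R0\<close>.\<close>
  have K: "0 < 2 / \<theta>" using \<theta> by simp
  obtain c where c: "0 < c" "\<forall>(\<alpha> :: real \<Rightarrow> 'a) \<beta> p R \<rho>.
      0 < R \<longrightarrow> path \<alpha> \<longrightarrow> path \<beta> \<longrightarrow> path_image \<alpha> \<subseteq> cball p R \<longrightarrow> path_image \<beta> \<subseteq> cball p R \<longrightarrow>
      R / (2 / \<theta>) \<le> norm (pathfinish \<alpha> - pathstart \<alpha>) \<longrightarrow> R / (2 / \<theta>) \<le> norm (pathfinish \<beta> - pathstart \<beta>) \<longrightarrow>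
      \<rho> \<in> borel_measurable borel \<longrightarrow> (\<integral>\<^sup>+x. \<rho> x ^ DIM('a) \<partial>lborel) < ennreal c \<longrightarrow>
      (\<exists>x\<in>path_image \<alpha>. \<exists>y\<in>path_image \<beta>. \<exists>z. seg_int \<rho> x z + seg_int \<rho> z y < 1)"
    using loewner_estimate[where 'a='a, OF K] by (elim exE conjE)
  have nonneg: "0 \<le> Q x" if "x \<in> ball x0 r2" for x
  proof -
    have "x \<in> D" using sub that by (auto simp: subset_eq)
    then show ?thesis using D(1)[of x] by simp
  qed
  have fq: "fmo_at Q x0" using D(2) x0 by (simp add: FMO_def)
  \<comment> \<open>Half of \<open>c\<close> leaves room for a strict inequality, so that some
    admissible density has its integral below \<open>c\<close>.\<close>
  have c2: "0 < c / 2" using c(1) by simp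
  obtain r1 \<eta> where r1: "0 < r1" "r1 < r2" and \<eta>: "\<eta> \<in> borel_measurable borel"
    "1 \<le> (\<integral>\<^sup>+ r \<in> {r1<..<r2}. \<eta> r \<partial>lebesgue)"
    "(\<integral>\<^sup>+ x \<in> ring_domain x0 r1 r2. ennreal (Q x) * \<eta> (norm (x - x0)) ^ DIM('a) \<partial>lebesgue) \<le> ennreal (c / 2)"
    by (rule fmo_at_small_ring_integral[OF fq n r2(1) c2 nonneg])
  have \<eta>m: "\<eta> \<in> borel_measurable (lebesgue_on {r1<..<r2})"
    using \<eta>(1) by (intro measurable_restrict_space1 measurable_completion) simp
  show ?thesis
  proof (rule that[OF r1], rule ccontr)
    fix f g a x y
    assume f: "ring_Q_homeo_at D Q f x0" "Infpt \<notin> f ` D" and g_def: "g = the_point \<circ> f"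
      and ax: "a \<in> cball x0 r1" "x \<in> cball x0 r1" and y: "y \<notin> g ` cball x0 r2"
      and contra: "\<not> norm (g x - g a) \<le> \<theta> * norm (g a - y)"
    have ex: "\<exists>h. homeomorphism D (f ` D) f h" using f(1) by (simp add: ring_Q_homeo_at_def)
    note g = finite_homeomorphism_embedding[OF ex f(2), folded g_def]
    have gc: "continuous_on (cball x0 r2) g" "inj_on g (cball x0 r2)"
      using g sub by (auto intro: continuous_on_subset inj_on_subset)
    define R0 where "R0 = norm (g a - y)"
    have R0: "R0 > 0" using y ax r1 by (auto simp: R0_def)
    have "modulus (path_family (f ` sphere x0 r1) (f ` sphere x0 r2)) \<le> ennreal (c / 2)"
    proof -
      have "modulus (path_family (f ` sphere x0 r1) (f ` sphere x0 r2)) \<le>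
          (\<integral>\<^sup>+ x \<in> ring_domain x0 r1 r2. ennreal (Q x) * \<eta> (norm (x - x0)) ^ DIM('a) \<partial>lebesgue)"
        using f(1) r1 r2(2) \<eta>(2) \<eta>m unfolding ring_Q_homeo_at_def by blast
      then show ?thesis using \<eta>(3) by (rule order_trans)
    qed
    also have "\<dots> < ennreal c" using c(1) by (simp add: ennreal_less_iff)
    finally have "modulus (path_family (f ` sphere x0 r1) (f ` sphere x0 r2)) < ennreal c" .
    moreover have "f ` sphere x0 r1 = Point ` g ` sphere x0 r1" "f ` sphere x0 r2 = Point ` g ` sphere x0 r2"
      using r1 sub by (auto intro!: image_eq_Point_image g(3))
    ultimately obtain \<rho> where \<rho>: "\<rho> \<in> admissible (path_family (Point ` g ` sphere x0 r1) (Point ` g ` sphere x0 r2))"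
      "(\<integral>\<^sup>+x. \<rho> x ^ DIM('a) \<partial>lborel) < ennreal c"
      unfolding modulus_def INF_less_iff by auto
    have \<rho>m: "\<rho> \<in> borel_measurable borel" using \<rho>(1) by (simp add: admissible_def)
    have "path_connected (g ` cball x0 r1)"
      using r1 by (intro path_connected_continuous_image continuous_on_subset[OF gc(1)] convex_imp_path_connected) auto
    then obtain \<alpha>0 where \<alpha>0: "path \<alpha>0" "path_image \<alpha>0 \<subseteq> g ` cball x0 r1" "pathstart \<alpha>0 = g a" "pathfinish \<alpha>0 = g x"
      using ax unfolding path_connected_def by blast
    \<comment> \<open>The path is cut where it reaches the boundary of the ball of radius
      \<open>\<theta> * R0\<close>: its displacement is then exactly this radius, and it cannot
      leave the ball of the Loewner estimate.\<close>
    have "pathfinish \<alpha>0 \<notin> cball (g a) (\<theta> * R0)"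
      using contra \<alpha>0 by (simp add: R0_def dist_norm norm_minus_commute)
    moreover have "pathstart \<alpha>0 \<in> cball (g a) (\<theta> * R0)" using \<alpha>0 \<theta> R0 by simp
    ultimately obtain \<alpha> where \<alpha>': "path \<alpha>" "pathstart \<alpha> = pathstart \<alpha>0"
      "path_image \<alpha> \<subseteq> path_image \<alpha>0 \<inter> cball (g a) (\<theta> * R0)" "pathfinish \<alpha> \<in> frontier (cball (g a) (\<theta> * R0))"
      using exists_path_subpath_to_frontier_closed[OF closed_cball \<alpha>0(1)] by blast
    then have \<alpha>: "path \<alpha>" "pathstart \<alpha> = g a" "path_image \<alpha> \<subseteq> g ` cball x0 r1 \<inter> cball (g a) (\<theta> * R0)"
      "pathfinish \<alpha> \<in> frontier (cball (g a) (\<theta> * R0))"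
      using \<alpha>0 by auto
    have \<alpha>_end: "norm (pathfinish \<alpha> - pathstart \<alpha>) = \<theta> * R0"
      using \<alpha>(2,4) \<theta> R0 by (simp add: dist_norm norm_minus_commute)
    \<comment> \<open>The image is a topological ball, whose complement is path connected in
      dimension at least \<open>2\<close>; this provides a path from \<open>y\<close> to a point
      outside \<open>cball y R0\<close> that avoids the image.\<close>
    have hom: "g ` cball x0 r2 homeomorphic cball x0 r2"
      using homeomorphic_compact[OF compact_cball gc(1) refl gc(2)] by (rule homeomorphic_sym[THEN iffD1])
    have pc: "path_connected (- (g ` cball x0 r2))"
      by (rule path_connected_complement_homeomorphic_convex_compact[OF hom _ _ n]) auto
    have "bounded (g ` cball x0 r2)"
      using gc by (intro compact_imp_bounded compact_continuous_image) auto
    then have "bounded (g ` cball x0 r2 \<union> cball y R0)" by simp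
    then have "g ` cball x0 r2 \<union> cball y R0 \<noteq> UNIV" using not_bounded_UNIV by metis
    then obtain v where v: "v \<notin> g ` cball x0 r2" "v \<notin> cball y R0" by blast
    obtain \<beta>0 where \<beta>0: "path \<beta>0" "path_image \<beta>0 \<subseteq> - (g ` cball x0 r2)" "pathstart \<beta>0 = y" "pathfinish \<beta>0 = v"
      using pc y v(1) unfolding path_connected_def by blast
    have "pathstart \<beta>0 \<in> cball y R0" "pathfinish \<beta>0 \<notin> cball y R0" using \<beta>0 v R0 by simp_all
    then obtain \<beta> where \<beta>': "path \<beta>" "pathstart \<beta> = pathstart \<beta>0"
      "path_image \<beta> \<subseteq> path_image \<beta>0 \<inter> cball y R0" "pathfinish \<beta> \<in> frontier (cball y R0)"
      using exists_path_subpath_to_frontier_closed[OF closed_cball \<beta>0(1)] by blast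
    then have \<beta>: "path \<beta>" "pathstart \<beta> = y" "path_image \<beta> \<subseteq> - (g ` cball x0 r2) \<inter> cball y R0"
      "pathfinish \<beta> \<in> frontier (cball y R0)"
      using \<beta>0 by auto
    have \<beta>_end: "norm (pathfinish \<beta> - pathstart \<beta>) = R0"
      using \<beta>(2,4) R0 by (simp add: dist_norm norm_minus_commute)
    have "\<theta> * R0 \<le> 2 * R0" "\<theta> * R0 \<le> R0" using \<theta> R0 by (auto intro: mult_right_mono)
    then have im: "path_image \<alpha> \<subseteq> cball (g a) (2 * R0)" "path_image \<beta> \<subseteq> cball (g a) (2 * R0)"
    proof -
      show "path_image \<alpha> \<subseteq> cball (g a) (2 * R0)" using \<alpha>(3) \<open>\<theta> * R0 \<le> 2 * R0\<close> by force
      have "cball y R0 \<subseteq> cball (g a) (2 * R0)"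
        unfolding cball_subset_cball_iff by (simp add: R0_def dist_norm norm_minus_commute)
      then show "path_image \<beta> \<subseteq> cball (g a) (2 * R0)" using \<beta>(3) by blast
    qed
    have "\<exists>x\<in>path_image \<alpha>. \<exists>y\<in>path_image \<beta>. \<exists>z. seg_int \<rho> x z + seg_int \<rho> z y < 1"
    proof (rule c(2)[rule_format, OF _ \<alpha>(1) \<beta>(1) im _ _ \<rho>m \<rho>(2)])
      have "2 * R0 / (2 / \<theta>) = \<theta> * R0" using \<theta> by simp
      then show "2 * R0 / (2 / \<theta>) \<le> norm (pathfinish \<alpha> - pathstart \<alpha>)"
        "2 * R0 / (2 / \<theta>) \<le> norm (pathfinish \<beta> - pathstart \<beta>)"
        unfolding \<alpha>_end \<beta>_end using \<open>\<theta> * R0 \<le> R0\<close> by (auto simp: mult.commute)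
    qed (use R0 in simp)
    then obtain x' y' z where xyz: "x' \<in> path_image \<alpha>" "y' \<in> path_image \<beta>" "seg_int \<rho> x' z + seg_int \<rho> z y' < 1" by blast
    have "1 \<le> seg_int \<rho> x' z + seg_int \<rho> z y'"
      using xyz \<alpha>(3) \<beta>(3) by (intro admissible_broken_line[OF gc r1 \<rho>(1)]) auto
    then show False using xyz(3) by simp
  qed
qed

section \<open>Local bounds and normality\<close>

locale fmo_ring_class =
  fixes D :: "'a::euclidean_space set" and Q :: "'a \<Rightarrow> real" and x1 x2 y1 y2 :: 'a
  assumes dim: "2 \<le> DIM('a)" and open_D: "open D" and connected_D: "connected D"
    and Q_pos: "\<And>x. x \<in> D \<Longrightarrow> 0 < Q x" and Q_fmo: "Q \<in> FMO D"
    and x_in: "x1 \<in> D" "x2 \<in> D" and x_ne: "x1 \<noteq> x2" and y_ne: "y1 \<noteq> y2"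
begin

abbreviation \<F> where "\<F> \<equiv> ring_Q_class D Q x1 x2 y1 y2"

lemma class_at: "f \<in> \<F> \<Longrightarrow> x \<in> D \<Longrightarrow> ring_Q_homeo_at D Q f x"
  by (simp add: ring_Q_class_def ring_Q_homeo_def)

lemma class_finite: "f \<in> \<F> \<Longrightarrow> Infpt \<notin> f ` D"
  by (simp add: ring_Q_class_def)

lemma
  assumes "f \<in> \<F>"
  shows class_continuous: "continuous_on D (the_point \<circ> f)"
    and class_inj: "inj_on (the_point \<circ> f) D"
    and class_Point: "x \<in> D \<Longrightarrow> f x = Point ((the_point \<circ> f) x)"
proof -
  have "\<exists>g. homeomorphism D (f ` D) f g"
    using class_at[OF assms x_in(1)] by (simp add: ring_Q_homeo_at_def)
  note * = finite_homeomorphism_embedding[OF this class_finite[OF assms]]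
  show "continuous_on D (the_point \<circ> f)" "inj_on (the_point \<circ> f) D" "x \<in> D \<Longrightarrow> f x = Point ((the_point \<circ> f) x)"
    by (fact *)+
qed

lemma class_values: "f \<in> \<F> \<Longrightarrow> the_point (f x1) = y1" "f \<in> \<F> \<Longrightarrow> the_point (f x2) = y2"
  by (auto simp: ring_Q_class_def)

lemma small_radius:
  assumes "x0 \<in> D" "0 < d"
  obtains r where "0 < r" "r < d" "ennreal r < dist_to_frontier x0 D"
proof -
  obtain e where e: "0 < e" "ball x0 e \<subseteq> D" using open_D assms open_contains_ball by blast
  show ?thesis
    using that[of "min e d / 2"] less_dist_to_frontier[OF open_D e(2)] e assms by auto
qed

text \<open>At least one of \<open>x1\<close>, \<open>x2\<close> differs from \<open>x0\<close>, and
  by injectivity its prescribed value is omitted on a ball that does not reach it. The sum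
  \<open>norm y1 + norm y2\<close> bounds that value whichever it is.\<close>

lemma class_distortion:
  assumes x0: "x0 \<in> D" and \<theta>: "0 < \<theta>" "\<theta> \<le> 1"
  obtains r where "0 < r" "cball x0 r \<subseteq> D"
    "\<And>f a x. f \<in> \<F> \<Longrightarrow> a \<in> cball x0 r \<Longrightarrow> x \<in> cball x0 r \<Longrightarrow>
      norm (the_point (f x) - the_point (f a)) \<le> \<theta> * (norm (the_point (f a)) + (norm y1 + norm y2))"
proof -
  have "\<exists>z w. z \<in> D \<and> z \<noteq> x0 \<and> norm w \<le> norm y1 + norm y2 \<and> (\<forall>f\<in>\<F>. the_point (f z) = w)"
    using x_in x_ne class_values by (metis add_increasing add_increasing2 norm_ge_zero order_refl)
  then obtain z w where z: "z \<in> D" "z \<noteq> x0" "norm w \<le> norm y1 + norm y2" "\<And>f. f \<in> \<F> \<Longrightarrow> the_point (f z) = w"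
    by blast
  obtain r2 where r2: "0 < r2" "r2 < dist x0 z" "ennreal r2 < dist_to_frontier x0 D"
    using small_radius[OF x0, of "dist x0 z"] z(2) by auto
  have sub: "cball x0 r2 \<subseteq> D" using x0 r2 by (intro dist_to_frontier_less_cball) auto
  obtain r1 where r1: "0 < r1" "r1 < r2"
    "\<And>f g a x y. \<lbrakk>ring_Q_homeo_at D Q f x0; Infpt \<notin> f ` D; g = the_point \<circ> f;
      a \<in> cball x0 r1; x \<in> cball x0 r1; y \<notin> g ` cball x0 r2\<rbrakk> \<Longrightarrow> norm (g x - g a) \<le> \<theta> * norm (g a - y)"
    using ring_Q_homeo_distortion[OF dim Q_pos Q_fmo x0 r2(1,3) \<theta>] by blast
  show ?thesis
  proof (rule that[OF r1(1)])
    show "cball x0 r1 \<subseteq> D" using sub r1(2) by (meson less_imp_le order_trans subset_cball)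
    fix f a x assume f: "f \<in> \<F>" and ax: "a \<in> cball x0 r1" "x \<in> cball x0 r1"
    have "w \<notin> (the_point \<circ> f) ` cball x0 r2"
    proof
      assume "w \<in> (the_point \<circ> f) ` cball x0 r2"
      then obtain v where v: "v \<in> cball x0 r2" "(the_point \<circ> f) v = (the_point \<circ> f) z" using z(4)[OF f] by auto
      then have "v \<in> D" using sub by blast
      then have "v = z" using inj_onD[OF class_inj[OF f] v(2) _ z(1)] by blast
      then show False using \<open>v \<in> cball x0 r2\<close> r2(2) by simp
    qed
    then have "norm ((the_point \<circ> f) x - (the_point \<circ> f) a) \<le> \<theta> * norm ((the_point \<circ> f) a - w)"
      using r1(3)[OF class_at[OF f x0] class_finite[OF f] refl ax] by blast
    also have "\<dots> \<le> \<theta> * (norm (the_point (f a)) + (norm y1 + norm y2))"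
      using \<theta> z(3) norm_triangle_ineq4[of "the_point (f a)" w] by (intro mult_left_mono) auto
    finally show "norm (the_point (f x) - the_point (f a)) \<le> \<theta> * (norm (the_point (f a)) + (norm y1 + norm y2))" by simp
  qed
qed

text \<open>With \<open>\<theta> = 1\<close> the distortion inequality compares any two points of
  the ball, not only with its centre, which is the symmetric local condition that induction over a
  connected set asks for.\<close>

lemma class_pointwise_bounded:
  assumes "x \<in> D"
  shows "\<exists>M. \<forall>f\<in>\<F>. norm (the_point (f x)) \<le> M"
proof (rule connected_induction_simple[OF connected_D x_in(1) assms])
  show "\<exists>M. \<forall>f\<in>\<F>. norm (the_point (f x1)) \<le> M" using class_values by auto
  fix x0 assume "x0 \<in> D"
  then obtain r where r: "0 < r" "cball x0 r \<subseteq> D"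
    "\<And>f a x. f \<in> \<F> \<Longrightarrow> a \<in> cball x0 r \<Longrightarrow> x \<in> cball x0 r \<Longrightarrow>
      norm (the_point (f x) - the_point (f a)) \<le> 1 * (norm (the_point (f a)) + (norm y1 + norm y2))"
    using class_distortion[of x0 1] by (metis order_refl zero_less_one)
  show "\<exists>T. openin (top_of_set D) T \<and> x0 \<in> T \<and> (\<forall>x\<in>T. \<forall>y\<in>T.
      (\<exists>M. \<forall>f\<in>\<F>. norm (the_point (f x)) \<le> M) \<longrightarrow> (\<exists>M. \<forall>f\<in>\<F>. norm (the_point (f y)) \<le> M))"
  proof (intro exI[of _ "ball x0 r"] conjI ballI impI)
    show "openin (top_of_set D) (ball x0 r)"
      using r(2) open_D by (simp add: openin_open_eq) (meson ball_subset_cball order_trans)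
    fix a x assume ax: "a \<in> ball x0 r" "x \<in> ball x0 r" and "\<exists>M. \<forall>f\<in>\<F>. norm (the_point (f a)) \<le> M"
    then obtain M where M: "\<And>f. f \<in> \<F> \<Longrightarrow> norm (the_point (f a)) \<le> M" by blast
    have "norm (the_point (f x)) \<le> M + (M + (norm y1 + norm y2))" if "f \<in> \<F>" for f
      using r(3)[OF that, of a x] ax M[OF that] norm_triangle_sub[of "the_point (f x)" "the_point (f a)"] by auto
    then show "\<exists>M. \<forall>f\<in>\<F>. norm (the_point (f x)) \<le> M" by blast
  qed (use r in auto)
qed

lemma class_equicontinuous:
  assumes x: "x \<in> D" and e: "0 < e"
  shows "\<exists>d>0. ball x d \<subseteq> D \<and> (\<forall>f\<in>\<F>. \<forall>y\<in>ball x d. norm (the_point (f y) - the_point (f x)) < e)"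
proof -
  obtain M where M: "\<And>f. f \<in> \<F> \<Longrightarrow> norm (the_point (f x)) \<le> M" using class_pointwise_bounded[OF x] by blast
  define B where "B = \<bar>M\<bar> + (norm y1 + norm y2) + 1"
  have B: "B > 0" by (simp add: B_def add_nonneg_pos)
  \<comment> \<open>\<open>B\<close> exceeds the factor multiplying \<open>\<theta>\<close> in the
    distortion inequality, so the oscillation is at most \<open>e / 2\<close>.\<close>
  define \<theta> where "\<theta> = min 1 (e / (2 * B))"
  have \<theta>: "0 < \<theta>" "\<theta> \<le> 1" "\<theta> \<le> e / (2 * B)" using B e by (auto simp: \<theta>_def)
  obtain r where r: "0 < r" "cball x r \<subseteq> D"
    "\<And>f a z. f \<in> \<F> \<Longrightarrow> a \<in> cball x r \<Longrightarrow> z \<in> cball x r \<Longrightarrow>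
      norm (the_point (f z) - the_point (f a)) \<le> \<theta> * (norm (the_point (f a)) + (norm y1 + norm y2))"
    using class_distortion[OF x \<theta>(1,2)] by blast
  show ?thesis
  proof (intro exI[of _ r] conjI ballI)
    show "ball x r \<subseteq> D" using r(2) ball_subset_cball by blast
    fix f y assume f: "f \<in> \<F>" and y: "y \<in> ball x r"
    have "norm (the_point (f y) - the_point (f x)) \<le> \<theta> * (norm (the_point (f x)) + (norm y1 + norm y2))"
      using r y by (intro r(3)[OF f]) auto
    also have "\<dots> \<le> (e / (2 * B)) * B"
      using \<theta> M[OF f] by (intro mult_mono) (auto simp: B_def)
    also have "\<dots> < e" using B e by simp
    finally show "norm (the_point (f y) - the_point (f x)) < e" .
  qed (rule r)
qed

lemma class_locally_bounded:
  assumes K: "compact K" "K \<subseteq> D"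
  shows "\<exists>M. \<forall>f\<in>\<F>. \<forall>x\<in>K. norm (the_point (f x)) \<le> M"
proof -
  have "\<exists>d M. 0 < d \<and> (\<forall>f\<in>\<F>. \<forall>y\<in>ball x d. norm (the_point (f y)) \<le> M)" if x: "x \<in> K" for x
  proof -
    obtain M where M: "\<And>f. f \<in> \<F> \<Longrightarrow> norm (the_point (f x)) \<le> M" using class_pointwise_bounded K x by blast
    obtain d where d: "0 < d" "\<And>f y. f \<in> \<F> \<Longrightarrow> y \<in> ball x d \<Longrightarrow> norm (the_point (f y) - the_point (f x)) < 1"
      using class_equicontinuous[OF subsetD[OF K(2) x] zero_less_one] by blast
    have "norm (the_point (f y)) \<le> M + 1" if "f \<in> \<F>" "y \<in> ball x d" for f y
      using M[OF that(1)] d(2)[OF that] norm_triangle_sub[of "the_point (f y)" "the_point (f x)"] by linarith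
    then show ?thesis using d(1) by blast
  qed
  then obtain d M where d: "\<And>x. x \<in> K \<Longrightarrow> 0 < d x"
    "\<And>x f y. x \<in> K \<Longrightarrow> f \<in> \<F> \<Longrightarrow> y \<in> ball x (d x) \<Longrightarrow> norm (the_point (f y)) \<le> M x"
    by metis
  have "K \<subseteq> (\<Union>x\<in>K. ball x (d x))" using d(1) by force
  then obtain C where C: "C \<subseteq> K" "finite C" "K \<subseteq> (\<Union>x\<in>C. ball x (d x))"
    by (rule compactE_image[OF K(1) open_ball])
  have "norm (the_point (f y)) \<le> (\<Sum>x\<in>C. \<bar>M x\<bar>)" if f: "f \<in> \<F>" "y \<in> K" for f y
  proof -
    obtain x where x: "x \<in> C" "y \<in> ball x (d x)" using C f by blast
    have "norm (the_point (f y)) \<le> \<bar>M x\<bar>" using d(2)[of x f y] x f C by force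
    also have "\<dots> \<le> (\<Sum>x\<in>C. \<bar>M x\<bar>)" using x C by (intro member_le_sum) auto
    finally show ?thesis .
  qed
  then show ?thesis by blast
qed

text \<open>Arzela-Ascoli is applied on each set of a compact exhaustion and the subsequences are
  diagonalized. Convergence is obtained in the Euclidean norm; the chordal distance is no
  larger.\<close>

lemma class_normal: "normal_class D \<F>"
  unfolding normal_class_def
proof (intro allI impI)
  fix F :: "nat \<Rightarrow> 'a \<Rightarrow> 'a ext_space" assume F: "range F \<subseteq> \<F>"
  have "\<exists>C :: nat \<Rightarrow> 'a set. (\<forall>i. compact (C i)) \<and> (\<forall>i. C i \<subseteq> D) \<and>
      (\<forall>K. compact K \<and> K \<subseteq> D \<longrightarrow> (\<exists>N. \<forall>n\<ge>N. K \<subseteq> C n))"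
    by (rule open_Union_compact_subsets[OF open_D]) blast
  then obtain C :: "nat \<Rightarrow> 'a set" where C: "\<And>i. compact (C i)" "\<And>i. C i \<subseteq> D"
    and exhaust: "\<forall>K. compact K \<and> K \<subseteq> D \<longrightarrow> (\<exists>N. \<forall>n\<ge>N. K \<subseteq> C n)"
    by blast
  define G where "G n = the_point \<circ> F n" for n
  have Fn: "F n \<in> \<F>" for n using F by auto
  define P where "P i k \<longleftrightarrow> (\<exists>g. \<forall>e>0. \<exists>N. \<forall>n\<ge>N. \<forall>x\<in>C i. norm (G (k n) x - g x) < e)"
    for i and k :: "nat \<Rightarrow> nat"
  have sub: "\<exists>k. strict_mono (k :: nat \<Rightarrow> nat) \<and> P i (r \<circ> k)" for i r
  proof -
    obtain M where M: "\<And>f x. f \<in> \<F> \<Longrightarrow> x \<in> C i \<Longrightarrow> norm (the_point (f x)) \<le> M"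
      using class_locally_bounded[OF C(1,2)] by blast
    have bound: "norm (G (r n) x) \<le> M" if "x \<in> C i" for n x
      using M[OF Fn that] by (simp add: G_def)
    have equi: "\<exists>d>0. \<forall>n y. y \<in> C i \<and> norm (x - y) < d \<longrightarrow> norm (G (r n) x - G (r n) y) < e"
      if x: "x \<in> C i" and e: "0 < e" for x and e :: real
    proof -
      have "x \<in> D" using C(2) x by blast
      then obtain d where d: "d > 0" "\<And>f y. f \<in> \<F> \<Longrightarrow> y \<in> ball x d \<Longrightarrow> norm (the_point (f y) - the_point (f x)) < e"
        using class_equicontinuous[OF _ e] by blast
      show ?thesis
      proof (intro exI[of _ d] conjI allI impI)
        fix n y assume "y \<in> C i \<and> norm (x - y) < d"
        then have "norm (the_point (F (r n) y) - the_point (F (r n) x)) < e"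
          by (intro d(2) Fn) (simp add: dist_norm)
        then show "norm (G (r n) x - G (r n) y) < e" by (simp add: G_def norm_minus_commute)
      qed (rule d(1))
    qed
    obtain g k where "strict_mono (k :: nat \<Rightarrow> nat)" "\<And>e. 0 < e \<Longrightarrow> \<exists>N. \<forall>n x. n \<ge> N \<and> x \<in> C i \<longrightarrow> norm (G (r (k n)) x - g x) < e"
      using Arzela_Ascoli[OF C(1)[of i], of "\<lambda>n. G (r n)" M] bound equi by metis
    then show ?thesis unfolding P_def by (intro exI[of _ k] conjI exI[of _ g]) (auto, meson)
  qed
  \<comment> \<open>The diagonal sequence is only eventually drawn from the \<open>i\<close>-th
    subsequence, so \<open>P i\<close> has to survive changes of finitely many terms.\<close>
  have tail: "P i (r \<circ> k2)" if P1: "P i (r \<circ> k1)" and eventual: "\<And>j. N \<le> j \<Longrightarrow> \<exists>j'. j \<le> j' \<and> k2 j = k1 j'" for i r k1 k2 N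
  proof -
    obtain g where g: "\<And>e. e > 0 \<Longrightarrow> \<exists>N. \<forall>n\<ge>N. \<forall>x\<in>C i. norm (G (r (k1 n)) x - g x) < e"
      using P1 unfolding P_def by auto
    have "\<exists>N. \<forall>n\<ge>N. \<forall>x\<in>C i. norm (G (r (k2 n)) x - g x) < e" if e: "e > 0" for e
    proof -
      obtain N' where N': "\<And>n x. n \<ge> N' \<Longrightarrow> x \<in> C i \<Longrightarrow> norm (G (r (k1 n)) x - g x) < e" using g[OF e] by blast
      have "norm (G (r (k2 n)) x - g x) < e" if n: "n \<ge> max N N'" and x: "x \<in> C i" for n x
      proof -
        obtain j where "n \<le> j" "k2 n = k1 j" using eventual[of n] n by auto
        then show ?thesis using N'[of j x] n x by simp
      qed
      then show ?thesis by blast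
    qed
    then show ?thesis unfolding P_def by auto
  qed
  have "\<exists>k. strict_mono (k :: nat \<Rightarrow> nat) \<and> (\<forall>i. P i (id \<circ> k))"
  proof (rule subsequence_diagonalization_lemma[of P id, OF sub tail])
    fix k :: "nat \<Rightarrow> nat" assume k: "strict_mono k" "\<And>i. P i (id \<circ> k)"
    show "\<exists>k. strict_mono (k :: nat \<Rightarrow> nat) \<and> (\<forall>i. P i (id \<circ> k))"
      by (intro exI[of _ k] conjI allI k)
  qed
  then obtain k where k: "strict_mono (k :: nat \<Rightarrow> nat)" "\<And>i. P i (id \<circ> k)"
    by blast
  \<comment> \<open>The uniform limits on the sets \<open>C i\<close> come from separate existential
    statements; the pointwise limit glues them into one function.\<close>
  define g where "g x = lim (\<lambda>n. G (k n) x)" for x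
  have conv: "\<exists>N. \<forall>n\<ge>N. \<forall>x\<in>C i. norm (G (k n) x - g x) < e" if e: "e > 0" for e i
  proof -
    obtain h where h: "\<And>e. e > 0 \<Longrightarrow> \<exists>N. \<forall>n\<ge>N. \<forall>x\<in>C i. norm (G (k n) x - h x) < e"
      using k(2)[of i] unfolding P_def by auto
    have "g x = h x" if "x \<in> C i" for x
    proof -
      have "(\<lambda>n. G (k n) x) \<longlonglongrightarrow> h x"
        using h that unfolding LIMSEQ_iff by blast
      then show ?thesis unfolding g_def by (rule limI)
    qed
    then show ?thesis using h[OF e] by simp
  qed
  have "uniform_limit K (F \<circ> k) (\<lambda>x. Point (g x)) sequentially" if K: "compact K" "K \<subseteq> D" for K
  proof (rule uniform_limitI)
    fix e :: real assume e: "e > 0"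
    have "\<exists>N. \<forall>n\<ge>N. K \<subseteq> C n" using exhaust K by simp
    then obtain i where "\<forall>n\<ge>i. K \<subseteq> C n" ..
    then have i: "K \<subseteq> C i" by simp
    obtain N where N: "\<And>n x. n \<ge> N \<Longrightarrow> x \<in> C i \<Longrightarrow> norm (G (k n) x - g x) < e" using conv[OF e] by blast
    have "dist ((F \<circ> k) n x) (Point (g x)) < e" if "n \<ge> N" "x \<in> K" for n x
    proof -
      have "(F \<circ> k) n x = Point (G (k n) x)"
        unfolding G_def o_apply[of F k] using that K by (intro class_Point[OF Fn]) auto
      then have "dist ((F \<circ> k) n x) (Point (g x)) \<le> dist (G (k n) x) (g x)" by (simp add: dist_Point_le)
      also have "\<dots> < e" using N[of n x] that i by (auto simp: dist_norm)
      finally show ?thesis .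
    qed
    then show "\<forall>\<^sub>F n in sequentially. \<forall>x\<in>K. dist ((F \<circ> k) n x) (Point (g x)) < e"
      unfolding eventually_sequentially by blast
  qed
  then have "locally_uniform_limit D (F \<circ> k) (\<lambda>x. Point (g x))" by (simp add: locally_uniform_limit_def)
  then show "\<exists>(r :: nat \<Rightarrow> nat) f. strict_mono r \<and> locally_uniform_limit D (F \<circ> r) f"
    using k(1) by blast
qed

end

section \<open>Limits of ring homeomorphisms\<close>

text \<open>In contrast to \<open>nn_integral_cmult\<close>, no measurability is needed for this inequality.\<close>

lemma nn_integral_cmult_le:
  assumes "0 < c"
  shows "(\<integral>\<^sup>+x. ennreal c * f x \<partial>M) \<le> ennreal c * (\<integral>\<^sup>+x. f x \<partial>M)"
  unfolding nn_integral_def[of M "\<lambda>x. ennreal c * f x"]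
proof (rule SUP_least, clarsimp)
  fix s assume s: "simple_function M s" and "s \<le> (\<lambda>x. ennreal c * f x)"
  then have le: "s x \<le> ennreal c * f x" for x by (auto simp: le_fun_def)
  have inv: "ennreal c * (ennreal (1 / c) * y) = y" "ennreal (1 / c) * (ennreal c * y) = y" for y
    using assms by (simp_all flip: ennreal_mult mult.assoc)
  \<comment> \<open>The constant is split off the simple function below \<open>c * f\<close>, which
    is measurable even if \<open>f\<close> is not.\<close>
  have "integral\<^sup>S M s = (\<integral>\<^sup>+x. ennreal c * (ennreal (1 / c) * s x) \<partial>M)"
    unfolding inv by (rule nn_integral_eq_simple_integral[OF s, symmetric])
  also have "\<dots> = ennreal c * (\<integral>\<^sup>+x. ennreal (1 / c) * s x \<partial>M)"
    using borel_measurable_simple_function[OF s] by (intro nn_integral_cmult) auto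
  also have "\<dots> \<le> ennreal c * (\<integral>\<^sup>+x. f x \<partial>M)"
  proof (intro mult_left_mono nn_integral_mono)
    fix x have "ennreal (1 / c) * s x \<le> ennreal (1 / c) * (ennreal c * f x)"
      using le by (intro mult_left_mono) auto
    then show "ennreal (1 / c) * s x \<le> f x" unfolding inv .
  qed simp
  finally show "integral\<^sup>S M s \<le> ennreal c * (\<integral>\<^sup>+x. f x \<partial>M)" .
qed

text \<open>For finite \<open>M\<close> let \<open>t\<close> tend to \<open>1\<close> from the left;
  for \<open>M = top\<close> a single \<open>t\<close> already forces
  \<open>I = top\<close>.\<close>

lemma ennreal_le_of_mult_power_le:
  fixes M I :: ennreal
  assumes "\<And>t. 0 < t \<Longrightarrow> t < 1 \<Longrightarrow> M * ennreal (t ^ n) \<le> I"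
  shows "M \<le> I"
proof (cases "M = top")
  case True
  then have "I = top" using assms[of "1/2"] by (simp add: ennreal_top_mult top_unique)
  then show ?thesis by simp
next
  case False
  have "((\<lambda>t::real. ennreal (t ^ n)) \<longlongrightarrow> ennreal (1 ^ n)) (at_left 1)"
    by (intro tendsto_ennrealI tendsto_power tendsto_ident_at)
  then have "((\<lambda>t::real. M * ennreal (t ^ n)) \<longlongrightarrow> M * ennreal (1 ^ n)) (at_left 1)"
    using False by (intro ennreal_tendsto_cmult) (auto simp: less_top)
  moreover have "\<forall>\<^sub>F t in at_left (1::real). M * ennreal (t ^ n) \<le> I"
    unfolding eventually_at_left[OF zero_less_one] using assms by (intro exI[of _ 0]) auto
  ultimately have "M * ennreal (1 ^ n) \<le> I"
    by (rule tendsto_upperbound) simp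
  then show ?thesis by simp
qed

text \<open>If the modulus is bounded through slightly smaller rings, rescaling the weight and letting the
  smaller rings exhaust the full ring gives the bound for the full ring.\<close>

lemma modulus_bound_of_smaller_rings:
  fixes \<eta> :: "real \<Rightarrow> ennreal" and x0 :: "'a::euclidean_space"
  assumes r: "r1 < r2" and \<eta>: "\<eta> \<in> borel_measurable (lebesgue_on {r1<..<r2})"
    "1 \<le> (\<integral>\<^sup>+ r \<in> {r1<..<r2}. \<eta> r \<partial>lebesgue)"
    and bound: "\<And>s1 s2 \<zeta>. \<lbrakk>r1 < s1; s1 < s2; s2 < r2; \<zeta> \<in> borel_measurable (lebesgue_on {s1<..<s2});
      1 \<le> (\<integral>\<^sup>+ r \<in> {s1<..<s2}. \<zeta> r \<partial>lebesgue)\<rbrakk> \<Longrightarrow>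
      M \<le> (\<integral>\<^sup>+ x \<in> ring_domain x0 s1 s2. ennreal (Q x) * \<zeta> (norm (x - x0)) ^ DIM('a) \<partial>lebesgue)"
  shows "M \<le> (\<integral>\<^sup>+ x \<in> ring_domain x0 r1 r2. ennreal (Q x) * \<eta> (norm (x - x0)) ^ DIM('a) \<partial>lebesgue)"
    (is "M \<le> ?I")
proof (rule ennreal_le_of_mult_power_le[where n = "DIM('a)"])
  fix t :: real assume t: "0 < t" "t < 1"
  define d where "d = r2 - r1"
  have d: "d > 0" using r by (simp add: d_def)
  \<comment> \<open>The offset \<open>3\<close> keeps each cut within a third of the width, so
    \<open>a k < b k\<close> already for \<open>k = 0\<close>.\<close>
  define a where "a k = r1 + d / (real k + 3)" for k
  define b where "b k = r2 - d / (real k + 3)" for k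
  have ab: "r1 < a k" "a k < b k" "b k < r2" for k
  proof -
    have "d / (real k + 3) \<le> d / 3" using d by (intro divide_left_mono) auto
    then have "a k < b k" using d d_def unfolding a_def b_def by linarith
    then show "r1 < a k" "a k < b k" "b k < r2" using d by (auto simp: a_def b_def)
  qed
  have anti: "d / (real j + 3) \<le> d / (real k + 3)" if "k \<le> j" for j k
    using d that by (intro divide_left_mono) auto
  define h where "h k r = \<eta> r * indicator {a k<..<b k} r" for k r
  have \<eta>': "(\<lambda>r. \<eta> r * indicator {r1<..<r2} r) \<in> borel_measurable lebesgue"
    using \<eta>(1) by (subst (asm) borel_measurable_restrict_space_iff_ennreal) auto
  have h_eq: "h k r = (\<eta> r * indicator {r1<..<r2} r) * indicator {a k<..<b k} r" for k r
    using ab[of k] by (auto simp: h_def indicator_def)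
  have hm: "h k \<in> borel_measurable lebesgue" for k
    unfolding h_eq[abs_def] by (intro borel_measurable_times_ennreal \<eta>' borel_measurable_indicator) simp
  have "incseq h"
  proof (intro incseq_SucI le_funI)
    fix k r show "h k r \<le> h (Suc k) r"
      using anti[of k "Suc k"] by (auto simp: h_def indicator_def a_def b_def)
  qed
  have "(SUP k. h k r) = \<eta> r * indicator {r1<..<r2} r" for r
  proof (rule antisym)
    show "(SUP k. h k r) \<le> \<eta> r * indicator {r1<..<r2} r"
      by (rule SUP_least) (auto simp: h_eq indicator_def)
    show "\<eta> r * indicator {r1<..<r2} r \<le> (SUP k. h k r)"
    proof (cases "r \<in> {r1<..<r2}")
      case True
      then have "0 < min (r - r1) (r2 - r) / d" using d by auto
      then obtain k where k: "inverse (real (Suc k)) < min (r - r1) (r2 - r) / d"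
        using reals_Archimedean by blast
      have "d / (real k + 3) \<le> d * inverse (real (Suc k))"
        using d by (simp add: field_simps)
      also have "\<dots> < min (r - r1) (r2 - r)" using k d by (simp add: field_simps)
      finally have "r \<in> {a k<..<b k}" by (auto simp: a_def b_def)
      then have "\<eta> r * indicator {r1<..<r2} r \<le> h k r" using True by (simp add: h_def)
      also have "\<dots> \<le> (SUP k. h k r)" by (rule SUP_upper) simp
      finally show ?thesis .
    qed simp
  qed
  then have "(\<integral>\<^sup>+ r \<in> {r1<..<r2}. \<eta> r \<partial>lebesgue) = (\<integral>\<^sup>+r. (SUP k. h k r) \<partial>lebesgue)" by simp
  also have "\<dots> = (SUP k. \<integral>\<^sup>+r. h k r \<partial>lebesgue)"
    using \<open>incseq h\<close> hm by (rule nn_integral_monotone_convergence_SUP)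
  finally have "ennreal t < (SUP k. \<integral>\<^sup>+r. h k r \<partial>lebesgue)"
    using \<eta>(2) t by (metis ennreal_1 ennreal_less_iff less_imp_le order_less_le_trans)
  then obtain k where k: "ennreal t < (\<integral>\<^sup>+r. h k r \<partial>lebesgue)" unfolding less_SUP_iff by blast
  \<comment> \<open>The truncated weight has integral above \<open>t\<close>; dividing by
    \<open>t\<close> makes it admissible and costs the factor \<open>(1 / t) ^ n\<close>, which
    disappears as \<open>t\<close> tends to \<open>1\<close>.\<close>
  define \<zeta> where "\<zeta> r = ennreal (1 / t) * h k r" for r
  have \<zeta>m: "\<zeta> \<in> borel_measurable lebesgue"
    unfolding \<zeta>_def by (intro borel_measurable_times_ennreal hm borel_measurable_const)
  have "1 = ennreal (1 / t) * ennreal t" using t by (simp flip: ennreal_mult)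
  also have "\<dots> \<le> ennreal (1 / t) * (\<integral>\<^sup>+r. h k r \<partial>lebesgue)" using k by (intro mult_left_mono) auto
  also have "\<dots> = (\<integral>\<^sup>+r. \<zeta> r \<partial>lebesgue)" unfolding \<zeta>_def by (rule nn_integral_cmult[OF hm, symmetric])
  also have "\<dots> = (\<integral>\<^sup>+ r \<in> {a k<..<b k}. \<zeta> r \<partial>lebesgue)"
    by (intro nn_integral_cong) (auto simp: \<zeta>_def h_def indicator_def)
  finally have "M \<le> (\<integral>\<^sup>+ x \<in> ring_domain x0 (a k) (b k). ennreal (Q x) * \<zeta> (norm (x - x0)) ^ DIM('a) \<partial>lebesgue)"
    using ab[of k] \<zeta>m by (intro bound measurable_restrict_space1) auto
  also have "\<dots> \<le> (\<integral>\<^sup>+x. ennreal ((1 / t) ^ DIM('a)) *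
      (ennreal (Q x) * \<eta> (norm (x - x0)) ^ DIM('a) * indicator (ring_domain x0 r1 r2) x) \<partial>lebesgue)"
  proof (rule nn_integral_mono)
    fix x
    show "ennreal (Q x) * \<zeta> (norm (x - x0)) ^ DIM('a) * indicator (ring_domain x0 (a k) (b k)) x \<le>
        ennreal ((1 / t) ^ DIM('a)) * (ennreal (Q x) * \<eta> (norm (x - x0)) ^ DIM('a) * indicator (ring_domain x0 r1 r2) x)"
    proof (cases "x \<in> ring_domain x0 (a k) (b k)")
      case True
      then have x: "x \<in> ring_domain x0 r1 r2" "norm (x - x0) \<in> {a k<..<b k}" using ab[of k] by (auto simp: ring_domain_def)
      have "\<zeta> (norm (x - x0)) ^ DIM('a) = ennreal ((1 / t) ^ DIM('a)) * \<eta> (norm (x - x0)) ^ DIM('a)"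
        using x(2) t by (simp add: \<zeta>_def h_def power_mult_distrib ennreal_power)
      then show ?thesis using True x(1) by (simp add: mult_ac)
    qed simp
  qed
  also have "\<dots> \<le> ennreal ((1 / t) ^ DIM('a)) * ?I"
    using t by (intro nn_integral_cmult_le) simp
  finally have "M * ennreal (t ^ DIM('a)) \<le> (ennreal ((1 / t) ^ DIM('a)) * ?I) * ennreal (t ^ DIM('a))"
    by (rule mult_right_mono) simp
  also have "\<dots> = (ennreal ((1 / t) ^ DIM('a)) * ennreal (t ^ DIM('a))) * ?I" by (simp only: mult_ac)
  also have "ennreal ((1 / t) ^ DIM('a)) * ennreal (t ^ DIM('a)) = 1"
    using t by (simp add: power_one_over flip: ennreal_mult)
  finally show "M * ennreal (t ^ DIM('a)) \<le> ?I" by simp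
qed

section \<open>Limit maps and their Euclidean convergence\<close>

locale fmo_ring_limit = fmo_ring_class D Q x1 x2 y1 y2
  for D :: "'a::euclidean_space set" and Q x1 x2 y1 y2 +
  fixes F :: "nat \<Rightarrow> 'a \<Rightarrow> 'a ext_space" and f :: "'a \<Rightarrow> 'a ext_space"
  assumes F_class: "\<And>n. F n \<in> \<F>" and F_lim: "locally_uniform_limit D F f"
begin

definition G where "G n = the_point \<circ> F n"
definition g where "g = the_point \<circ> f"

lemma F_tendsto: "(\<lambda>n. F n x) \<longlonglongrightarrow> f x" if "x \<in> D"
proof -
  have "compact {x}" "{x} \<subseteq> D" using that by auto
  then have "uniform_limit {x} F f sequentially" using F_lim unfolding locally_uniform_limit_def by blast
  then show ?thesis by (rule tendsto_uniform_limitI) simp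
qed

lemma F_Point: "x \<in> D \<Longrightarrow> F n x = Point (G n x)"
  unfolding G_def by (rule class_Point[OF F_class])

lemma G_cont: "continuous_on D (G n)"
  unfolding G_def by (rule class_continuous[OF F_class])

lemma G_inj: "inj_on (G n) D"
  unfolding G_def by (rule class_inj[OF F_class])

text \<open>Boundedness at \<open>x\<close> keeps all \<open>F n x\<close> at a fixed positive
  chordal distance from \<open>Infpt\<close>.\<close>

lemma limit_finite:
  assumes x: "x \<in> D"
  shows "f x \<noteq> Infpt"
proof
  assume inf: "f x = Infpt"
  obtain M where M: "\<And>n. norm (G n x) \<le> M"
    using class_pointwise_bounded[OF x] F_class by (auto simp: G_def)
  have "1 / sqrt (1 + M\<^sup>2) \<le> dist (F n x) (f x)" for n
  proof -
    have "(norm (G n x))\<^sup>2 \<le> M\<^sup>2" using M by (intro power_mono) auto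
    then have "1 / sqrt (1 + M\<^sup>2) \<le> 1 / sqrt (1 + (norm (G n x))\<^sup>2)"
      by (intro divide_left_mono mult_pos_pos) (auto simp: add_pos_nonneg)
    then show ?thesis by (simp add: F_Point[OF x] inf dist_ext_space_def)
  qed
  moreover have "(\<lambda>n. dist (F n x) (f x)) \<longlonglongrightarrow> 0"
    using F_tendsto[OF x] by (simp add: tendsto_dist_iff[symmetric])
  ultimately have "1 / sqrt (1 + M\<^sup>2) \<le> 0"
    by (intro LIMSEQ_le_const[where X = "\<lambda>n. dist (F n x) (f x)"]) auto
  moreover have "0 < 1 / sqrt (1 + M\<^sup>2)" by (simp add: add_pos_nonneg)
  ultimately show False by linarith
qed

lemma f_Point: "x \<in> D \<Longrightarrow> f x = Point (g x)"
  using limit_finite[of x] by (cases "f x") (auto simp: g_def)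

text \<open>The values on \<open>K\<close> are bounded uniformly in \<open>n\<close>, so the
  constant in \<open>norm_diff_le_dist_Point\<close> can be chosen once for all points and
  indices.\<close>

lemma G_uniform_limit:
  assumes K: "compact K" "K \<subseteq> D"
  shows "uniform_limit K G g sequentially"
proof (rule uniform_limitI)
  fix e :: real assume e: "e > 0"
  obtain M where M: "\<And>n x. x \<in> K \<Longrightarrow> norm (G n x) \<le> M"
    using class_locally_bounded[OF K] F_class by (auto simp: G_def)
  define B where "B = 1 + \<bar>M\<bar>"
  have B: "B \<ge> 1" by (simp add: B_def)
  define d where "d = min (1 / (2 * B)) (e / (2 * B\<^sup>2))"
  have "d > 0" using B e by (simp add: d_def)
  moreover have "uniform_limit K F f sequentially" using F_lim K by (simp add: locally_uniform_limit_def)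
  ultimately have "\<forall>\<^sub>F n in sequentially. \<forall>x\<in>K. dist (F n x) (f x) < d" by (rule uniform_limitD[rotated])
  then show "\<forall>\<^sub>F n in sequentially. \<forall>x\<in>K. dist (G n x) (g x) < e"
  proof eventually_elim
    case (elim n)
    show ?case
    proof
      fix x assume x: "x \<in> K"
      then have xD: "x \<in> D" using K by blast
      define h where "h = dist (Point (G n x)) (Point (g x))"
      have h: "h < 1 / (2 * B)" "h < e / (2 * B\<^sup>2)" "0 \<le> h"
        using elim x by (auto simp: h_def d_def F_Point[OF xD] f_Point[OF xD])
      have nB: "1 + norm (G n x) \<le> B" using M[OF x, of n] by (simp add: B_def)
      have "h * (1 + norm (G n x)) \<le> 1 / (2 * B) * B"
        using h nB B by (intro mult_mono) auto
      also have "\<dots> = 1 / 2" using B by simp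
      finally have "norm (G n x - g x) \<le> 2 * h * (1 + norm (G n x))\<^sup>2"
        unfolding h_def by (rule norm_diff_le_dist_Point)
      also have "\<dots> \<le> 2 * h * B\<^sup>2"
        using nB h by (intro mult_left_mono power_mono) auto
      also have "\<dots> < e" using h(2) B by (simp add: field_simps)
      finally show "dist (G n x) (g x) < e" by (simp add: dist_norm)
    qed
  qed
qed

section \<open>Continuity and injectivity of the limit\<close>

lemma G_tendsto: "(\<lambda>n. G n x) \<longlonglongrightarrow> g x" if "x \<in> D"
  by (rule tendsto_uniform_limitI[OF G_uniform_limit[of "{x}"]]) (use that in auto)

lemma g_cont: "continuous_on D g"
proof (rule continuous_at_imp_continuous_on, rule ballI)
  fix x assume "x \<in> D"
  then obtain r where r: "r > 0" "cball x r \<subseteq> D" using open_D open_contains_cball by blast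
  have "continuous_on (cball x r) g"
    using r(2) by (intro uniform_limit_theorem[OF _ G_uniform_limit] always_eventually allI
        continuous_on_subset[OF G_cont]) auto
  then show "isCont g x"
    by (rule continuous_on_interior) (simp add: r)
qed

lemma g_values: "g x1 = y1" "g x2 = y2"
proof -
  have "(\<lambda>n. G n x1) = (\<lambda>_. y1)" "(\<lambda>n. G n x2) = (\<lambda>_. y2)"
    using class_values[OF F_class] by (auto simp: G_def)
  then show "g x1 = y1" "g x2 = y2"
    using G_tendsto[OF x_in(1)] G_tendsto[OF x_in(2)] by (auto simp: tendsto_const_iff)
qed

text \<open>On a ball about \<open>a\<close> not reaching \<open>b\<close>, the map
  \<open>G n\<close> omits \<open>G n b\<close>, so its oscillation near \<open>a\<close> is at most
  \<open>norm (G n a - G n b)\<close>, which tends to \<open>0\<close>. The radius \<open>r1\<close>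
  does not depend on \<open>n\<close>, which permits the passage to the limit.\<close>

lemma g_locally_constant:
  assumes a: "a \<in> D" and b: "b \<in> D" "b \<noteq> a" "g b = g a"
  shows "\<exists>r>0. ball a r \<subseteq> D \<and> (\<forall>x\<in>ball a r. g x = g a)"
proof -
  obtain r2 where r2: "0 < r2" "r2 < dist a b" "ennreal r2 < dist_to_frontier a D"
    using small_radius[OF a, of "dist a b"] b(2) by auto
  have sub: "cball a r2 \<subseteq> D" using a r2 by (intro dist_to_frontier_less_cball) auto
  obtain r1 where r1: "0 < r1" "r1 < r2"
    "\<And>f g c x y. \<lbrakk>ring_Q_homeo_at D Q f a; Infpt \<notin> f ` D; g = the_point \<circ> f;
      c \<in> cball a r1; x \<in> cball a r1; y \<notin> g ` cball a r2\<rbrakk> \<Longrightarrow> norm (g x - g c) \<le> 1 * norm (g c - y)"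
    using ring_Q_homeo_distortion[OF dim Q_pos Q_fmo a r2(1,3) zero_less_one order_refl] by blast
  have omit: "G n b \<notin> G n ` cball a r2" for n
  proof
    assume "G n b \<in> G n ` cball a r2"
    then obtain v where v: "v \<in> cball a r2" "G n b = G n v" by auto
    then have "v \<in> D" using sub by blast
    then have "b = v" using inj_onD[OF G_inj v(2) b(1)] by blast
    then show False using v r2(2) by simp
  qed
  show ?thesis
  proof (intro exI[of _ r1] conjI ballI)
    show "ball a r1 \<subseteq> D" using sub r1 by (meson ball_subset_cball less_imp_le order_trans subset_cball)
    fix x assume x: "x \<in> ball a r1"
    then have xD: "x \<in> D" using \<open>ball a r1 \<subseteq> D\<close> by blast
    have "norm (G n x - G n a) \<le> norm (G n a - G n b)" for n
      using r1(3)[OF class_at[OF F_class a] class_finite[OF F_class], of "G n" n a x "G n b"] omit x r1(1)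
      by (auto simp: G_def)
    moreover have "(\<lambda>n. norm (G n x - G n a)) \<longlonglongrightarrow> norm (g x - g a)"
      by (intro tendsto_intros G_tendsto xD a)
    moreover have "(\<lambda>n. norm (G n a - G n b)) \<longlonglongrightarrow> norm (g a - g b)"
      by (intro tendsto_intros G_tendsto b a)
    ultimately have "norm (g x - g a) \<le> norm (g a - g b)" by (intro LIMSEQ_le) auto
    then show "g x = g a" using b by simp
  qed (rule r1)
qed

text \<open>The set \<open>V\<close> where \<open>g\<close> equals \<open>g a\<close> on a whole
  neighbourhood is open. It is relatively closed because at a limit point \<open>x\<close>
  continuity gives \<open>g x = g a\<close>, and a point of \<open>V\<close> other than
  \<open>x\<close> shares this value, so \<open>g_locally_constant\<close> applies at
  \<open>x\<close>.\<close>

lemma g_inj: "inj_on g D"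
proof (rule inj_onI, rule ccontr)
  fix a b assume ab: "a \<in> D" "b \<in> D" "g a = g b" "a \<noteq> b"
  define P where "P x \<longleftrightarrow> (\<exists>r>0. ball x r \<subseteq> D \<and> (\<forall>y\<in>ball x r. g y = g a))" for x
  define V where "V = {x \<in> D. P x}"
  have P_eq: "g x = g a" if "P x" for x using that by (auto simp: P_def)
  have V_ball: "\<exists>r>0. ball x r \<subseteq> V" if "x \<in> V" for x
  proof -
    have "P x" using that by (simp add: V_def)
    then obtain r where r: "r > 0" "ball x r \<subseteq> D" "\<forall>y\<in>ball x r. g y = g a"
      unfolding P_def by (elim exE conjE)
    have "y \<in> V" if y: "y \<in> ball x r" for y
    proof -
      obtain s where "s > 0" "ball y s \<subseteq> ball x r" using open_ball y open_contains_ball by blast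
      moreover from this have "ball y s \<subseteq> D" "\<forall>z\<in>ball y s. g z = g a" using r by blast+
      moreover have "y \<in> D" using r y by blast
      ultimately show ?thesis unfolding V_def P_def by blast
    qed
    then show ?thesis using r(1) by blast
  qed
  then have "open V" using open_contains_ball by blast
  have "V \<subseteq> D" by (auto simp: V_def)
  have aV: "a \<in> V" using g_locally_constant[OF ab(1,2)] ab by (simp add: V_def P_def)
  have closed: "x \<in> V" if x: "x \<in> D" "x \<in> closure V" for x
  proof -
    have gx: "g x = g a"
    proof -
      have "V \<subseteq> {z \<in> D. g z \<in> {g a}}" using P_eq by (auto simp: V_def)
      moreover obtain T where T: "closed T" "{z \<in> D. g z \<in> {g a}} = D \<inter> T"
      proof -
        have "closedin (top_of_set D) (D \<inter> g -` {g a})"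
          by (intro continuous_closedin_preimage g_cont closed_singleton)
        then show ?thesis using that unfolding closedin_closed by (auto simp: vimage_def Int_def)
      qed
      ultimately have "closure V \<subseteq> T" by (intro closure_minimal) auto
      then have "x \<in> {z \<in> D. g z \<in> {g a}}" using x unfolding T by blast
      then show ?thesis by simp
    qed
    \<comment> \<open>If \<open>x\<close> is itself in \<open>V\<close>, openness supplies further
      points nearby, as no singleton is open; otherwise \<open>a\<close> will do.\<close>
    obtain v where v: "v \<in> V" "v \<noteq> x"
    proof (cases "x \<in> V")
      case True
      then obtain r where "r > 0" "ball x r \<subseteq> V" using V_ball by blast
      moreover have "ball x r \<noteq> {x}" using not_open_singleton[of x] open_ball by metis
      ultimately show ?thesis using that centre_in_ball by blast
    next
      case False
      then show ?thesis using that aV by blast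
    qed
    have "g v = g x" "v \<in> D" using gx v(1) P_eq[of v] by (auto simp: V_def)
    then have "\<exists>r>0. ball x r \<subseteq> D \<and> (\<forall>y\<in>ball x r. g y = g x)"
      using g_locally_constant[OF x(1), of v] v(2) by simp
    then show ?thesis using x(1) unfolding V_def P_def gx by blast
  qed
  have "closedin (top_of_set D) V"
    using closed \<open>V \<subseteq> D\<close> closure_subset by (auto simp: closedin_closed intro!: exI[of _ "closure V"])
  moreover have "openin (top_of_set D) V" using \<open>open V\<close> \<open>V \<subseteq> D\<close> open_D by (simp add: openin_open_eq)
  ultimately have "V = D" using connected_D aV unfolding connected_clopen by blast
  then have "g x1 = g a" "g x2 = g a" using x_in P_eq by (auto simp: V_def)
  then show False using g_values y_ne by simp
qed

text \<open>Invariance of domain makes the inverse of the injective limit continuous;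
  \<open>the_point\<close> transports it to the extended space.\<close>

lemma limit_homeomorphism: "\<exists>h. homeomorphism D (f ` D) f h"
proof -
  obtain k where k: "homeomorphism D (g ` D) g k"
    using invariance_of_domain_homeomorphism[OF open_D g_cont _ g_inj] by auto
  have "homeomorphism D (f ` D) f (k \<circ> the_point)"
  proof (rule homeomorphismI)
    have "continuous_on D (Point \<circ> g)" by (intro continuous_on_compose g_cont continuous_on_Point)
    then show "continuous_on D f" by (rule continuous_on_eq) (simp add: f_Point)
    have im: "the_point ` f ` D = g ` D" by (auto simp: g_def image_image)
    have "Infpt \<notin> f ` D" using limit_finite by (metis imageE)
    then show "continuous_on (f ` D) (k \<circ> the_point)"
      using homeomorphism_cont2[OF k] im by (intro continuous_on_compose continuous_on_the_point) simp_all
    show "f ` D \<subseteq> f ` D" by simp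
    show "(k \<circ> the_point) ` f ` D \<subseteq> D"
      using homeomorphism_image2[OF k] im by (metis image_comp order_refl)
    show "(k \<circ> the_point) (f x) = x" if "x \<in> D" for x
      using homeomorphism_apply1[OF k that] by (simp add: g_def)
    show "f ((k \<circ> the_point) y) = y" if "y \<in> f ` D" for y
      using that homeomorphism_apply1[OF k] by (auto simp: g_def)
  qed
  then show ?thesis by blast
qed

section \<open>The ring inequality for the limit\<close>

text \<open>For large \<open>n\<close> the ring \<open>s1 < |x - x0| < s2\<close> has an image under \<open>G n\<close> that separates the
  two boundary components of the image of the larger ring under the limit.\<close>

lemma limit_modulus_le:
  assumes x0: "x0 \<in> D" and sub: "cball x0 r2 \<subseteq> D" and r: "0 < r1" "r1 < s1" "s1 < s2" "s2 < r2"
  shows "\<exists>n. modulus (path_family (f ` sphere x0 r1) (f ` sphere x0 r2)) \<le>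
      modulus (path_family (F n ` sphere x0 s1) (F n ` sphere x0 s2))"
proof -
  have in_D: "cball x0 t \<subseteq> D" "sphere x0 t \<subseteq> D" if "t \<le> r2" for t using sub that by (auto simp: subset_eq)
  have comp: "compact (g ` S)" if "compact S" "S \<subseteq> D" for S
    using that by (intro compact_continuous_image continuous_on_subset[OF g_cont])
  have sep: "\<exists>d>0. \<forall>x\<in>S. \<forall>y\<in>T. d \<le> dist (g x) (g y)" if "compact S" "compact T" "S \<subseteq> D" "T \<subseteq> D" "S \<inter> T = {}" for S T
  proof -
    have "g ` S \<inter> g ` T = {}" using inj_on_image_Int[OF g_inj that(3,4)] that(5) by simp
    then show ?thesis
      using separate_compact_closed[OF comp[OF that(1,3)] compact_imp_closed[OF comp[OF that(2,4)]]] by auto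
  qed
  obtain d1 where d1: "d1 > 0" "\<And>x y. x \<in> cball x0 r1 \<Longrightarrow> y \<in> sphere x0 s1 \<Longrightarrow> d1 \<le> dist (g x) (g y)"
    using sep[of "cball x0 r1" "sphere x0 s1"] in_D r by fastforce
  obtain d2 where d2: "d2 > 0" "\<And>x y. x \<in> sphere x0 r2 \<Longrightarrow> y \<in> cball x0 s2 \<Longrightarrow> d2 \<le> dist (g x) (g y)"
    using sep[of "sphere x0 r2" "cball x0 s2"] in_D r by fastforce
  have "open (g ` ball x0 r1)"
  proof -
    have "ball x0 r1 \<subseteq> D" by (rule order_trans[OF ball_subset_cball in_D(1)]) (use r in linarith)
    then show ?thesis
      by (intro invariance_of_domain continuous_on_subset[OF g_cont] inj_on_subset[OF g_inj] open_ball)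
  qed
  moreover have "g x0 \<in> g ` ball x0 r1" using r by simp
  ultimately obtain d3 where d3: "d3 > 0" "ball (g x0) d3 \<subseteq> g ` ball x0 r1" unfolding open_contains_ball by blast
  \<comment> \<open>Closeness below \<open>d1\<close> keeps the \<open>g\<close>-image of the inner
    ball off the \<open>G n\<close>-image of the sphere of radius \<open>s1\<close>, below
    \<open>d2\<close> it keeps the \<open>g\<close>-image of the outer sphere off the
    \<open>G n\<close>-image of the ball of radius \<open>s2\<close>, and below \<open>d3\<close> it
    places \<open>G n x0\<close> in the \<open>g\<close>-image of the inner ball.\<close>
  define d where "d = min d1 (min d2 d3)"
  have "d > 0" using d1 d2 d3 by (simp add: d_def)
  then have "\<forall>\<^sub>F n in sequentially. \<forall>x\<in>cball x0 r2. dist (G n x) (g x) < d"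
    by (rule uniform_limitD[OF G_uniform_limit[OF compact_cball sub]])
  then obtain n where n: "\<And>x. x \<in> cball x0 r2 \<Longrightarrow> dist (G n x) (g x) < d"
    unfolding eventually_sequentially by blast
  have Gc: "continuous_on (cball x0 t) (G n)" "inj_on (G n) (cball x0 t)" if "t \<le> r2" for t
    using continuous_on_subset[OF G_cont in_D(1)[OF that]] inj_on_subset[OF G_inj in_D(1)[OF that]] by auto
  have outer: "g ` sphere x0 r2 \<inter> G n ` cball x0 s2 = {}"
  proof -
    have False if "x \<in> sphere x0 r2" "y \<in> cball x0 s2" "g x = G n y" for x y
      using d2(2)[OF that(1,2)] n[of y] that r by (auto simp: d_def dist_commute)
    then show ?thesis by blast
  qed
  \<comment> \<open>A connected set that contains \<open>G n x0\<close> but is not contained in the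
    image ball would meet its frontier, contrary to the choice of \<open>d1\<close>.\<close>
  have inner: "g ` cball x0 r1 \<subseteq> G n ` cball x0 s1"
  proof (rule ccontr)
    assume "\<not> ?thesis"
    moreover have "G n x0 \<in> ball (g x0) d3" using n[of x0] r by (auto simp: d_def dist_commute)
    then have "G n x0 \<in> g ` cball x0 r1" using d3(2) ball_subset_cball[of x0 r1] by blast
    moreover have "G n x0 \<in> G n ` cball x0 s1" using r by simp
    moreover have "connected (g ` cball x0 r1)"
      using in_D(1)[of r1] r by (intro connected_continuous_image continuous_on_subset[OF g_cont] connected_cball) auto
    ultimately have "g ` cball x0 r1 \<inter> frontier (G n ` cball x0 s1) \<noteq> {}"
      by (intro connected_Int_frontier) blast+
    then obtain x y where xy: "x \<in> cball x0 r1" "y \<in> sphere x0 s1" "g x = G n y"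
      using frontier_image_cball[OF Gc, of s1] r by force
    then show False using d1(2)[OF xy(1,2)] n[of y] r by (auto simp: d_def dist_commute)
  qed
  have "modulus (path_family (Point ` g ` sphere x0 r1) (Point ` g ` sphere x0 r2)) \<le>
      modulus (path_family (Point ` G n ` sphere x0 s1) (Point ` G n ` sphere x0 s2))"
  proof (rule modulus_le_of_ring_crossing)
    show "g ` sphere x0 r1 \<subseteq> G n ` cball x0 s1" using inner sphere_cball by blast
  qed (use Gc[of s2] r outer in auto)
  moreover have "f ` sphere x0 t = Point ` g ` sphere x0 t" "F n ` sphere x0 t = Point ` G n ` sphere x0 t"
    if "t \<le> r2" for t
    using in_D(2)[OF that] by (auto intro!: image_eq_Point_image f_Point F_Point)
  ultimately show ?thesis using r by (intro exI[of _ n]) simp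
qed

text \<open>The index supplied by \<open>limit_modulus_le\<close> may depend on \<open>s1\<close>
  and \<open>s2\<close>, but the bound in terms of \<open>Q\<close> is the same for every member of
  the class.\<close>

lemma limit_ring_Q_homeo_at:
  assumes x0: "x0 \<in> D"
  shows "ring_Q_homeo_at D Q f x0"
  unfolding ring_Q_homeo_at_def
proof (intro conjI allI impI limit_homeomorphism)
  fix r1 r2 :: real and \<eta> :: "real \<Rightarrow> ennreal"
  assume "0 < r1 \<and> r1 < r2 \<and> ennreal r2 < dist_to_frontier x0 D"
    and "\<eta> \<in> borel_measurable (lebesgue_on {r1<..<r2}) \<and> 1 \<le> (\<integral>\<^sup>+ r \<in> {r1<..<r2}. \<eta> r \<partial>lebesgue)"
  then have r: "0 < r1" "r1 < r2" "ennreal r2 < dist_to_frontier x0 D"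
    and \<eta>: "\<eta> \<in> borel_measurable (lebesgue_on {r1<..<r2})" "1 \<le> (\<integral>\<^sup>+ r \<in> {r1<..<r2}. \<eta> r \<partial>lebesgue)" by auto
  have sub: "cball x0 r2 \<subseteq> D" using x0 r by (intro dist_to_frontier_less_cball) auto
  show "modulus (path_family (f ` sphere x0 r1) (f ` sphere x0 r2)) \<le>
      (\<integral>\<^sup>+ x \<in> ring_domain x0 r1 r2. ennreal (Q x) * \<eta> (norm (x - x0)) ^ DIM('a) \<partial>lebesgue)"
  proof (rule modulus_bound_of_smaller_rings[OF r(2) \<eta>])
    fix s1 s2 and \<zeta> :: "real \<Rightarrow> ennreal"
    assume s: "r1 < s1" "s1 < s2" "s2 < r2" and \<zeta>: "\<zeta> \<in> borel_measurable (lebesgue_on {s1<..<s2})"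
      "1 \<le> (\<integral>\<^sup>+ r \<in> {s1<..<s2}. \<zeta> r \<partial>lebesgue)"
    obtain n where n: "modulus (path_family (f ` sphere x0 r1) (f ` sphere x0 r2)) \<le>
        modulus (path_family (F n ` sphere x0 s1) (F n ` sphere x0 s2))"
      using limit_modulus_le[OF x0 sub r(1) s] by blast
    have "ennreal s2 < dist_to_frontier x0 D"
      using r(3) s by (meson ennreal_leI le_less_trans less_imp_le)
    then have "modulus (path_family (F n ` sphere x0 s1) (F n ` sphere x0 s2)) \<le>
        (\<integral>\<^sup>+ x \<in> ring_domain x0 s1 s2. ennreal (Q x) * \<zeta> (norm (x - x0)) ^ DIM('a) \<partial>lebesgue)"
      using class_at[OF F_class x0, of n] r(1) s \<zeta> unfolding ring_Q_homeo_at_def by (meson less_trans)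
    with n show "modulus (path_family (f ` sphere x0 r1) (f ` sphere x0 r2)) \<le>
        (\<integral>\<^sup>+ x \<in> ring_domain x0 s1 s2. ennreal (Q x) * \<zeta> (norm (x - x0)) ^ DIM('a) \<partial>lebesgue)"
      by (rule order_trans)
  qed
qed

lemma limit_in_class: "f \<in> \<F>"
  using limit_ring_Q_homeo_at limit_finite f_Point[OF x_in(1)] f_Point[OF x_in(2)] g_values
  by (force simp: ring_Q_class_def ring_Q_homeo_def)

end

context fmo_ring_class
begin

lemma class_closed: "closed_class D \<F>"
  unfolding closed_class_def
proof (intro allI impI)
  fix F f assume "range F \<subseteq> \<F> \<and> locally_uniform_limit D F f"
  then interpret fmo_ring_limit D Q x1 x2 y1 y2 F f
    by unfold_locales auto
  show "f \<in> \<F>" by (rule limit_in_class)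
qed

end

theorem theorem7p1:
  fixes D :: "(real ^ 'n) set"
    and Q :: "real ^ 'n \<Rightarrow> real"
    and x1 x2 y1 y2 :: "real ^ 'n"
  assumes "CARD('n) \<ge> 2"
    and "open D" and "connected D"
    and "Q \<in> borel_measurable (lebesgue_on D)"
    and "\<And>x. x \<in> D \<Longrightarrow> 0 < Q x"
    and "x1 \<in> D" and "x2 \<in> D" and "x1 \<noteq> x2"
    and "y1 \<noteq> y2"
    and "Q \<in> FMO D"
  shows "compact_class D (ring_Q_class D Q x1 x2 y1 y2)"
proof -
  interpret fmo_ring_class D Q x1 x2 y1 y2
    using assms by unfold_locales auto
  show ?thesis unfolding compact_class_def using class_normal class_closed by blast
qed

end
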